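(* Let $n\ge1$. Then $\mathcal T=P\,\mathrm{BDO}\,P$ as subsets of $\mathcal L(F_1^2)$, where $P\,\mathrm{BDO}\,P=\{PAP|_{F_1^2}: A\in\mathrm{BDO}\}$.
   Context: Let $V$ be Lebesgue measure on $\mathbb{C}^n$, $d\mu_1(z)=\pi^{-n}e^{-|z|^2}dV(z)$, $L_1^2=L^2(\mathbb{C}^n,\mu_1)$, and let $F_1^2=L_1^2\cap\mathrm{Hol}(\mathbb{C}^n)$ be the Fock space, with $P:L_1^2\to F_1^2$ the orthogonal projection. $\mathcal L(X)$ denotes the bounded operators on $X$, and $M_f$ denotes multiplication by $f$. For $f\in L^\infty(\mathbb{C}^n)$ the Toeplitz operator is $T_f=PM_f|_{F_1^2}$. The Toeplitz algebra $\mathcal T$ is the $C^*$ algebra in $\mathcal L(F_1^2)$ generated by $\{T_f: f\in L^\infty(\mathbb{C}^n)\}$. An operator $A\in\mathcal L(L_1^2)$ is a band operator if there is $\omega>0$ such that $M_fAM_g=0$ for all $f,g\in L^\infty(\mathbb{C}^n)$ with $d(\operatorname{supp}f,\operatorname{supp}g)>\omega$, where $d$ is the Euclidean distance (between sets) and supports are essential supports. $\mathrm{BDO}$, the set of band-dominated operators, is the norm closure in $\mathcal L(L_1^2)$ of the set of all band operators. *)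

theory Defs
  imports "HOL-Analysis.Analysis"
begin

section \<open>Complex inner product spaces\<close>

text \<open>The underlying real inner product is the real part of the complex one, so that the norm and
  the library's type of bounded (real-)linear operators, with its operator norm, are available.\<close>

class complex_inner = real_inner +
  fixes scaleC :: "complex \<Rightarrow> 'a \<Rightarrow> 'a"
    and cinner :: "'a \<Rightarrow> 'a \<Rightarrow> complex"
  assumes scaleC_add_right: "scaleC a (x + y) = scaleC a x + scaleC a y"
    and scaleC_add_left: "scaleC (a + b) x = scaleC a x + scaleC b x"
    and scaleC_scaleC: "scaleC a (scaleC b x) = scaleC (a * b) x"
    and scaleC_of_real: "scaleC (complex_of_real r) x = r *\<^sub>R x"
    and cinner_commute: "cinner x y = cnj (cinner y x)"
    and cinner_add_left: "cinner (x + y) z = cinner x z + cinner y z"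
    and cinner_scaleC_left: "cinner (scaleC a x) y = a * cinner x y"
    and inner_eq_Re_cinner: "inner x y = Re (cinner x y)"

lemma scaleC_one [simp]: "scaleC 1 x = x"
  using scaleC_of_real[of 1 x] by simp

lemma cinner_scaleC_right: "cinner x (scaleC a y) = cnj a * cinner x y"
  by (metis cinner_commute cinner_scaleC_left complex_cnj_mult)

lemma cinner_self: "cinner x x = complex_of_real ((norm x)\<^sup>2)"
proof (rule complex_eqI)
  show "Re (cinner x x) = Re (complex_of_real ((norm x)\<^sup>2))"
    by (simp add: inner_eq_Re_cinner[symmetric] dot_square_norm)
  show "Im (cinner x x) = Im (complex_of_real ((norm x)\<^sup>2))"
    using cinner_commute[of x x] by (simp add: complex_eq_iff)
qed

lemma norm_scaleC: "norm (scaleC a x) = norm a * norm x"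
proof -
  have "complex_of_real ((norm (scaleC a x))\<^sup>2) = (a * cnj a) * cinner x x"
    unfolding cinner_self[symmetric] by (simp add: cinner_scaleC_left cinner_scaleC_right)
  also have "\<dots> = complex_of_real ((norm a * norm x)\<^sup>2)"
    by (simp only: cinner_self complex_norm_square[symmetric] of_real_mult[symmetric]
        of_real_power[symmetric] power_mult_distrib)
  finally have "(norm (scaleC a x))\<^sup>2 = (norm a * norm x)\<^sup>2"
    by (simp only: of_real_eq_iff)
  then show ?thesis
    by (simp add: power2_eq_iff_nonneg)
qed

text \<open>\<open>operators\<close> is the set of bounded complex-linear operators.\<close>

definition operators :: "('a::complex_inner \<Rightarrow>\<^sub>L 'a) set" where
  "operators = {A. \<forall>c x. blinfun_apply A (scaleC c x) = scaleC c (blinfun_apply A x)}"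

lift_definition scaleC_op :: "complex \<Rightarrow> ('a::complex_inner \<Rightarrow>\<^sub>L 'a) \<Rightarrow> 'a \<Rightarrow>\<^sub>L 'a"
  is "\<lambda>c A x. scaleC c (A x)"
proof -
  fix c :: complex and A :: "'a \<Rightarrow> 'a"
  assume "bounded_linear A"
  moreover have "bounded_linear (scaleC c :: 'a \<Rightarrow> 'a)"
  proof (rule bounded_linear_intro[where K = "norm c"])
    fix r :: real and x :: 'a
    have "scaleC c (r *\<^sub>R x) = scaleC (c * complex_of_real r) x"
      by (simp add: scaleC_of_real[symmetric] scaleC_scaleC)
    also have "\<dots> = r *\<^sub>R scaleC c x"
      by (simp add: scaleC_of_real[symmetric] scaleC_scaleC mult.commute)
    finally show "scaleC c (r *\<^sub>R x) = r *\<^sub>R scaleC c x" .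
  qed (simp_all add: scaleC_add_right norm_scaleC mult.commute)
  ultimately show "bounded_linear (\<lambda>x. scaleC c (A x))"
    using bounded_linear_compose by blast
qed

text \<open>There is at most one adjoint, and on a complete space there is one.\<close>

definition hadjoint :: "('a::complex_inner \<Rightarrow>\<^sub>L 'a) \<Rightarrow> 'a \<Rightarrow>\<^sub>L 'a" where
  "hadjoint A = (THE B. \<forall>x y. cinner (blinfun_apply A x) y = cinner x (blinfun_apply B y))"

definition c_star_subalgebra :: "('a::complex_inner \<Rightarrow>\<^sub>L 'a) set \<Rightarrow> bool" where
  "c_star_subalgebra S \<longleftrightarrow>
     S \<subseteq> operators \<and> 0 \<in> S \<and>
     (\<forall>A\<in>S. \<forall>B\<in>S. A + B \<in> S) \<and>
     (\<forall>c. \<forall>A\<in>S. scaleC_op c A \<in> S) \<and>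
     (\<forall>A\<in>S. \<forall>B\<in>S. A o\<^sub>L B \<in> S) \<and>
     (\<forall>A\<in>S. hadjoint A \<in> S) \<and>
     closed S"

definition c_star_generated :: "('a::complex_inner \<Rightarrow>\<^sub>L 'a) set \<Rightarrow> ('a \<Rightarrow>\<^sub>L 'a) set" where
  "c_star_generated G = \<Inter>{S. c_star_subalgebra S \<and> G \<subseteq> S}"


section \<open>The Hilbert space of Gaussian square-integrable functions\<close>

definition gauss :: "(complex ^ 'n::finite) measure" where
  "gauss = density lborel (\<lambda>z. ennreal (exp (- (norm z)\<^sup>2) / pi ^ CARD('n)))"

lemma sets_gauss [simp, measurable_cong]: "sets gauss = sets borel"
  by (simp add: gauss_def)

lemma space_gauss [simp]: "space gauss = UNIV"
  by (simp add: gauss_def)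

lemma AE_gauss_iff: "(AE z in gauss. Q z) \<longleftrightarrow> (AE z in lborel. Q z)"
  unfolding gauss_def by (subst AE_density) simp_all

definition sq_integrable :: "(complex ^ 'n::finite \<Rightarrow> complex) \<Rightarrow> bool" where
  "sq_integrable f \<longleftrightarrow> f \<in> borel_measurable gauss \<and> integrable gauss (\<lambda>z. (norm (f z))\<^sup>2)"

lemma sq_integrable_measurable [measurable_dest]:
  "sq_integrable f \<Longrightarrow> f \<in> borel_measurable gauss"
  by (simp add: sq_integrable_def)

lemma measurable_cnj [measurable]: "cnj \<in> borel_measurable borel"
  by (intro borel_measurable_continuous_onI continuous_intros)

lemma sq_integrable_zero: "sq_integrable (\<lambda>_. 0)"
  by (simp add: sq_integrable_def)

lemma sq_integrable_bounded_mult: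
  assumes f: "sq_integrable f" and g [measurable]: "g \<in> borel_measurable gauss"
    and b: "AE z in gauss. norm (g z) \<le> C"
  shows "sq_integrable (\<lambda>z. g z * f z)"
proof -
  note [measurable] = sq_integrable_measurable[OF f]
  have "integrable gauss (\<lambda>z. C\<^sup>2 * (norm (f z))\<^sup>2)"
    using f by (simp add: sq_integrable_def)
  then have "integrable gauss (\<lambda>z. (norm (g z * f z))\<^sup>2)"
  proof (rule Bochner_Integration.integrable_bound)
    show "AE z in gauss. norm ((norm (g z * f z))\<^sup>2) \<le> norm (C\<^sup>2 * (norm (f z))\<^sup>2)"
      using b by eventually_elim
        (simp add: norm_mult power_mult_distrib mult_right_mono power_mono)
  qed measurable
  then show ?thesis
    by (simp add: sq_integrable_def)
qed

lemma sq_integrable_cmult: "sq_integrable f \<Longrightarrow> sq_integrable (\<lambda>z. c * f z)"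
  by (rule sq_integrable_bounded_mult[where C = "norm c"]) simp_all

lemma sq_integrable_add:
  assumes f: "sq_integrable f" and g: "sq_integrable g"
  shows "sq_integrable (\<lambda>z. f z + g z)"
proof -
  note [measurable] = sq_integrable_measurable[OF f] sq_integrable_measurable[OF g]
  have "integrable gauss (\<lambda>z. 2 * (norm (f z))\<^sup>2 + 2 * (norm (g z))\<^sup>2)"
    using f g by (simp add: sq_integrable_def)
  then have "integrable gauss (\<lambda>z. (norm (f z + g z))\<^sup>2)"
  proof (rule Bochner_Integration.integrable_bound)
    have "(norm (f z + g z))\<^sup>2 \<le> 2 * (norm (f z))\<^sup>2 + 2 * (norm (g z))\<^sup>2" for z
    proof -
      have "(norm (f z + g z))\<^sup>2 \<le> (norm (f z) + norm (g z))\<^sup>2"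
        by (intro power_mono norm_triangle_ineq) simp
      also have "\<dots> \<le> 2 * (norm (f z))\<^sup>2 + 2 * (norm (g z))\<^sup>2"
        using sum_squares_bound[of "norm (f z)" "norm (g z)"]
        by (simp add: power2_sum)
      finally show ?thesis .
    qed
    then show "AE z in gauss. norm ((norm (f z + g z))\<^sup>2)
        \<le> norm (2 * (norm (f z))\<^sup>2 + 2 * (norm (g z))\<^sup>2)"
      by simp
  qed measurable
  then show ?thesis
    by (simp add: sq_integrable_def)
qed

lemma sq_integrable_uminus: "sq_integrable f \<Longrightarrow> sq_integrable (\<lambda>z. - f z)"
  using sq_integrable_cmult[of f "-1"] by simp

lemma sq_integrable_diff: "sq_integrable f \<Longrightarrow> sq_integrable g \<Longrightarrow> sq_integrable (\<lambda>z. f z - g z)"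
  using sq_integrable_add[of f "\<lambda>z. - g z"] sq_integrable_uminus[of g] by simp

lemma integrable_mult_cnj:
  assumes f: "sq_integrable f" and g: "sq_integrable g"
  shows "integrable gauss (\<lambda>z. f z * cnj (g z))"
proof -
  note [measurable] = sq_integrable_measurable[OF f] sq_integrable_measurable[OF g]
  have "integrable gauss (\<lambda>z. (norm (f z))\<^sup>2 + (norm (g z))\<^sup>2)"
    using f g by (simp add: sq_integrable_def)
  then show ?thesis
  proof (rule Bochner_Integration.integrable_bound)
    have "norm (f z) * norm (g z) \<le> (norm (f z))\<^sup>2 + (norm (g z))\<^sup>2" for z
      using sum_squares_bound[of "norm (f z)" "norm (g z)"]
        mult_nonneg_nonneg[OF norm_ge_zero[of "f z"] norm_ge_zero[of "g z"]] by linarith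
    then show "AE z in gauss. norm (f z * cnj (g z)) \<le> norm ((norm (f z))\<^sup>2 + (norm (g z))\<^sup>2)"
      by (simp add: norm_mult)
  qed measurable
qed

definition l2_rel :: "(complex ^ 'n::finite \<Rightarrow> complex) \<Rightarrow> (complex ^ 'n \<Rightarrow> complex) \<Rightarrow> bool" where
  "l2_rel f g \<longleftrightarrow> sq_integrable f \<and> sq_integrable g \<and> (AE z in gauss. f z = g z)"

quotient_type (overloaded) 'n l2 = "complex ^ 'n::finite \<Rightarrow> complex" / partial: l2_rel
  morphisms rep_l2 l2_class
proof (rule part_equivpI)
  show "\<exists>f. l2_rel f f"
    using sq_integrable_zero by (auto simp: l2_rel_def)
  show "symp l2_rel"
    by (rule sympI) (auto simp: l2_rel_def eq_commute)
  show "transp l2_rel"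
    by (rule transpI) (auto simp: l2_rel_def elim!: AE_mp)
qed

instantiation l2 :: (finite) complex_inner
begin

lift_definition zero_l2 :: "'a l2" is "\<lambda>_. 0"
  by (simp add: l2_rel_def sq_integrable_zero)

lift_definition plus_l2 :: "'a l2 \<Rightarrow> 'a l2 \<Rightarrow> 'a l2" is "\<lambda>f g z. f z + g z"
  by (auto simp: l2_rel_def sq_integrable_add elim!: AE_mp)

lift_definition minus_l2 :: "'a l2 \<Rightarrow> 'a l2 \<Rightarrow> 'a l2" is "\<lambda>f g z. f z - g z"
  by (auto simp: l2_rel_def sq_integrable_diff elim!: AE_mp)

lift_definition uminus_l2 :: "'a l2 \<Rightarrow> 'a l2" is "\<lambda>f z. - f z"
  by (auto simp: l2_rel_def sq_integrable_uminus elim!: AE_mp)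

lift_definition scaleC_l2 :: "complex \<Rightarrow> 'a l2 \<Rightarrow> 'a l2" is "\<lambda>c f z. c * f z"
  by (auto simp: l2_rel_def sq_integrable_cmult elim!: AE_mp)

lift_definition cinner_l2 :: "'a l2 \<Rightarrow> 'a l2 \<Rightarrow> complex"
  is "\<lambda>f g. integral\<^sup>L gauss (\<lambda>z. f z * cnj (g z))"
proof -
  fix f f' g g' :: "complex ^ 'a \<Rightarrow> complex"
  assume *: "l2_rel f f'" "l2_rel g g'"
  then have "sq_integrable f" "sq_integrable f'" "sq_integrable g" "sq_integrable g'"
    by (simp_all add: l2_rel_def)
  note [measurable] = this[THEN sq_integrable_measurable]
  have "AE z in gauss. f z = f' z" "AE z in gauss. g z = g' z"
    using * by (simp_all add: l2_rel_def)
  then have "AE z in gauss. f z * cnj (g z) = f' z * cnj (g' z)"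
    by eventually_elim simp
  then show "integral\<^sup>L gauss (\<lambda>z. f z * cnj (g z)) = integral\<^sup>L gauss (\<lambda>z. f' z * cnj (g' z))"
    by (intro integral_cong_AE) measurable
qed

definition scaleR_l2 :: "real \<Rightarrow> 'a l2 \<Rightarrow> 'a l2" where
  "scaleR_l2 r u = scaleC (complex_of_real r) u"

definition inner_l2 :: "'a l2 \<Rightarrow> 'a l2 \<Rightarrow> real" where
  "inner_l2 u v = Re (cinner u v)"

definition norm_l2 :: "'a l2 \<Rightarrow> real" where
  "norm_l2 u = sqrt (inner u u)"

definition dist_l2 :: "'a l2 \<Rightarrow> 'a l2 \<Rightarrow> real" where
  "dist_l2 u v = norm (u - v)"

definition sgn_l2 :: "'a l2 \<Rightarrow> 'a l2" where
  "sgn_l2 u = inverse (norm u) *\<^sub>R u"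

definition uniformity_l2 :: "('a l2 \<times> 'a l2) filter" where
  "uniformity_l2 = (INF e\<in>{0 <..}. principal {(u, v). dist u v < e})"

definition open_l2 :: "'a l2 set \<Rightarrow> bool" where
  "open_l2 U \<longleftrightarrow> (\<forall>u\<in>U. eventually (\<lambda>(u', v). u' = u \<longrightarrow> v \<in> U) uniformity)"

instance
proof
  fix u v w :: "'a l2" and a b :: real and c d :: complex
  show "u + v + w = u + (v + w)"
    by transfer (simp add: l2_rel_def sq_integrable_add add.assoc)
  show "u + v = v + u"
    by transfer (simp add: l2_rel_def sq_integrable_add add.commute)
  show "0 + u = u"
    by transfer (simp add: l2_rel_def)
  show "- u + u = 0"
    by transfer (simp add: l2_rel_def sq_integrable_zero)
  show "u - v = u + - v"
    by transfer (simp add: l2_rel_def sq_integrable_diff)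
  show addR: "scaleC c (u + v) = scaleC c u + scaleC c v" for c and u v :: "'a l2"
    by transfer (simp add: l2_rel_def sq_integrable_cmult sq_integrable_add distrib_left)
  show addL: "scaleC (c + d) u = scaleC c u + scaleC d u" for c d and u :: "'a l2"
    by transfer (simp add: l2_rel_def sq_integrable_cmult sq_integrable_add distrib_right)
  show assoc: "scaleC c (scaleC d u) = scaleC (c * d) u" for c d and u :: "'a l2"
    by transfer (simp add: l2_rel_def sq_integrable_cmult mult.assoc)
  have one: "scaleC 1 u = u" for u :: "'a l2"
    by transfer (simp add: l2_rel_def)
  show "scaleC (complex_of_real a) u = a *\<^sub>R u"
    by (simp add: scaleR_l2_def)
  show "a *\<^sub>R (u + v) = a *\<^sub>R u + a *\<^sub>R v" "(a + b) *\<^sub>R u = a *\<^sub>R u + b *\<^sub>R u"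
    "a *\<^sub>R b *\<^sub>R u = (a * b) *\<^sub>R u" "1 *\<^sub>R u = u"
    by (simp_all add: scaleR_l2_def addR addL assoc one)
  show comm: "cinner u v = cnj (cinner v u)" for u v :: "'a l2"
    by transfer (simp flip: Bochner_Integration.integral_cnj add: mult.commute)
  show add: "cinner (u + v) w = cinner u w + cinner v w" for u v w :: "'a l2"
    by transfer (simp add: l2_rel_def distrib_right integrable_mult_cnj)
  show scale: "cinner (scaleC c u) v = c * cinner u v" for c and u v :: "'a l2"
    by transfer (simp add: l2_rel_def mult.assoc)
  show "inner u v = Re (cinner u v)"
    by (simp add: inner_l2_def)
  show "inner u v = inner v u"
    using comm[of u v] by (simp add: inner_l2_def)
  show "inner (u + v) w = inner u w + inner v w"
    by (simp add: inner_l2_def add)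
  show "inner (a *\<^sub>R u) v = a * inner u v"
    by (simp add: inner_l2_def scaleR_l2_def scale)
  have Re_self: "Re (integral\<^sup>L gauss (\<lambda>z. f z * cnj (f z))) = integral\<^sup>L gauss (\<lambda>z. (norm (f z))\<^sup>2)"
    for f :: "complex ^ 'a \<Rightarrow> complex"
    by (simp add: complex_norm_square[symmetric] flip: of_real_power)
  show "0 \<le> inner u u"
    unfolding inner_l2_def by transfer (simp add: Re_self)
  show "(inner u u = 0) = (u = 0)"
    unfolding inner_l2_def
  proof transfer
    fix f :: "complex ^ 'a \<Rightarrow> complex"
    assume "l2_rel f f"
    then have f: "sq_integrable f"
      by (simp add: l2_rel_def)
    then have "(integral\<^sup>L gauss (\<lambda>z. (norm (f z))\<^sup>2) = 0) \<longleftrightarrow> (AE z in gauss. (norm (f z))\<^sup>2 = 0)"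
      by (intro integral_nonneg_eq_0_iff_AE) (simp_all add: sq_integrable_def)
    with f show "(Re (integral\<^sup>L gauss (\<lambda>z. f z * cnj (f z))) = 0) = l2_rel f (\<lambda>_. 0)"
      unfolding Re_self by (simp add: l2_rel_def sq_integrable_zero)
  qed
  show "norm u = sqrt (inner u u)"
    by (simp add: norm_l2_def)
  show "dist u v = norm (u - v)"
    by (simp add: dist_l2_def)
  show "sgn u = inverse (norm u) *\<^sub>R u"
    by (simp add: sgn_l2_def)
  show "(uniformity :: ('a l2 \<times> 'a l2) filter) = (INF e\<in>{0 <..}. principal {(u, v). dist u v < e})"
    by (simp add: uniformity_l2_def)
  show "open U \<longleftrightarrow> (\<forall>u\<in>U. eventually (\<lambda>(u', v). u' = u \<longrightarrow> v \<in> U) uniformity)" for U :: "'a l2 set"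
    by (simp add: open_l2_def)
qed

end


section \<open>The Fock space\<close>

definition entire :: "(complex ^ 'n::finite \<Rightarrow> complex) \<Rightarrow> bool" where
  "entire f \<longleftrightarrow> (\<forall>z. \<exists>D. (f has_derivative D) (at z) \<and> (\<forall>c v. D (c *s v) = c * D v))"

definition fock_space :: "'n::finite l2 set" where
  "fock_space = {l2_class f |f. sq_integrable f \<and> entire f}"

lemma entire_add: "entire f \<Longrightarrow> entire g \<Longrightarrow> entire (\<lambda>z. f z + g z)"
  unfolding entire_def
proof
  fix z
  assume "\<forall>z. \<exists>D. (f has_derivative D) (at z) \<and> (\<forall>c v. D (c *s v) = c * D v)"
    "\<forall>z. \<exists>D. (g has_derivative D) (at z) \<and> (\<forall>c v. D (c *s v) = c * D v)"
  then obtain D E where "(f has_derivative D) (at z)" "\<forall>c v. D (c *s v) = c * D v"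
    "(g has_derivative E) (at z)" "\<forall>c v. E (c *s v) = c * E v"
    by metis
  then show "\<exists>D. ((\<lambda>z. f z + g z) has_derivative D) (at z) \<and> (\<forall>c v. D (c *s v) = c * D v)"
    by (intro exI[of _ "\<lambda>v. D v + E v"]) (auto intro: has_derivative_add simp: distrib_left)
qed

lemma entire_cmult: "entire f \<Longrightarrow> entire (\<lambda>z. a * f z)"
  unfolding entire_def
proof
  fix z
  assume "\<forall>z. \<exists>D. (f has_derivative D) (at z) \<and> (\<forall>c v. D (c *s v) = c * D v)"
  then obtain D where "(f has_derivative D) (at z)" "\<forall>c v. D (c *s v) = c * D v"
    by metis
  then show "\<exists>D. ((\<lambda>z. a * f z) has_derivative D) (at z) \<and> (\<forall>c v. D (c *s v) = c * D v)"
    by (intro exI[of _ "\<lambda>v. a * D v"]) (auto intro: has_derivative_mult_right simp: mult_ac)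
qed

lemma fock_space_zero: "0 \<in> fock_space"
proof -
  have "entire (\<lambda>_. 0 :: complex)"
    unfolding entire_def by (auto intro!: exI[of _ "\<lambda>_. 0"])
  then show ?thesis
    unfolding fock_space_def zero_l2_def using sq_integrable_zero by auto
qed

lemma fock_space_add: "u \<in> fock_space \<Longrightarrow> v \<in> fock_space \<Longrightarrow> u + v \<in> fock_space"
  unfolding fock_space_def
  by (clarsimp simp: plus_l2.abs_eq l2_rel_def) (metis sq_integrable_add entire_add)

lemma fock_space_scaleC: "u \<in> fock_space \<Longrightarrow> scaleC c u \<in> fock_space"
  unfolding fock_space_def
  by (clarsimp simp: scaleC_l2.abs_eq l2_rel_def) (metis sq_integrable_cmult entire_cmult)

lemma fock_space_scaleR: "u \<in> fock_space \<Longrightarrow> r *\<^sub>R u \<in> fock_space"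
  using fock_space_scaleC[of u "complex_of_real r"] by (simp add: scaleC_of_real)

lemma fock_space_uminus: "u \<in> fock_space \<Longrightarrow> - u \<in> fock_space"
  using fock_space_scaleR[of u "-1"] by simp

lemma fock_space_diff: "u \<in> fock_space \<Longrightarrow> v \<in> fock_space \<Longrightarrow> u - v \<in> fock_space"
  using fock_space_add[of u "- v"] fock_space_uminus[of v] by simp

typedef (overloaded) 'n fock = "fock_space :: 'n::finite l2 set"
  morphisms fock_l2 fock_of
  using fock_space_zero by blast

setup_lifting type_definition_fock

instantiation fock :: (finite) complex_inner
begin

lift_definition zero_fock :: "'a fock" is 0 by (rule fock_space_zero)
lift_definition plus_fock :: "'a fock \<Rightarrow> 'a fock \<Rightarrow> 'a fock" is plus by (rule fock_space_add)
lift_definition minus_fock :: "'a fock \<Rightarrow> 'a fock \<Rightarrow> 'a fock" is minus by (rule fock_space_diff)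
lift_definition uminus_fock :: "'a fock \<Rightarrow> 'a fock" is uminus by (rule fock_space_uminus)
lift_definition scaleC_fock :: "complex \<Rightarrow> 'a fock \<Rightarrow> 'a fock" is scaleC by (rule fock_space_scaleC)
lift_definition scaleR_fock :: "real \<Rightarrow> 'a fock \<Rightarrow> 'a fock" is scaleR by (rule fock_space_scaleR)
lift_definition cinner_fock :: "'a fock \<Rightarrow> 'a fock \<Rightarrow> complex" is cinner .
lift_definition inner_fock :: "'a fock \<Rightarrow> 'a fock \<Rightarrow> real" is inner .
lift_definition norm_fock :: "'a fock \<Rightarrow> real" is norm .
lift_definition dist_fock :: "'a fock \<Rightarrow> 'a fock \<Rightarrow> real" is dist .
lift_definition sgn_fock :: "'a fock \<Rightarrow> 'a fock" is sgn
  by (simp add: sgn_div_norm fock_space_scaleR)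

definition uniformity_fock :: "('a fock \<times> 'a fock) filter" where
  "uniformity_fock = (INF e\<in>{0 <..}. principal {(u, v). dist u v < e})"

definition open_fock :: "'a fock set \<Rightarrow> bool" where
  "open_fock U \<longleftrightarrow> (\<forall>u\<in>U. eventually (\<lambda>(u', v). u' = u \<longrightarrow> v \<in> U) uniformity)"

instance
proof
  fix u v w :: "'a fock" and a b :: real and c d :: complex
  show "u + v + w = u + (v + w)" by transfer simp
  show "u + v = v + u" by transfer simp
  show "0 + u = u" by transfer simp
  show "- u + u = 0" by transfer simp
  show "u - v = u + - v" by transfer simp
  show "a *\<^sub>R (u + v) = a *\<^sub>R u + a *\<^sub>R v" by transfer (simp add: scaleR_add_right)
  show "(a + b) *\<^sub>R u = a *\<^sub>R u + b *\<^sub>R u" by transfer (simp add: scaleR_add_left)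
  show "a *\<^sub>R b *\<^sub>R u = (a * b) *\<^sub>R u" by transfer simp
  show "1 *\<^sub>R u = u" by transfer simp
  show "dist u v = norm (u - v)" by transfer (simp add: dist_norm)
  show "sgn u = inverse (norm u) *\<^sub>R u" by transfer (simp add: sgn_div_norm)
  show "inner u v = inner v u" by transfer (simp add: inner_commute)
  show "inner (u + v) w = inner u w + inner v w" by transfer (simp add: inner_add_left)
  show "inner (a *\<^sub>R u) v = a * inner u v" by transfer simp
  show "0 \<le> inner u u" by transfer simp
  show "(inner u u = 0) = (u = 0)" by transfer simp
  show "norm u = sqrt (inner u u)" by transfer (simp add: norm_eq_sqrt_inner)
  show "scaleC c (u + v) = scaleC c u + scaleC c v" by transfer (simp add: scaleC_add_right)
  show "scaleC (c + d) u = scaleC c u + scaleC d u" by transfer (simp add: scaleC_add_left)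
  show "scaleC c (scaleC d u) = scaleC (c * d) u" by transfer (simp add: scaleC_scaleC)
  show "scaleC (complex_of_real a) u = a *\<^sub>R u" by transfer (simp add: scaleC_of_real)
  show "cinner u v = cnj (cinner v u)" by transfer (rule cinner_commute)
  show "cinner (u + v) w = cinner u w + cinner v w" by transfer (rule cinner_add_left)
  show "cinner (scaleC c u) v = c * cinner u v" by transfer (rule cinner_scaleC_left)
  show "inner u v = Re (cinner u v)" by transfer (rule inner_eq_Re_cinner)
  show "(uniformity :: ('a fock \<times> 'a fock) filter) = (INF e\<in>{0 <..}. principal {(u, v). dist u v < e})"
    by (simp add: uniformity_fock_def)
  show "open U \<longleftrightarrow> (\<forall>u\<in>U. eventually (\<lambda>(u', v). u' = u \<longrightarrow> v \<in> U) uniformity)" for U :: "'a fock set"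
    by (simp add: open_fock_def)
qed

end

lift_definition fock_incl :: "'n::finite fock \<Rightarrow>\<^sub>L 'n l2" is fock_l2
  by (rule bounded_linear_intro[where K = 1])
    (simp_all add: plus_fock.rep_eq scaleR_fock.rep_eq norm_fock.rep_eq)

text \<open>The orthogonal projection onto the Fock space, with the Fock space as codomain: the value at
  \<open>u\<close> is the element of the Fock space whose difference from \<open>u\<close> is orthogonal to the Fock space.
  There is at most one such operator; it exists because the Fock space is complete.\<close>

definition fock_proj :: "'n::finite l2 \<Rightarrow>\<^sub>L 'n fock" where
  "fock_proj = (THE P. \<forall>u v.
     cinner (u - blinfun_apply fock_incl (blinfun_apply P u)) (blinfun_apply fock_incl v) = 0)"


section \<open>Toeplitz operators and band-dominated operators\<close>

definition Linf :: "(complex ^ 'n::finite \<Rightarrow> complex) set" where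
  "Linf = {f \<in> borel_measurable lborel. \<exists>C. AE z in lborel. norm (f z) \<le> C}"

lemma LinfE:
  assumes "f \<in> Linf"
  obtains C where "C \<ge> 0" "AE z in gauss. norm (f z) \<le> C" "f \<in> borel_measurable gauss"
proof -
  obtain C where C: "AE z in lborel. norm (f z) \<le> C" and f: "f \<in> borel_measurable lborel"
    using assms by (auto simp: Linf_def)
  have "AE z in gauss. norm (f z) \<le> max C 0"
    unfolding AE_gauss_iff using C by eventually_elim simp
  moreover have "f \<in> borel_measurable gauss"
    using f by (simp cong: measurable_cong_sets)
  ultimately show ?thesis
    using that[of "max C 0"] by simp
qed

lemma sq_integrable_Linf_mult:
  assumes "f \<in> Linf" "sq_integrable u"
  shows "sq_integrable (\<lambda>z. f z * u z)"
  by (rule LinfE[OF assms(1)]) (rule sq_integrable_bounded_mult[OF assms(2)])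

text \<open>Multiplication by \<open>f\<close>; the value for \<open>f\<close> outside \<open>Linf\<close> is a dummy.\<close>

lift_definition mult_l2 :: "(complex ^ 'n::finite \<Rightarrow> complex) \<Rightarrow> 'n l2 \<Rightarrow> 'n l2"
  is "\<lambda>f u z. if f \<in> Linf then f z * u z else 0"
proof -
  fix f u v :: "complex ^ 'n \<Rightarrow> complex"
  assume uv: "l2_rel u v"
  show "l2_rel (\<lambda>z. if f \<in> Linf then f z * u z else 0) (\<lambda>z. if f \<in> Linf then f z * v z else 0)"
    using uv by (cases "f \<in> Linf")
      (auto simp: l2_rel_def sq_integrable_zero sq_integrable_Linf_mult elim!: AE_mp)
qed

lemma norm_l2_class_sq:
  assumes "sq_integrable f"
  shows "(norm (l2_class f))\<^sup>2 = integral\<^sup>L gauss (\<lambda>z. (norm (f z))\<^sup>2)"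
proof -
  have "complex_of_real ((norm (l2_class f))\<^sup>2) = integral\<^sup>L gauss (\<lambda>z. f z * cnj (f z))"
    unfolding cinner_self[symmetric] using assms by (simp add: cinner_l2.abs_eq l2_rel_def)
  also have "\<dots> = complex_of_real (integral\<^sup>L gauss (\<lambda>z. (norm (f z))\<^sup>2))"
    by (simp add: complex_norm_square[symmetric] flip: of_real_power)
  finally show ?thesis
    by (simp only: of_real_eq_iff)
qed

lift_definition mult_op :: "(complex ^ 'n::finite \<Rightarrow> complex) \<Rightarrow> 'n l2 \<Rightarrow>\<^sub>L 'n l2" is mult_l2
proof -
  fix f :: "complex ^ 'n \<Rightarrow> complex"
  show "bounded_linear (mult_l2 f)"
  proof (cases "f \<in> Linf")
    case True
    then obtain C where C: "C \<ge> 0" "AE z in gauss. norm (f z) \<le> C"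
      by (rule LinfE)
    note sq = sq_integrable_Linf_mult
    show ?thesis
    proof (rule bounded_linear_intro[where K = C])
      show "mult_l2 f (u + v) = mult_l2 f u + mult_l2 f v" for u v
        using True by transfer (simp add: l2_rel_def sq sq_integrable_add distrib_left)
      show "mult_l2 f (r *\<^sub>R u) = r *\<^sub>R mult_l2 f u" for r u
        unfolding scaleR_l2_def using True
        by transfer (simp add: l2_rel_def sq sq_integrable_cmult mult.left_commute)
      show "norm (mult_l2 f u) \<le> norm u * C" for u
      proof -
        obtain g where g: "sq_integrable g" and abs_eq: "u = l2_class g"
          by (metis Quotient_l2 Quotient_abs_rep Quotient_rep_reflp l2_rel_def)
        have "(norm (mult_l2 f u))\<^sup>2 = integral\<^sup>L gauss (\<lambda>z. (norm (f z * g z))\<^sup>2)"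
          using True g by (simp add: abs_eq mult_l2.abs_eq l2_rel_def norm_l2_class_sq sq)
        also have "\<dots> \<le> integral\<^sup>L gauss (\<lambda>z. C\<^sup>2 * (norm (g z))\<^sup>2)"
        proof (rule integral_mono_AE)
          show "AE z in gauss. (norm (f z * g z))\<^sup>2 \<le> C\<^sup>2 * (norm (g z))\<^sup>2"
            using C(2) by eventually_elim
              (simp add: norm_mult power_mult_distrib mult_right_mono power_mono)
        qed (use g sq[OF True g] in \<open>simp_all add: sq_integrable_def\<close>)
        also have "\<dots> = (norm u * C)\<^sup>2"
          using g by (simp add: abs_eq norm_l2_class_sq power_mult_distrib)
        finally show ?thesis
          using C(1) by (simp add: power2_le_iff_abs_le)
      qed
    qed
  next
    case False
    then have "mult_l2 f = (\<lambda>_. 0)"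
      by (intro ext) (transfer, simp add: l2_rel_def sq_integrable_zero)
    then show ?thesis
      by simp
  qed
qed

definition toeplitz :: "(complex ^ 'n::finite \<Rightarrow> complex) \<Rightarrow> 'n fock \<Rightarrow>\<^sub>L 'n fock" where
  "toeplitz f = fock_proj o\<^sub>L mult_op f o\<^sub>L fock_incl"

definition toeplitz_algebra :: "('n::finite fock \<Rightarrow>\<^sub>L 'n fock) set" where
  "toeplitz_algebra = c_star_generated (toeplitz ` Linf)"

definition ess_support :: "(complex ^ 'n::finite \<Rightarrow> complex) \<Rightarrow> (complex ^ 'n) set" where
  "ess_support f = - \<Union>{U. open U \<and> (AE z in lborel. z \<in> U \<longrightarrow> f z = 0)}"

text \<open>\<open>setdist\<close> is \<open>0\<close> if one of the sets is empty, but then \<open>f\<close> or \<open>g\<close> vanishes almost everywhere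
  and the product of operators is \<open>0\<close> anyway.\<close>

definition band_operator :: "('n::finite l2 \<Rightarrow>\<^sub>L 'n l2) \<Rightarrow> bool" where
  "band_operator A \<longleftrightarrow> A \<in> operators \<and>
     (\<exists>\<omega>>0. \<forall>f\<in>Linf. \<forall>g\<in>Linf. setdist (ess_support f) (ess_support g) > \<omega> \<longrightarrow>
        mult_op f o\<^sub>L A o\<^sub>L mult_op g = 0)"

definition BDO :: "('n::finite l2 \<Rightarrow>\<^sub>L 'n l2) set" where
  "BDO = closure {A. band_operator A}"

end

theory Submission
  imports Defs "HOL-Probability.Distributions" "HOL-Complex_Analysis.Cauchy_Integral_Formula"
    "HOL-Real_Asymp.Real_Asymp"
begin

text \<open>Let \<open>S\<close> be the norm closure of the Toeplitz operators \<open>T\<^sub>f\<close>, \<open>f \<in> L\<^sup>\<infinity>\<close>; both sides of the theorem equal \<open>S\<close>.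

  For a band operator \<open>A\<close> the matrix elements \<open>\<langle>A k\<^sub>w, k\<^sub>z\<rangle>\<close> between normalised reproducing kernels decay like a
  Gaussian in \<open>z - w\<close>, so that \<open>PAP\<close> is, up to a small error, an integral over bounded displacements \<open>x = z - w\<close>
  of rank one operators \<open>k\<^sub>w \<mapsto> k\<^bsub>w+x\<^esub>\<close>. By Taylor expansion along the complex line through \<open>x\<close>, an off-diagonal
  rank one operator is approximated by finite combinations of diagonal ones at the points \<open>w + a\<^sub>i x\<close>, uniformly
  enough for the error to be small in operator norm. Diagonal operators integrate to Toeplitz operators, hence
  \<open>P BDO P \<subseteq> S\<close>.

  Conversely, multiplication operators are band operators and \<open>P\<close> is band-dominated by the Schur test, so
  \<open>X \<mapsto> PXP\<close> maps \<open>S\<close> into the closed algebra \<open>BDO\<close>; this gives \<open>S \<subseteq> P BDO P\<close>. Since products of Toeplitz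
  operators then lie in \<open>P BDO P \<subseteq> S\<close>, the closed subspace \<open>S\<close> is itself a \<open>C\<^sup>*\<close> algebra.\<close>

section \<open>Lebesgue measure and the Gaussian integral\<close>

text \<open>The difficulty is that a sampling error made at every base point \<open>w\<close> of a
  non-compact space has to be small in operator norm. Two facts make this possible. The nodes and
  weights depend on the tolerance alone, neither on the functions nor on \<open>w\<close>. And the
  error at \<open>w\<close> is measured by quadratic means over circles of radius 2|x| around
  \<open>w\<close>, whose squares integrate over \<open>w\<close>, by translation invariance, to
  exp(4|x|^2) times the squared norms of \<open>u\<close> and \<open>v\<close>. This growth is the
  reason for restricting to |x| \<le> R first and choosing the tolerance only afterwards. It is
  enough to compare forms: a bound of <Du, v> by a small multiple of |u|^2 + |v|^2 controls the norm
  of D after rescaling v. The Gaussian decay of the matrix elements comes from cutting both kernels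
  to balls that are still separated by the band width: the operator does not connect the truncated
  kernels, and what is cut off is a Gaussian tail.\<close>

lemma nn_integral_lborel_shift:
  fixes c :: "'a::euclidean_space"
  assumes [measurable]: "f \<in> borel_measurable borel"
  shows "(\<integral>\<^sup>+x. f (x + c) \<partial>lborel) = (\<integral>\<^sup>+x. f x \<partial>lborel)"
proof -
  have "(\<integral>\<^sup>+x. f x \<partial>lborel) = (\<integral>\<^sup>+x. f x \<partial>distr lborel borel ((+) c))"
    by (simp add: lborel_distr_plus)
  also have "\<dots> = (\<integral>\<^sup>+x. f (x + c) \<partial>lborel)"
    by (subst nn_integral_distr) (simp_all add: add.commute)
  finally show ?thesis ..
qed

lemma lborel_distr_reflect:
  fixes c :: "'a::euclidean_space"
  shows "distr lborel borel (\<lambda>x. c - x) = lborel"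
  by (subst (2) lborel_affine[of "-1" c]) (simp_all add: density_1)

lemma nn_integral_lborel_reflect:
  fixes c :: "'a::euclidean_space"
  assumes [measurable]: "f \<in> borel_measurable borel"
  shows "(\<integral>\<^sup>+x. f (c - x) \<partial>lborel) = (\<integral>\<^sup>+x. f x \<partial>lborel)"
proof -
  have "(\<integral>\<^sup>+x. f x \<partial>lborel) = (\<integral>\<^sup>+x. f x \<partial>distr lborel borel (\<lambda>x. c - x))"
    by (simp add: lborel_distr_reflect)
  also have "\<dots> = (\<integral>\<^sup>+x. f (c - x) \<partial>lborel)"
    by (subst nn_integral_distr) simp_all
  finally show ?thesis ..
qed

lemma integral_lborel_shift:
  fixes c :: "'a::euclidean_space" and f :: "'a \<Rightarrow> 'b::{banach, second_countable_topology}"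
  assumes [measurable]: "f \<in> borel_measurable borel"
  shows "(\<integral>x. f (x + c) \<partial>lborel) = (\<integral>x. f x \<partial>lborel)"
proof -
  have "(\<integral>x. f x \<partial>lborel) = (\<integral>x. f x \<partial>distr lborel borel ((+) c))"
    by (simp add: lborel_distr_plus)
  also have "\<dots> = (\<integral>x. f (x + c) \<partial>lborel)"
    by (subst integral_distr) (simp_all add: add.commute)
  finally show ?thesis ..
qed

lemma integrable_lborel_shift:
  fixes c :: "'a::euclidean_space" and f :: "'a \<Rightarrow> 'b::{banach, second_countable_topology}"
  assumes "integrable lborel f"
  shows "integrable lborel (\<lambda>x. f (x + c))"
proof -
  have [measurable]: "f \<in> borel_measurable borel" using assms by auto
  have "(\<integral>\<^sup>+x. ennreal (norm (f (x + c))) \<partial>lborel) = (\<integral>\<^sup>+x. ennreal (norm (f x)) \<partial>lborel)"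
    by (rule nn_integral_lborel_shift) measurable
  then show ?thesis using assms
    unfolding integrable_iff_bounded by simp
qed

text \<open>The image measure \<open>\<nu>\<close> of Lebesgue measure under a linear isometry is again translation
  invariant, so that \<open>\<nu>(A) \<lambda>(B) = \<lambda>(-A) \<nu>(B)\<close> by Fubini; the unit ball \<open>B\<close> is invariant.\<close>

lemma lborel_distr_isometry:
  fixes R :: "'a::euclidean_space \<Rightarrow> 'a"
  assumes lin: "linear R" and iso: "\<And>x. norm (R x) = norm x"
  shows "distr lborel borel R = lborel"
proof -
  have inj: "inj R"
    using lin iso by (metis linear_injective_0 norm_eq_zero)
  have surj: "surj R"
    using lin inj linear_injective_imp_surjective by blast
  have [measurable]: "R \<in> borel_measurable borel"
    using lin by (simp add: borel_measurable_continuous_onI linear_continuous_on linear_conv_bounded_linear)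
  define N where "N = distr lborel borel R"
  have [measurable_cong, simp]: "sets N = sets borel" by (simp add: N_def)
  have [simp]: "space N = UNIV" by (simp add: N_def)
  have shift: "(\<integral>\<^sup>+x. f (x + c) \<partial>N) = (\<integral>\<^sup>+x. f x \<partial>N)" if [measurable]: "f \<in> borel_measurable borel" for f c
  proof -
    obtain d where d: "c = R d" using surj by blast
    have "(\<integral>\<^sup>+x. f (x + c) \<partial>N) = (\<integral>\<^sup>+x. f (R (x + d)) \<partial>lborel)"
      unfolding N_def d by (subst nn_integral_distr) (simp_all add: linear_add[OF lin])
    also have "\<dots> = (\<integral>\<^sup>+x. f x \<partial>N)"
      unfolding N_def by (subst nn_integral_lborel_shift, simp, subst nn_integral_distr) simp_all
    finally show ?thesis .
  qed
  define B where "B = (cball 0 1 :: 'a set)"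
  have [measurable]: "B \<in> sets borel" by (simp add: B_def)
  have NB: "emeasure N B = emeasure lborel B"
  proof -
    have "R -` B = B" unfolding B_def using iso by auto
    then show ?thesis by (simp add: N_def emeasure_distr)
  qed
  \<comment> \<open>The factor \<open>emeasure lborel B\<close> is cancelled at the end, which
    requires it to be finite and nonzero.\<close>
  have B_fin: "emeasure lborel B < \<infinity>"
    unfolding B_def using emeasure_lborel_cball_finite[of "0::'a" 1] by simp
  have B_pos: "emeasure lborel B \<noteq> 0"
  proof -
    have "unit_ball_vol (real DIM('a)) \<noteq> 0"
      by (rule less_imp_neq[THEN not_sym]) simp
    then show ?thesis by (simp add: B_def emeasure_cball)
  qed
  \<comment> \<open>Balls about the origin are invariant under \<open>R\<close>, so \<open>N\<close>
    gives them their Lebesgue measure; they form the countable cover that Fubini requires.\<close>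
  interpret N: sigma_finite_measure N
  proof
    show "\<exists>A. countable A \<and> A \<subseteq> sets N \<and> \<Union> A = space N \<and> (\<forall>a\<in>A. emeasure N a \<noteq> \<infinity>)"
    proof (intro exI[of _ "range (\<lambda>n. cball 0 (real n))"] conjI ballI)
      show "\<Union> (range (\<lambda>n. cball (0::'a) (real n))) = space N"
        by (auto simp: real_arch_simple)
      fix a assume "a \<in> range (\<lambda>n. cball (0::'a) (real n))"
      then obtain n where a: "a = cball 0 (real n)" by auto
      have "R -` a = a" using iso by (auto simp: a)
      then have "emeasure N a = emeasure lborel a" by (simp add: N_def emeasure_distr a)
      then show "emeasure N a \<noteq> \<infinity>" using emeasure_lborel_cball_finite[of "0::'a" "real n"] by (simp add: a less_top)
    qed auto
  qed
  interpret P: pair_sigma_finite lborel N ..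
  show ?thesis
  proof (rule measure_eqI)
    fix A assume "A \<in> sets (distr lborel borel R)"
    then have [measurable]: "A \<in> sets borel" by simp
    \<comment> \<open>The measure of \<open>B\<close> is written as an integral over y of a shifted
      indicator. After exchanging the integrals, translating by - y under \<open>N\<close> frees
      \<open>B\<close> from y and moves the shift to \<open>A\<close>.\<close>
    have "emeasure N A * emeasure lborel B = (\<integral>\<^sup>+x. indicator A x * (\<integral>\<^sup>+y. indicator B (y + x) \<partial>lborel) \<partial>N)"
      by (subst nn_integral_lborel_shift) (simp_all add: nn_integral_multc)
    also have "\<dots> = (\<integral>\<^sup>+x. (\<integral>\<^sup>+y. indicator A x * indicator B (y + x) \<partial>lborel) \<partial>N)"
      by (simp add: nn_integral_cmult)
    also have "\<dots> = (\<integral>\<^sup>+y. (\<integral>\<^sup>+x. indicator A x * indicator B (y + x) \<partial>N) \<partial>lborel)"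
      by (rule P.Fubini') measurable
    also have "\<dots> = (\<integral>\<^sup>+y. (\<integral>\<^sup>+x. indicator A (x + - y) * indicator B (y + (x + - y)) \<partial>N) \<partial>lborel)"
      proof (rule nn_integral_cong)
      fix y :: 'a
      have "(\<lambda>x. indicator A x * indicator B (y + x) :: ennreal) \<in> borel_measurable borel" by measurable
      from shift[OF this, of "- y"]
      show "(\<integral>\<^sup>+x. indicator A x * indicator B (y + x) \<partial>N)
          = (\<integral>\<^sup>+x. indicator A (x + - y) * indicator B (y + (x + - y)) \<partial>N)" by (simp only:)
    qed
    also have "\<dots> = (\<integral>\<^sup>+x. (\<integral>\<^sup>+y. indicator A (x + - y) * indicator B x \<partial>lborel) \<partial>N)"
      by (subst P.Fubini') (simp_all)
    also have "\<dots> = (\<integral>\<^sup>+x. (\<integral>\<^sup>+y. indicator A (x - y) \<partial>lborel) * indicator B x \<partial>N)"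
      by (simp add: nn_integral_multc)
    also have "\<dots> = emeasure lborel A * emeasure lborel B"
      by (subst nn_integral_lborel_reflect) (simp_all add: nn_integral_cmult NB)
    finally have "emeasure N A = emeasure lborel A"
      using B_fin B_pos by (auto simp: ennreal_mult_cancel_left mult.commute[of _ "emeasure lborel B"])
    then show "emeasure (distr lborel borel R) A = emeasure lborel A" by (simp add: N_def)
  qed simp
qed

text \<open>The squared norm is a sum over \<open>Basis\<close>, so the integral factors into
  one-dimensional ones.\<close>

lemma nn_integral_gaussian:
  assumes "a > 0"
  shows "(\<integral>\<^sup>+x. ennreal (exp (- a * (norm (x::'a::euclidean_space))\<^sup>2)) \<partial>lborel) = ennreal (sqrt (pi / a) ^ DIM('a))"
proof -
  \<comment> \<open>With this standard deviation the normal density is a constant multiple of exp(-a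
    x^2), and its total mass 1 yields the value sqrt (pi / a).\<close>
  define s where "s = sqrt (1 / (2 * a))"
  have s: "s > 0" "2 * s\<^sup>2 = 1 / a" using assms by (simp_all add: s_def)
  have one: "(\<integral>\<^sup>+x. ennreal (exp (- a * x\<^sup>2)) \<partial>lborel) = ennreal (sqrt (pi / a))"
  proof -
    have "exp (- a * x\<^sup>2) = sqrt (pi / a) * normal_density 0 s x" for x
    proof -
      have "2 * pi * s\<^sup>2 = pi / a" using s by (simp add: field_simps)
      moreover have "- (x - 0)\<^sup>2 / (2 * s\<^sup>2) = - a * x\<^sup>2" unfolding s(2) by simp
      moreover have "sqrt (pi / a) > 0" using assms by simp
      ultimately show ?thesis unfolding normal_density_def using assms by simp
    qed
    then have "(\<integral>\<^sup>+x. ennreal (exp (- a * x\<^sup>2)) \<partial>lborel)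
        = (\<integral>\<^sup>+x. ennreal (sqrt (pi / a) * normal_density 0 s x) \<partial>lborel)" by simp
    also have "\<dots> = ennreal (\<integral>x. sqrt (pi / a) * normal_density 0 s x \<partial>lborel)"
      using s assms by (intro nn_integral_eq_integral) auto
    also have "\<dots> = ennreal (sqrt (pi / a))"
      using s by simp
    finally show ?thesis .
  qed
  have "exp (- a * (norm x)\<^sup>2) = (\<Prod>b\<in>Basis. exp (- a * (x \<bullet> b)\<^sup>2))" for x :: 'a
    by (simp add: exp_sum[symmetric] sum_distrib_left power2_norm_eq_inner
        euclidean_inner[of x x] sum_negf flip: power2_eq_square)
  then have "(\<integral>\<^sup>+x. ennreal (exp (- a * (norm (x::'a))\<^sup>2)) \<partial>lborel)
      = (\<integral>\<^sup>+x. (\<Prod>b\<in>Basis. ennreal (exp (- a * ((x::'a) \<bullet> b)\<^sup>2))) \<partial>lborel)"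
    by (simp add: prod_ennreal)
  also have "\<dots> = (\<Prod>b\<in>(Basis::'a set). \<integral>\<^sup>+x. ennreal (exp (- a * x\<^sup>2)) \<partial>lborel)"
    by (rule nn_integral_lborel_prod) simp_all
  also have "\<dots> = ennreal (sqrt (pi / a) ^ DIM('a))"
    unfolding one using assms by (simp add: ennreal_power)
  finally show ?thesis .
qed

lemma integrable_gaussian:
  assumes "a > 0"
  shows "integrable lborel (\<lambda>x::'a::euclidean_space. exp (- a * (norm x)\<^sup>2))"
  using nn_integral_gaussian[OF assms, where 'a = 'a]
  by (intro integrableI_nonneg) simp_all

section \<open>Averages over circles\<close>

text \<open>Normalised arc length of the unit circle, as a probability measure on the whole plane:
  it can be paired with other measures in Fubini's theorem, at the price that |\<zeta>| = 1 holds
  only almost everywhere.\<close>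

definition circ :: "complex measure" where
  "circ = distr (uniform_measure lborel {0..2 * pi}) borel cis"

lemma cis_measurable [measurable]: "cis \<in> borel_measurable borel"
  by (intro borel_measurable_continuous_onI continuous_intros)

lemma sets_circ [simp, measurable_cong]: "sets circ = sets borel"
  by (simp add: circ_def)

lemma space_circ [simp]: "space circ = UNIV"
  by (simp add: circ_def)

lemma prob_space_circ: "prob_space circ"
  unfolding circ_def
  by (intro prob_space.prob_space_distr prob_space_uniform_measure) simp_all

interpretation circ: prob_space circ
  by (rule prob_space_circ)

lemma AE_circ: "AE \<zeta> in circ. norm \<zeta> = 1"
  unfolding circ_def by (subst AE_distr_iff) simp_all

lemma integrable_circ:
  fixes f :: "complex \<Rightarrow> 'b::{banach, second_countable_topology}"
  assumes f: "continuous_on UNIV f"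
  shows "integrable circ f"
proof -
  have [measurable]: "f \<in> borel_measurable borel"
    using f by (rule borel_measurable_continuous_onI)
  obtain C where C: "\<And>z. z \<in> sphere 0 1 \<Longrightarrow> norm (f z) \<le> C"
  proof -
    have "compact (f ` sphere 0 1)"
      by (intro compact_continuous_image continuous_on_subset[OF f]) auto
    then have "bounded (f ` sphere 0 1)" by (rule compact_imp_bounded)
    then show ?thesis unfolding bounded_iff by (meson imageI that)
  qed
  show ?thesis
  proof (rule circ.integrable_const_bound[where B = C])
    show "AE z in circ. norm (f z) \<le> C"
      using AE_circ by eventually_elim (simp add: C)
  qed measurable
qed

text \<open>Links the Lebesgue integral over \<open>circ\<close> with the gauge integral over an
  interval in which contour integrals are expressed.\<close>

lemma integral_circ:
  fixes f :: "complex \<Rightarrow> complex"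
  assumes f: "continuous_on UNIV f"
  shows "integral\<^sup>L circ f = integral {0..2 * pi} (\<lambda>t. f (cis t)) / (2 * pi)"
proof -
  have [measurable]: "f \<in> borel_measurable borel"
    using f by (rule borel_measurable_continuous_onI)
  have cont: "continuous_on {0..2*pi} (\<lambda>t. f (cis t))"
    by (intro continuous_on_compose2[OF f] continuous_intros) auto
  have "integral\<^sup>L circ f = (\<integral>t. f (cis t) \<partial>uniform_measure lborel {0..2 * pi})"
    unfolding circ_def by (subst integral_distr) simp_all
  also have "\<dots> = (\<integral>t. f (cis t) \<partial>density lborel (\<lambda>x. ennreal (indicator {0..2 * pi} x / (2 * pi))))"
    unfolding uniform_measure_def
    by (intro arg_cong2[where f = "integral\<^sup>L"] density_cong refl)
      (auto simp: indicator_def ennreal_1[symmetric] divide_ennreal simp del: ennreal_1)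
  also have "\<dots> = (\<integral>t. (indicator {0..2 * pi} t / (2 * pi)) *\<^sub>R f (cis t) \<partial>lborel)"
    by (subst integral_density) (simp_all)
  also have "\<dots> = (\<integral>t. (1 / (2 * pi)) *\<^sub>R (indicator {0..2 * pi} t *\<^sub>R f (cis t)) \<partial>lborel)"
    by simp
  also have "\<dots> = (1 / (2 * pi)) *\<^sub>R (\<integral>t\<in>{0..2*pi}. f (cis t) \<partial>lborel)"
    unfolding set_lebesgue_integral_def by (rule integral_scaleR_right)
  also have "(\<integral>t\<in>{0..2*pi}. f (cis t) \<partial>lborel) = integral {0..2 * pi} (\<lambda>t. f (cis t))"
    by (rule set_borel_integral_eq_integral(2)) (rule borel_integrable_atLeastAtMost'[OF cont])
  finally show ?thesis by (simp add: scaleR_conv_of_real)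
qed

text \<open>Cauchy's formula for higher derivatives, read as a mean value: on the unit circle
  \<open>cnj\<close> is inversion, and the velocity of the path cancels one power of the
  denominator.\<close>

lemma taylor_coeff_circ:
  assumes f: "f holomorphic_on UNIV" and r: "r > 0"
  shows "(deriv ^^ k) f 0 / fact k = (\<integral>\<zeta>. f (complex_of_real r * \<zeta>) * cnj \<zeta> ^ k \<partial>circ) / r ^ k"
proof -
  have contf: "continuous_on UNIV f" using f by (rule holomorphic_on_imp_continuous_on)
  have "((\<lambda>u. f u / (u - 0) ^ Suc k) has_contour_integral (2 * pi) * \<i> / (fact k) * (deriv ^^ k) f 0)
      (part_circlepath 0 r 0 (2 * pi))"
    using Cauchy_has_contour_integral_higher_derivative_circlepath[of 0 r f 0 k] f contf r
    by (auto simp: circlepath_def intro: holomorphic_on_subset continuous_on_subset)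
  then have "((\<lambda>t. f (0 + r * cis t) / (0 + r * cis t - 0) ^ Suc k * r * \<i> * cis t) has_integral
      (2 * pi) * \<i> / (fact k) * (deriv ^^ k) f 0) {0..2 * pi}"
    by (subst (asm) has_contour_integral_part_circlepath_iff) simp_all
  moreover have "f (0 + r * cis t) / (0 + r * cis t - 0) ^ Suc k * r * \<i> * cis t
      = (\<i> / r ^ k) * (f (r * cis t) * cnj (cis t) ^ k)" for t
    using r by (simp add: power_mult_distrib field_simps cis_cnj cis_inverse[symmetric] power_inverse)
  ultimately have "((\<lambda>t. (\<i> / r ^ k) * (f (r * cis t) * cnj (cis t) ^ k)) has_integral
      (2 * pi) * \<i> / (fact k) * (deriv ^^ k) f 0) {0..2 * pi}" by simp
  then have "integral {0..2 * pi} (\<lambda>t. (\<i> / r ^ k) * (f (r * cis t) * cnj (cis t) ^ k))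
      = (2 * pi) * \<i> / (fact k) * (deriv ^^ k) f 0" by (rule integral_unique)
  then have "(\<i> / r ^ k) * integral {0..2 * pi} (\<lambda>t. f (r * cis t) * cnj (cis t) ^ k)
      = (2 * pi) * \<i> / (fact k) * (deriv ^^ k) f 0" by simp
  moreover have "(\<integral>\<zeta>. f (complex_of_real r * \<zeta>) * cnj \<zeta> ^ k \<partial>circ)
      = integral {0..2 * pi} (\<lambda>t. f (r * cis t) * cnj (cis t) ^ k) / (2 * pi)"
    by (rule integral_circ) (intro continuous_intros continuous_on_compose2[OF contf]; simp)
  moreover have "x / fact k = y / (2 * pi) / r ^ k" if "(\<i> / r ^ k) * y = (2 * pi) * \<i> / (fact k) * x" for x y :: complex
  proof -
    have "\<i> * (y / r ^ k) = \<i> * (2 * pi * (x / fact k))" using that by (simp add: ac_simps)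
    then have "y / r ^ k = 2 * pi * (x / fact k)" by (simp only: mult_cancel_left) simp
    moreover have "complex_of_real (r ^ k) \<noteq> 0" using r by simp
    ultimately have "y = 2 * pi * (x / fact k) * r ^ k" by (metis nonzero_divide_eq_eq)
    then show ?thesis using r by simp
  qed
  ultimately show ?thesis by (simp only:)
qed

lemma mean_value_circ:
  assumes "f holomorphic_on UNIV"
  shows "(\<integral>\<zeta>. f \<zeta> \<partial>circ) = f 0"
  using taylor_coeff_circ[OF assms, of 1 0] by simp

section \<open>Sampling products of entire functions on the diagonal\<close>

text \<open>Quadratic mean over the circle of radius 2. A radius above 1 makes the Taylor series at
  the point 1 converge geometrically; the quadratic mean is chosen because its square can later be
  integrated over base points to an L^2 norm.\<close>

definition circ_norm :: "(complex \<Rightarrow> complex) \<Rightarrow> real" where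
  "circ_norm F = sqrt (\<integral>\<zeta>. (norm (F (2 * \<zeta>)))\<^sup>2 \<partial>circ)"

definition tcoeff :: "(complex \<Rightarrow> complex) \<Rightarrow> nat \<Rightarrow> complex" where
  "tcoeff F k = (deriv ^^ k) F 0 / fact k"

lemma circ_norm_nonneg: "circ_norm F \<ge> 0"
  by (simp add: circ_norm_def)

lemma tcoeff_sums:
  assumes "F holomorphic_on UNIV"
  shows "(\<lambda>k. tcoeff F k * z ^ k) sums F z"
  using holomorphic_power_series[of F 0 "norm z + 1" z] assms
  by (auto simp: tcoeff_def intro: holomorphic_on_subset)

text \<open>Cauchy's estimate on the circle of radius 2, with the mean of |F| replaced by the
  quadratic mean.\<close>

lemma norm_tcoeff_le:
  assumes F: "F holomorphic_on UNIV"
  shows "norm (tcoeff F k) \<le> circ_norm F * (1 / 2) ^ k"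
proof -
  have contF: "continuous_on UNIV F" using F by (rule holomorphic_on_imp_continuous_on)
  have c: "continuous_on UNIV (\<lambda>\<zeta>. F (2 * \<zeta>))"
    by (intro continuous_intros continuous_on_compose2[OF contF]) auto
  define m where "m = (\<integral>\<zeta>. norm (F (2 * \<zeta>)) \<partial>circ)"
  have i1: "integrable circ (\<lambda>\<zeta>. norm (F (2 * \<zeta>)))"
    by (intro integrable_circ continuous_intros c)
  have i2: "integrable circ (\<lambda>\<zeta>. (norm (F (2 * \<zeta>)))\<^sup>2)"
    by (intro integrable_circ continuous_intros c)
  \<comment> \<open>The variance of |F (2 \<zeta>)| is nonnegative, so the mean is at most the
    quadratic mean.\<close>
  have "0 \<le> (\<integral>\<zeta>. (norm (F (2 * \<zeta>)) - m)\<^sup>2 \<partial>circ)" by simp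
  also have "\<dots> = (\<integral>\<zeta>. (norm (F (2 * \<zeta>)))\<^sup>2 - 2 * m * norm (F (2 * \<zeta>)) + m\<^sup>2 \<partial>circ)"
    by (intro Bochner_Integration.integral_cong) (auto simp: power2_diff)
  also have "\<dots> = (\<integral>\<zeta>. (norm (F (2 * \<zeta>)))\<^sup>2 \<partial>circ) - m\<^sup>2"
    using i1 i2 by (simp add: m_def[symmetric] circ.prob_space[simplified] power2_eq_square)
  finally have "m \<le> circ_norm F"
    unfolding circ_norm_def by (intro real_le_rsqrt) simp
  have "norm (tcoeff F k) * 2 ^ k = norm (\<integral>\<zeta>. F (2 * \<zeta>) * cnj \<zeta> ^ k \<partial>circ)"
    using taylor_coeff_circ[OF F, of 2 k] by (simp add: tcoeff_def norm_divide norm_power)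
  also have "\<dots> \<le> (\<integral>\<zeta>. norm (F (2 * \<zeta>) * cnj \<zeta> ^ k) \<partial>circ)"
    by (rule integral_norm_bound)
  also have "\<dots> = m"
    unfolding m_def
  proof (rule integral_cong_AE)
    show "AE \<zeta> in circ. norm (F (2 * \<zeta>) * cnj \<zeta> ^ k) = norm (F (2 * \<zeta>))"
      using AE_circ by eventually_elim (simp add: norm_mult norm_power)
    show "(\<lambda>\<zeta>. norm (F (2 * \<zeta>) * cnj \<zeta> ^ k)) \<in> borel_measurable circ"
      by (intro borel_measurable_integrable integrable_circ continuous_intros c)
  qed (use i1 in auto)
  finally have "norm (tcoeff F k) * 2 ^ k \<le> circ_norm F" using \<open>m \<le> circ_norm F\<close> by simp
  then show ?thesis by (simp add: pos_le_divide_eq power_one_over divide_inverse[symmetric])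
qed

text \<open>A geometric sum over an \<open>N\<close>-th root of unity other than 1.\<close>

lemma sum_powers_root_of_unity:
  fixes x :: int and N :: nat
  assumes N: "N > 0" and nd: "\<not> int N dvd x"
  shows "(\<Sum>l<N. cis (2 * pi * x / N) ^ l) = 0"
proof -
  define q where "q = cis (2 * pi * x / N)"
  have "q ^ N = 1"
    using N unfolding q_def by (subst Complex.DeMoivre) simp
  moreover have "q \<noteq> 1"
  proof
    assume "q = 1"
    then have "cos (2 * pi * x / N) = 1"
      by (metis q_def cis.simps(1) one_complex.simps(1))
    then obtain j :: int where "2 * pi * x / N = of_int j * (2 * pi)"
      using cos_one_2pi_int by auto
    then have "real_of_int x = of_int (j * int N)" using N by (simp add: field_simps)
    then have "x = j * int N" by (simp only: of_int_eq_iff)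
    then show False using nd by simp
  qed
  ultimately show ?thesis unfolding q_def[symmetric] by (subst geometric_sum) auto
qed

text \<open>A discrete Fourier transform on the circle of radius r: the nodes are r times the
  \<open>N\<close>-th roots of unity, the weights pick out the mode \<open>m\<close>. Only pairs (j,
  k) of Taylor indices with k = j + m modulo \<open>N\<close> survive; the pair (0, m) gets weight 1
  after division by r^m, every other one keeps at least one factor r. The list depends only on
  \<open>e\<close> and \<open>m\<close>, so the estimate is uniform in \<open>F\<close> and
  \<open>G\<close>.\<close>

lemma sample_coeff_product:
  assumes e: "e > 0"
  shows "\<exists>xs::(complex \<times> complex) list. (\<forall>(c, a)\<in>set xs. norm a \<le> 1) \<and>
    (\<forall>F G. F holomorphic_on UNIV \<longrightarrow> G holomorphic_on UNIV \<longrightarrow>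
      norm ((\<Sum>(c, a)\<leftarrow>xs. c * (F a * cnj (G a))) - tcoeff F 0 * cnj (tcoeff G m))
        \<le> e * (circ_norm F * circ_norm G))"
proof -
  \<comment> \<open>The Taylor coefficients of each function have absolute sum at most twice its
    \<open>circ_norm\<close>, so the error is at most 4 r times the product of the norms. The bound
    r \<le> 1 keeps the nodes in the unit disc and makes higher powers of r smaller.\<close>
  define r where "r = min 1 (e / 4)"
  have r: "0 < r" "r \<le> 1" "4 * r \<le> e" using e by (auto simp: r_def)
  \<comment> \<open>For j + k \<le> m the number j + m - k lies between 0 and 2 m. With this
    \<open>N\<close> it is a multiple of \<open>N\<close> only if it is 0, that is for (j, k) = (0,
    m); all aliased pairs have j + k > m.\<close>
  define N where "N = 2 * m + 1"
  have "N > 0" by (simp add: N_def)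
  define w where "w l = cis (2 * pi * real l / N)" for l
  define cf where "cf l = w l ^ m / (of_nat N * r ^ m)" for l
  define a where "a l = complex_of_real r * w l" for l
  define xs where "xs = map (\<lambda>l. (cf l, a l)) [0..<N]"
  have sum_xs: "(\<Sum>(c, a)\<leftarrow>xs. c * (F a * cnj (G a))) = (\<Sum>l<N. cf l * (F (a l) * cnj (G (a l))))" for F G
    unfolding xs_def by (simp add: o_def interv_sum_list_conv_sum_set_nat atLeast0LessThan)
  \<comment> \<open>The factor with which coefficient j of \<open>F\<close> times the conjugate of
    coefficient k of \<open>G\<close> enters the sampled sum.\<close>
  define d where "d j k = (\<Sum>l<N. cf l * (a l ^ j * cnj (a l) ^ k))" for j k
  have d_eq: "d j k = of_real (r ^ (j + k) / r ^ m / N) * (\<Sum>l<N. cis (2 * pi * (int j + int m - int k) / N) ^ l)" for j k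
  proof -
    have "w l ^ m * (w l ^ j * cnj (w l) ^ k) = cis (2 * pi * (int j + int m - int k) / N) ^ l" for l
    proof -
      have "real m * (2 * pi * real l / N) + (real j * (2 * pi * real l / N) + real k * - (2 * pi * real l / N))
          = real l * (2 * pi * real_of_int (int j + int m - int k) / N)"
      proof -
        define t where "t = 2 * pi * real l / N"
        have "real l * (2 * pi * real_of_int (int j + int m - int k) / N) = t * (real j + real m - real k)"
          by (simp add: t_def)
        then show ?thesis unfolding t_def[symmetric] by (simp add: algebra_simps)
      qed
      then show ?thesis
        unfolding w_def Complex.DeMoivre cis_cnj cis_mult by (rule arg_cong)
    qed
    moreover have "cf l * (a l ^ j * cnj (a l) ^ k)
        = of_real (r ^ (j + k) / r ^ m / N) * (w l ^ m * (w l ^ j * cnj (w l) ^ k))" for l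
      unfolding cf_def a_def by (simp add: power_mult_distrib power_add mult_ac)
    ultimately have "cf l * (a l ^ j * cnj (a l) ^ k)
        = of_real (r ^ (j + k) / r ^ m / N) * cis (2 * pi * (int j + int m - int k) / N) ^ l" for l
      by simp
    then show ?thesis unfolding d_def sum_distrib_left by (intro sum.cong refl)
  qed
  have d_main: "d 0 m = 1"
    unfolding d_eq using r \<open>N > 0\<close> by simp
  have d_err: "norm (d j k) \<le> r" if jk: "(j, k) \<noteq> (0, m)" for j k
  proof (cases "int N dvd (int j + int m - int k)")
    case False
    then show ?thesis unfolding d_eq sum_powers_root_of_unity[OF \<open>N > 0\<close> False] using r by simp
  next
    case True
    then obtain q where q: "int j + int m - int k = int N * q" by auto
    have "m < j + k"
    proof (rule ccontr)
      assume "\<not> m < j + k"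
      then have le: "int j + int k \<le> int m" by simp
      have "int N * q < int N * 1" "int N * (-1) < int N * q"
        unfolding q[symmetric] using le by (simp_all add: N_def)
      then have "q < 1" "-1 < q"
        using \<open>N > 0\<close> by (simp_all only: mult_less_cancel_left_pos of_nat_0_less_iff)
      then have "q = 0" by simp
      with q le jk show False by simp
    qed
    have "norm (d j k) = r ^ (j + k) / r ^ m / N * norm (\<Sum>l<N. cis (2 * pi * (int j + int m - int k) / N) ^ l)"
      unfolding d_eq norm_mult norm_of_real using r by simp
    also have "\<dots> \<le> r ^ (j + k) / r ^ m / N * N"
    proof (intro mult_left_mono)
      show "norm (\<Sum>l<N. cis (2 * pi * (int j + int m - int k) / N) ^ l) \<le> real N"
        by (rule order.trans[OF norm_sum]) (simp add: norm_power)
    qed (use r in simp)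
    also have "\<dots> = r ^ (j + k - m)"
      using r \<open>m < j + k\<close> by (simp add: N_def power_diff)
    also have "\<dots> \<le> r ^ 1"
      using r \<open>m < j + k\<close> by (intro power_decreasing) auto
    finally show ?thesis by simp
  qed
  have "norm ((\<Sum>l<N. cf l * (F (a l) * cnj (G (a l)))) - tcoeff F 0 * cnj (tcoeff G m))
        \<le> e * (circ_norm F * circ_norm G)"
    if F: "F holomorphic_on UNIV" and G: "G holomorphic_on UNIV" for F G
  proof -
    define f where "f = tcoeff F"
    define g where "g = tcoeff G"
    \<comment> \<open>The estimate is proved for Taylor polynomials, where all sums are finite and
      can be rearranged freely, and passes to the limit because the bound does not depend on the
      degree.\<close>
    define SF where "SF J z = (\<Sum>j<J. f j * z ^ j)" for J z
    define SG where "SG J z = (\<Sum>j<J. g j * z ^ j)" for J z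
    have limF: "(\<lambda>J. SF J z) \<longlonglongrightarrow> F z" for z
      using tcoeff_sums[OF F, of z] by (simp add: SF_def f_def sums_def)
    have limG: "(\<lambda>J. SG J z) \<longlonglongrightarrow> G z" for z
      using tcoeff_sums[OF G, of z] by (simp add: SG_def g_def sums_def)
    have half: "(\<Sum>j<J. (1 / 2) ^ j) \<le> (2::real)" for J :: nat
      by (subst geometric_sum) (simp_all add: field_simps)
    have fsum: "(\<Sum>j<J. norm (f j)) \<le> 2 * circ_norm F" for J
    proof -
      have "(\<Sum>j<J. norm (f j)) \<le> (\<Sum>j<J. circ_norm F * (1 / 2) ^ j)"
        using norm_tcoeff_le[OF F] by (intro sum_mono) (simp add: f_def)
      also have "\<dots> \<le> circ_norm F * 2"
        unfolding sum_distrib_left[symmetric] by (intro mult_left_mono half circ_norm_nonneg)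
      finally show ?thesis by simp
    qed
    have gsum: "(\<Sum>j<J. norm (g j)) \<le> 2 * circ_norm G" for J
    proof -
      have "(\<Sum>j<J. norm (g j)) \<le> (\<Sum>j<J. circ_norm G * (1 / 2) ^ j)"
        using norm_tcoeff_le[OF G] by (intro sum_mono) (simp add: g_def)
      also have "\<dots> \<le> circ_norm G * 2"
        unfolding sum_distrib_left[symmetric] by (intro mult_left_mono half circ_norm_nonneg)
      finally show ?thesis by simp
    qed
    have bound: "norm ((\<Sum>l<N. cf l * (SF J (a l) * cnj (SG J (a l)))) - f 0 * cnj (g m))
        \<le> e * (circ_norm F * circ_norm G)" if J: "J > m" for J
    proof -
      have "(\<Sum>l<N. cf l * (SF J (a l) * cnj (SG J (a l))))
          = (\<Sum>l<N. \<Sum>j<J. \<Sum>k<J. f j * cnj (g k) * (cf l * (a l ^ j * cnj (a l) ^ k)))"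
        unfolding SF_def SG_def cnj_sum sum_product unfolding sum_distrib_left
        by (intro sum.cong refl) (simp only: complex_cnj_mult complex_cnj_power mult_ac)
      also have "\<dots> = (\<Sum>j<J. \<Sum>l<N. \<Sum>k<J. f j * cnj (g k) * (cf l * (a l ^ j * cnj (a l) ^ k)))"
        by (rule sum.swap)
      also have "\<dots> = (\<Sum>j<J. \<Sum>k<J. f j * cnj (g k) * d j k)"
        unfolding d_def sum_distrib_left by (intro sum.cong refl sum.swap)
      also have "\<dots> = (\<Sum>(j, k)\<in>{..<J} \<times> {..<J}. f j * cnj (g k) * d j k)"
        by (rule sum.cartesian_product)
      \<comment> \<open>The pair (0, m) is among the indices because m < J.\<close>
      also have "\<dots> = f 0 * cnj (g m) + (\<Sum>(j, k)\<in>{..<J} \<times> {..<J} - {(0, m)}. f j * cnj (g k) * d j k)"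
        using J by (subst sum.remove[of _ "(0, m)"]) (auto simp: d_main)
      finally have "norm ((\<Sum>l<N. cf l * (SF J (a l) * cnj (SG J (a l)))) - f 0 * cnj (g m))
          = norm (\<Sum>(j, k)\<in>{..<J} \<times> {..<J} - {(0, m)}. f j * cnj (g k) * d j k)" by simp
      also have "\<dots> \<le> (\<Sum>(j, k)\<in>{..<J} \<times> {..<J} - {(0, m)}. norm (f j) * norm (g k) * r)"
      proof (intro order.trans[OF norm_sum] sum_mono)
        fix p assume "p \<in> {..<J} \<times> {..<J} - {(0, m)}"
        then have "norm (d (fst p) (snd p)) \<le> r" by (intro d_err) auto
        then show "norm (case p of (j, k) \<Rightarrow> f j * cnj (g k) * d j k)
            \<le> (case p of (j, k) \<Rightarrow> norm (f j) * norm (g k) * r)"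
          unfolding case_prod_beta norm_mult complex_mod_cnj by (rule mult_left_mono) simp
      qed
      also have "\<dots> \<le> (\<Sum>(j, k)\<in>{..<J} \<times> {..<J}. norm (f j) * norm (g k) * r)"
        using r by (intro sum_mono2) auto
      also have "\<dots> = r * ((\<Sum>j<J. norm (f j)) * (\<Sum>k<J. norm (g k)))"
        unfolding sum_product unfolding sum_distrib_left sum.cartesian_product[symmetric]
        by (intro sum.cong refl) (simp only: mult_ac)
      also have "\<dots> \<le> r * ((2 * circ_norm F) * (2 * circ_norm G))"
        using r circ_norm_nonneg[of F] by (intro mult_left_mono mult_mono fsum gsum sum_nonneg) auto
      also have "\<dots> = (4 * r) * (circ_norm F * circ_norm G)" by simp
      also have "\<dots> \<le> e * (circ_norm F * circ_norm G)"
        using r circ_norm_nonneg[of F] circ_norm_nonneg[of G] by (intro mult_right_mono) auto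
      finally show ?thesis .
    qed
    have lim: "(\<lambda>J. norm ((\<Sum>l<N. cf l * (SF J (a l) * cnj (SG J (a l)))) - f 0 * cnj (g m)))
        \<longlonglongrightarrow> norm ((\<Sum>l<N. cf l * (F (a l) * cnj (G (a l)))) - f 0 * cnj (g m))"
      by (intro tendsto_intros limF limG)
    show ?thesis
      unfolding f_def[symmetric] g_def[symmetric]
      by (rule tendsto_upperbound[OF lim]) (auto intro: eventually_mono[OF eventually_gt_at_top[of m]] bound)
  qed
  moreover have "\<forall>(c, a)\<in>set xs. norm a \<le> 1"
    using r by (auto simp: xs_def a_def w_def norm_mult)
  ultimately show ?thesis
    by (intro exI[of _ xs]) (simp add: sum_xs)
qed

text \<open>The target is additive in the coefficients of \<open>G\<close>, so a list for the new
  coefficient is appended, half of the tolerance going to each part.\<close>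

lemma sample_partial_sum:
  assumes e: "e > 0"
  shows "\<exists>xs::(complex \<times> complex) list. (\<forall>(c, a)\<in>set xs. norm a \<le> 1) \<and>
    (\<forall>F G. F holomorphic_on UNIV \<longrightarrow> G holomorphic_on UNIV \<longrightarrow>
      norm ((\<Sum>(c, a)\<leftarrow>xs. c * (F a * cnj (G a))) - tcoeff F 0 * cnj (\<Sum>k<m. tcoeff G k))
        \<le> e * (circ_norm F * circ_norm G))"
  using e
proof (induction m arbitrary: e)
  case 0
  then show ?case
    by (intro exI[of _ "[]"]) (simp add: circ_norm_nonneg)
next
  case (Suc m)
  obtain xs where xs: "\<forall>(c, a)\<in>set xs. norm a \<le> 1"
    "\<And>F G. F holomorphic_on UNIV \<Longrightarrow> G holomorphic_on UNIV \<Longrightarrow>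
      norm ((\<Sum>(c, a)\<leftarrow>xs. c * (F a * cnj (G a))) - tcoeff F 0 * cnj (\<Sum>k<m. tcoeff G k))
        \<le> e / 2 * (circ_norm F * circ_norm G)"
    using Suc.IH[of "e / 2"] Suc.prems by auto
  obtain ys where ys: "\<forall>(c, a)\<in>set ys. norm a \<le> 1"
    "\<And>F G. F holomorphic_on UNIV \<Longrightarrow> G holomorphic_on UNIV \<Longrightarrow>
      norm ((\<Sum>(c, a)\<leftarrow>ys. c * (F a * cnj (G a))) - tcoeff F 0 * cnj (tcoeff G m))
        \<le> e / 2 * (circ_norm F * circ_norm G)"
    using sample_coeff_product[of "e / 2" m] Suc.prems by auto
  show ?case
  proof (intro exI[of _ "xs @ ys"] conjI allI impI)
    show "\<forall>(c, a)\<in>set (xs @ ys). norm a \<le> 1" using xs(1) ys(1) by auto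
    fix F G :: "complex \<Rightarrow> complex"
    assume FG: "F holomorphic_on UNIV" "G holomorphic_on UNIV"
    have eq: "(\<Sum>(c, a)\<leftarrow>xs @ ys. c * (F a * cnj (G a))) - tcoeff F 0 * cnj (\<Sum>k<Suc m. tcoeff G k)
      = ((\<Sum>(c, a)\<leftarrow>xs. c * (F a * cnj (G a))) - tcoeff F 0 * cnj (\<Sum>k<m. tcoeff G k))
        + ((\<Sum>(c, a)\<leftarrow>ys. c * (F a * cnj (G a))) - tcoeff F 0 * cnj (tcoeff G m))"
      by (simp add: algebra_simps)
    have "e / 2 * (circ_norm F * circ_norm G) + e / 2 * (circ_norm F * circ_norm G) = e * (circ_norm F * circ_norm G)"
      by simp
    with norm_triangle_mono[OF xs(2)[OF FG] ys(2)[OF FG]]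
    show "norm ((\<Sum>(c, a)\<leftarrow>xs @ ys. c * (F a * cnj (G a))) - tcoeff F 0 * cnj (\<Sum>k<Suc m. tcoeff G k))
        \<le> e * (circ_norm F * circ_norm G)" unfolding eq by (simp only:)
  qed
qed

text \<open>On the diagonal circle \<open>|\<zeta>| = r\<close> the Fourier mode \<open>m\<close> of \<open>F \<zeta> * cnj (G \<zeta>)\<close> is
  \<open>r ^ m\<close> times the product of the Taylor coefficients \<open>0\<close> of \<open>F\<close> and \<open>m\<close> of \<open>G\<close>, up to higher
  powers of \<open>r\<close>. Hence the polarised value \<open>F 0 * cnj (G 1)\<close> can be sampled on the diagonal.\<close>

lemma sample_off_diagonal:
  assumes e: "e > 0"
  obtains n :: nat and c a :: "nat \<Rightarrow> complex" where "\<And>i. norm (a i) \<le> 1"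
    "\<And>F G. F holomorphic_on UNIV \<Longrightarrow> G holomorphic_on UNIV \<Longrightarrow>
      norm ((\<Sum>i<n. c i * (F (a i) * cnj (G (a i)))) - F 0 * cnj (G 1)) \<le> e * (circ_norm F * circ_norm G)"
proof -
  \<comment> \<open>The Taylor tail of \<open>G\<close> at 1 from index M on is at most 2 (1/2)^M
    \<open>circ_norm G\<close>, hence at most e/2 times this norm. The other e/2 is the sampling
    error.\<close>
  obtain M where M: "(1 / 2) ^ M < e / 4"
    using real_arch_pow_inv[of "e / 4" "1 / 2"] e by auto
  obtain xs where xs: "\<forall>(c, a)\<in>set xs. norm a \<le> 1"
    "\<And>F G. F holomorphic_on UNIV \<Longrightarrow> G holomorphic_on UNIV \<Longrightarrow>
      norm ((\<Sum>(c, a)\<leftarrow>xs. c * (F a * cnj (G a))) - tcoeff F 0 * cnj (\<Sum>k<M. tcoeff G k))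
        \<le> e / 2 * (circ_norm F * circ_norm G)"
    using sample_partial_sum[of "e / 2" M] e by auto
  \<comment> \<open>The default 0 beyond the list makes the bound on the nodes hold for every
    index.\<close>
  define a where "a i = (if i < length xs then snd (xs ! i) else 0)" for i
  define c where "c i = fst (xs ! i)" for i
  have "norm (a i) \<le> 1" for i
    using xs(1) by (auto simp: a_def case_prod_beta)
  moreover have "norm ((\<Sum>i<length xs. c i * (F (a i) * cnj (G (a i)))) - F 0 * cnj (G 1))
      \<le> e * (circ_norm F * circ_norm G)"
    if F: "F holomorphic_on UNIV" and G: "G holomorphic_on UNIV" for F G
  proof -
    define g where "g = tcoeff G"
    have s: "(\<Sum>i<length xs. c i * (F (a i) * cnj (G (a i)))) = (\<Sum>(c, a)\<leftarrow>xs. c * (F a * cnj (G a)))"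
      by (simp add: sum_list_sum_nth atLeast0LessThan a_def c_def case_prod_beta)
    have F0: "tcoeff F 0 = F 0" by (simp add: tcoeff_def)
    have gle: "norm (g k) \<le> circ_norm G * (1 / 2) ^ k" for k
      using norm_tcoeff_le[OF G, of k] by (simp add: g_def)
    have sg: "g sums G 1" using tcoeff_sums[OF G, of 1] by (simp add: g_def)
    have geo: "(\<lambda>k. circ_norm G * (1 / 2) ^ (k + M)) sums (circ_norm G * (1 / 2) ^ M * 2)"
    proof -
      have "(\<lambda>k. (1 / 2) ^ k) sums (2::real)"
        using geometric_sums[of "1 / 2 :: real"] by simp
      from sums_mult[OF this, of "circ_norm G * (1 / 2) ^ M"] show ?thesis
        unfolding power_add by (simp only: ac_simps)
    qed
    have "G 1 - (\<Sum>k<M. g k) = (\<Sum>k. g (k + M))"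
      by (rule sums_unique) (rule sums_split_initial_segment[OF sg])
    also have "norm \<dots> \<le> (\<Sum>k. circ_norm G * (1 / 2) ^ (k + M))"
      by (rule norm_suminf_le[OF gle sums_summable[OF geo]])
    also have "\<dots> = circ_norm G * (1 / 2) ^ M * 2" by (rule sums_unique[OF geo, symmetric])
    also have "\<dots> \<le> circ_norm G * (e / 4) * 2"
      using M circ_norm_nonneg[of G] by (intro mult_right_mono mult_left_mono) auto
    finally have tail: "norm (G 1 - (\<Sum>k<M. g k)) \<le> e / 2 * circ_norm G" by simp
    have nF: "norm (F 0) \<le> circ_norm F" using norm_tcoeff_le[OF F, of 0] by (simp add: F0)
    have "(\<Sum>(c, a)\<leftarrow>xs. c * (F a * cnj (G a))) - F 0 * cnj (G 1)
      = ((\<Sum>(c, a)\<leftarrow>xs. c * (F a * cnj (G a))) - F 0 * cnj (\<Sum>k<M. g k)) + - (F 0 * cnj (G 1 - (\<Sum>k<M. g k)))"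
      by (simp add: algebra_simps)
    also have "norm \<dots> \<le> e / 2 * (circ_norm F * circ_norm G) + circ_norm F * (e / 2 * circ_norm G)"
    proof (rule norm_triangle_mono)
      show "norm ((\<Sum>(c, a)\<leftarrow>xs. c * (F a * cnj (G a))) - F 0 * cnj (\<Sum>k<M. g k)) \<le> e / 2 * (circ_norm F * circ_norm G)"
        using xs(2)[OF F G] by (simp add: F0 g_def)
      show "norm (- (F 0 * cnj (G 1 - (\<Sum>k<M. g k)))) \<le> circ_norm F * (e / 2 * circ_norm G)"
        unfolding norm_minus_cancel norm_mult complex_mod_cnj
        by (intro mult_mono nF tail circ_norm_nonneg) simp
    qed
    also have "\<dots> = e * (circ_norm F * circ_norm G)" by (simp add: algebra_simps)
    finally show ?thesis unfolding s .
  qed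
  ultimately show ?thesis by (rule that)
qed

section \<open>Entire functions and the Gaussian measure\<close>

definition hip :: "complex ^ 'n::finite \<Rightarrow> complex ^ 'n \<Rightarrow> complex" where
  "hip z w = (\<Sum>i\<in>UNIV. z $ i * cnj (w $ i))"

lemma hip_add_left: "hip (x + y) w = hip x w + hip y w"
  by (simp add: hip_def distrib_right sum.distrib)

lemma hip_add_right: "hip w (x + y) = hip w x + hip w y"
  by (simp add: hip_def distrib_left sum.distrib)

lemma hip_smult_left: "hip (c *s x) w = c * hip x w"
  by (simp add: hip_def sum_distrib_left mult.assoc)

lemma hip_zero_left [simp]: "hip 0 w = 0"
  by (simp add: hip_def)

lemma cnj_hip: "cnj (hip z w) = hip w z"
  by (simp add: hip_def mult.commute)

lemma Re_hip: "Re (hip z w) = z \<bullet> w"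
  by (simp add: hip_def inner_vec_def inner_complex_def)

lemma hip_self: "hip z z = complex_of_real ((norm z)\<^sup>2)"
  using cnj_hip[of z z] by (simp add: complex_eq_iff Re_hip power2_norm_eq_inner)

lemma norm_smult: "norm (c *s z) = norm c * norm (z :: complex ^ 'n::finite)"
proof -
  have "complex_of_real ((norm (c *s z))\<^sup>2) = c * cnj (c * hip z z)"
    unfolding hip_self[symmetric] by (metis cnj_hip hip_smult_left)
  also have "\<dots> = complex_of_real ((norm c * norm z)\<^sup>2)"
    by (simp add: hip_self power_mult_distrib complex_norm_square mult.assoc[symmetric] del: of_real_power)
  finally have "(norm (c *s z))\<^sup>2 = (norm c * norm z)\<^sup>2" by (simp only: of_real_eq_iff)
  then show ?thesis by (simp add: power2_eq_iff_nonneg)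
qed

text \<open>Multiplying \<open>z\<close> by a suitable phase makes the product equal to its modulus;
  then the real Cauchy-Schwarz inequality applies to its real part.\<close>

lemma norm_hip_le: "norm (hip z w) \<le> norm z * norm w"
proof (cases "hip z w = 0")
  case False
  define c where "c = cnj (hip z w) / norm (hip z w)"
  have c: "norm c = 1" using False by (simp add: c_def norm_divide)
  have "c * hip z w = (hip z w * cnj (hip z w)) / norm (hip z w)" by (simp add: c_def mult.commute)
  also have "\<dots> = norm (hip z w)"
    using False by (simp add: complex_norm_square[symmetric] power2_eq_square)
  finally have "norm (hip z w) = Re (hip (c *s z) w)" by (simp add: hip_smult_left)
  also have "\<dots> \<le> norm (c *s z) * norm w" unfolding Re_hip by (rule norm_cauchy_schwarz)
  finally show ?thesis by (simp add: norm_smult c)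
qed simp

lemma continuous_on_hip [continuous_intros]:
  "continuous_on S f \<Longrightarrow> continuous_on S g \<Longrightarrow> continuous_on S (\<lambda>x. hip (f x) (g x))"
  unfolding hip_def by (intro continuous_intros)

lemma measurable_hip [measurable]:
  assumes [measurable]: "f \<in> borel_measurable M" "g \<in> borel_measurable M"
  shows "(\<lambda>x. hip (f x) (g x)) \<in> borel_measurable M"
proof -
  have [measurable]: "(\<lambda>p::(complex^'n) \<times> (complex^'n). hip (fst p) (snd p)) \<in> borel_measurable (borel \<Otimes>\<^sub>M borel)"
    unfolding borel_prod by (intro borel_measurable_continuous_onI continuous_intros)
  have "(\<lambda>x. hip (fst (f x, g x)) (snd (f x, g x))) \<in> borel_measurable M"
    by (rule measurable_compose[where f = "\<lambda>x. (f x, g x)" and N = "borel \<Otimes>\<^sub>M borel"]) measurable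
  then show ?thesis by simp
qed

lemma bounded_linear_smult_left: "bounded_linear (\<lambda>c. c *s (u :: complex ^ 'n::finite))"
  unfolding linear_conv_bounded_linear[symmetric]
  by (rule linearI) (simp_all add: vec_eq_iff distrib_right)

lemma bounded_linear_smult_right: "bounded_linear (\<lambda>z. c *s (z :: complex ^ 'n::finite))"
  unfolding linear_conv_bounded_linear[symmetric]
  by (rule linearI) (simp_all add: vec_eq_iff distrib_left)

lemma bounded_linear_hip_left: "bounded_linear (\<lambda>z. hip z w)"
  unfolding linear_conv_bounded_linear[symmetric]
  by (rule linearI) (simp_all add: hip_def sum.distrib distrib_right scaleR_sum_right)

section \<open>Entire functions of several variables\<close>

lemma entireE:
  assumes "entire f"
  obtains D where "(f has_derivative D) (at z)" "\<And>c v. D (c *s v) = c * D v"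
  using assms unfolding entire_def by metis

lemma entire_continuous_on:
  assumes "entire f" shows "continuous_on S f"
  by (rule continuous_at_imp_continuous_on)
    (metis assms entireE has_derivative_continuous)

lemma entire_measurable:
  assumes "entire f" shows "f \<in> borel_measurable borel"
  by (intro borel_measurable_continuous_onI entire_continuous_on assms)

lemma entire_mult:
  assumes "entire f" "entire g" shows "entire (\<lambda>z. f z * g z)"
  unfolding entire_def
proof
  fix z
  obtain D where D: "(f has_derivative D) (at z)" "\<And>c v. D (c *s v) = c * D v"
    using entireE[OF assms(1), of "z"] by blast
  obtain E where E: "(g has_derivative E) (at z)" "\<And>c v. E (c *s v) = c * E v"
    using entireE[OF assms(2), of "z"] by blast
  show "\<exists>D. ((\<lambda>z. f z * g z) has_derivative D) (at z) \<and> (\<forall>c v. D (c *s v) = c * D v)"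
    using has_derivative_mult[OF D(1) E(1)]
    by (intro exI[of _ "\<lambda>h. f z * E h + D h * g z"]) (simp add: D E algebra_simps)
qed

lemma entire_shift:
  assumes "entire f" shows "entire (\<lambda>z. f (z + w))"
  unfolding entire_def
proof
  fix z
  obtain D where D: "(f has_derivative D) (at (z + w))" "\<And>c v. D (c *s v) = c * D v"
    using entireE[OF assms(1), of "z + w"] by blast
  have "((\<lambda>z. z + w) has_derivative (\<lambda>h. h)) (at z)"
    by (auto intro!: derivative_eq_intros)
  from has_derivative_compose[OF this D(1)]
  show "\<exists>D. ((\<lambda>z. f (z + w)) has_derivative D) (at z) \<and> (\<forall>c v. D (c *s v) = c * D v)"
    using D(2) by auto
qed

lemma entire_exp_hip: "entire (\<lambda>z. exp (c * hip z w))"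
  unfolding entire_def
proof
  fix z
  have "((\<lambda>z. c * hip z w) has_derivative (\<lambda>h. c * hip h w)) (at z)"
    by (intro has_derivative_mult_right bounded_linear_imp_has_derivative bounded_linear_hip_left)
  moreover have "(exp has_derivative (\<lambda>h. exp (c * hip z w) * h)) (at (c * hip z w))"
    using DERIV_exp[of "c * hip z w"] by (simp add: has_field_derivative_def)
  ultimately have "((\<lambda>z. exp (c * hip z w)) has_derivative (\<lambda>h. exp (c * hip z w) * (c * hip h w))) (at z)"
    by (rule has_derivative_compose)
  then show "\<exists>D. ((\<lambda>z. exp (c * hip z w)) has_derivative D) (at z) \<and> (\<forall>c v. D (c *s v) = c * D v)"
    by (intro exI[of _ "\<lambda>h. exp (c * hip z w) * (c * hip h w)"]) (simp add: hip_smult_left)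
qed

text \<open>On a complex line the complex-linear derivative acts as multiplication by the number
  \<open>D u\<close>. This opens the way to one-variable results: the mean value property and the
  sampling estimate.\<close>

lemma entire_on_line:
  assumes "entire f" shows "(\<lambda>\<zeta>. f (w + \<zeta> *s u)) holomorphic_on UNIV"
  unfolding holomorphic_on_def field_differentiable_def
proof
  fix \<zeta> :: complex
  obtain D where D: "(f has_derivative D) (at (w + \<zeta> *s u))" "\<And>c v. D (c *s v) = c * D v"
    using entireE[OF assms(1), of "w + \<zeta> *s u"] by blast
  have line: "((\<lambda>\<zeta>. w + \<zeta> *s u) has_derivative (\<lambda>h. 0 + h *s u)) (at \<zeta>)"
    by (intro has_derivative_add has_derivative_const bounded_linear_imp_has_derivative bounded_linear_smult_left)
  have eq: "(\<lambda>h. D (0 + h *s u)) = (*) (D u)"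
    by (simp add: fun_eq_iff D(2) mult.commute)
  have "((\<lambda>\<zeta>. f (w + \<zeta> *s u)) has_derivative (*) (D u)) (at \<zeta>)"
    using has_derivative_compose[OF line D(1)] unfolding eq .
  then show "\<exists>f'. ((\<lambda>\<zeta>. f (w + \<zeta> *s u)) has_field_derivative f') (at \<zeta> within UNIV)"
    unfolding has_field_derivative_def by blast
qed

section \<open>Rotation invariance and the mean value property of the Gaussian measure\<close>

abbreviation gdens :: "complex ^ 'n::finite \<Rightarrow> real" where
  "gdens z \<equiv> exp (- (norm z)\<^sup>2) / pi ^ CARD('n)"

lemma nn_integral_gauss:
  fixes f :: "complex ^ 'n::finite \<Rightarrow> ennreal"
  assumes [measurable]: "f \<in> borel_measurable borel"
  shows "(\<integral>\<^sup>+z. f z \<partial>gauss) = (\<integral>\<^sup>+z. ennreal (gdens z) * f z \<partial>lborel)"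
  unfolding gauss_def by (rule nn_integral_density) measurable

lemma integral_gauss:
  fixes f :: "complex ^ 'n::finite \<Rightarrow> complex"
  assumes [measurable]: "f \<in> borel_measurable borel"
  shows "(\<integral>z. f z \<partial>gauss) = (\<integral>z. gdens z *\<^sub>R f z \<partial>lborel)"
  unfolding gauss_def by (rule integral_density) simp_all

lemma prob_space_gauss: "prob_space (gauss :: (complex ^ 'n::finite) measure)"
proof
  have "emeasure (gauss :: (complex ^ 'n) measure) UNIV = (\<integral>\<^sup>+z. 1 \<partial>(gauss :: (complex ^ 'n) measure))"
    by simp
  also have "\<dots> = (\<integral>\<^sup>+z. ennreal (1 / pi ^ CARD('n)) * ennreal (exp (- 1 * (norm (z :: complex ^ 'n))\<^sup>2)) \<partial>lborel)"
    by (subst nn_integral_gauss) (simp_all add: ennreal_mult'[symmetric])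
  also have "\<dots> = ennreal (1 / pi ^ CARD('n)) * ennreal (sqrt (pi / 1) ^ DIM(complex ^ 'n))"
    by (subst nn_integral_cmult) (measurable, subst nn_integral_gaussian, simp_all)
  also have "\<dots> = 1"
    by (simp add: ennreal_mult'[symmetric] mult.commute[of "CARD('n)"] power_mult)
  finally show "emeasure (gauss :: (complex ^ 'n) measure) (space gauss) = 1" by simp
qed

interpretation gauss: prob_space "gauss :: (complex ^ 'n::finite) measure"
  by (rule prob_space_gauss)

text \<open>Multiplication by a unimodular scalar is a real-linear isometry, so it preserves both
  Lebesgue measure and the radial density.\<close>

lemma distr_gauss_rotation:
  assumes c: "norm c = 1"
  shows "distr gauss borel (\<lambda>z. c *s z) = (gauss :: (complex ^ 'n::finite) measure)"
proof -
  have [measurable]: "(\<lambda>z :: complex ^ 'n. c *s z) \<in> borel_measurable borel"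
    by (intro borel_measurable_continuous_onI linear_continuous_on bounded_linear_smult_right)
  have iso: "distr lborel borel (\<lambda>z :: complex ^ 'n. c *s z) = lborel"
    using bounded_linear_smult_right c
    by (intro lborel_distr_isometry) (auto simp: norm_smult linear_conv_bounded_linear)
  have "distr gauss borel (\<lambda>z :: complex ^ 'n. c *s z)
     = distr (density lborel (\<lambda>z. ennreal (gdens (c *s z)))) borel (\<lambda>z. c *s z)"
    by (simp add: gauss_def norm_smult c)
  also have "\<dots> = density (distr lborel borel (\<lambda>z. c *s z)) (\<lambda>z. ennreal (gdens z))"
    by (subst density_distr) simp_all
  finally show ?thesis unfolding iso by (simp add: gauss_def)
qed

text \<open>Averaging over the rotations \<zeta> z with |\<zeta>| = 1 does not change the integral;
  after exchanging the integrals, the inner one is a mean over a circle in a complex line and equals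
  \<open>f 0\<close>. Absolute integrability on the product follows from that of \<open>f\<close>,
  again by rotation invariance.\<close>

lemma mean_value_gauss:
  fixes f :: "complex ^ 'n::finite \<Rightarrow> complex"
  assumes f: "entire f" and i: "integrable gauss f"
  shows "(\<integral>z. f z \<partial>gauss) = f 0"
proof -
  note [measurable] = entire_measurable[OF f]
  have cont: "continuous_on UNIV (\<lambda>p::complex \<times> (complex ^ 'n). fst p *s snd p)"
    unfolding vector_scalar_mult_def by (intro continuous_intros)
  have [measurable]: "(\<lambda>p::complex \<times> (complex ^ 'n). fst p *s snd p) \<in> borel_measurable (borel \<Otimes>\<^sub>M borel)"
    unfolding borel_prod by (rule borel_measurable_continuous_onI[OF cont])
  have [measurable]: "(\<lambda>z :: complex ^ 'n. c *s z) \<in> borel_measurable borel" for c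
    by (intro borel_measurable_continuous_onI linear_continuous_on bounded_linear_smult_right)
  have meas [measurable]: "(\<lambda>p. f (fst p *s snd p)) \<in> borel_measurable (circ \<Otimes>\<^sub>M gauss)"
    by (rule measurable_compose[OF _ entire_measurable[OF f]]) simp
  interpret P: pair_sigma_finite circ "gauss :: (complex ^ 'n) measure" ..
  have rot: "(\<integral>\<^sup>+z. ennreal (norm (f (\<zeta> *s z))) \<partial>gauss) = (\<integral>\<^sup>+z. ennreal (norm (f z)) \<partial>gauss)"
    "(\<integral>z. f (\<zeta> *s z) \<partial>gauss) = (\<integral>z. f z \<partial>gauss)" if "norm \<zeta> = 1" for \<zeta>
    using that
    by (subst (2) distr_gauss_rotation[symmetric, of \<zeta>], simp, subst nn_integral_distr, simp_all)
      (subst (2) distr_gauss_rotation[symmetric, of \<zeta>], simp, subst integral_distr, simp_all)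
  have int: "integrable (circ \<Otimes>\<^sub>M gauss) (\<lambda>(\<zeta>, z). f (\<zeta> *s z))"
  proof (rule integrableI_bounded)
    show "(\<lambda>(\<zeta>, z). f (\<zeta> *s z)) \<in> borel_measurable (circ \<Otimes>\<^sub>M gauss)"
      using meas by (simp add: case_prod_beta')
    have "(\<integral>\<^sup>+p. ennreal (norm (case p of (\<zeta>, z) \<Rightarrow> f (\<zeta> *s z))) \<partial>(circ \<Otimes>\<^sub>M gauss))
      = (\<integral>\<^sup>+\<zeta>. (\<integral>\<^sup>+z. ennreal (norm (f (\<zeta> *s z))) \<partial>gauss) \<partial>circ)"
      by (subst gauss.nn_integral_fst[symmetric]) (use meas in \<open>simp_all add: case_prod_beta'\<close>)
    also have "\<dots> = (\<integral>\<^sup>+\<zeta>. (\<integral>\<^sup>+z. ennreal (norm (f z)) \<partial>gauss) \<partial>circ)"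
      using AE_circ by (intro nn_integral_cong_AE, eventually_elim) (simp add: rot)
    also have "\<dots> < \<infinity>"
      using i circ.emeasure_space_1 by (simp add: integrable_iff_bounded)
    finally show "(\<integral>\<^sup>+p. ennreal (norm (case p of (\<zeta>, z) \<Rightarrow> f (\<zeta> *s z))) \<partial>(circ \<Otimes>\<^sub>M gauss)) < \<infinity>" .
  qed
  have "(\<integral>z. f z \<partial>gauss) = (\<integral>\<zeta>. (\<integral>z. f z \<partial>gauss) \<partial>circ)"
    using circ.prob_space by simp
  also have "\<dots> = (\<integral>\<zeta>. (\<integral>z. f (\<zeta> *s z) \<partial>gauss) \<partial>circ)"
    using AE_circ by (intro integral_cong_AE) (auto simp: rot elim!: eventually_mono)
  also have "\<dots> = (\<integral>z. (\<integral>\<zeta>. f (\<zeta> *s z) \<partial>circ) \<partial>gauss)"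
    by (rule P.Fubini_integral[OF int, symmetric])
  also have "\<dots> = (\<integral>(z::complex^'n). f 0 \<partial>gauss)"
  proof (intro Bochner_Integration.integral_cong refl)
    fix z
    show "(\<integral>\<zeta>. f (\<zeta> *s z) \<partial>circ) = f 0"
      using mean_value_circ[OF entire_on_line[OF f, of 0 z]] by simp
  qed
  also have "\<dots> = f 0" by (simp add: gauss.prob_space[simplified])
  finally show ?thesis .
qed

section \<open>The reproducing kernel\<close>

definition kern :: "complex ^ 'n::finite \<Rightarrow> complex ^ 'n \<Rightarrow> complex" where
  "kern w z = exp (hip z w)"

lemma norm_exp_hip: "norm (exp (hip z w)) = exp (z \<bullet> w)"
  by (simp add: norm_exp_eq_Re Re_hip)

lemma sq_integrable_borel: "sq_integrable f \<Longrightarrow> f \<in> borel_measurable borel"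
  using sq_integrable_measurable[of f] by (simp cong: measurable_cong_sets)

lemma kern_measurable [measurable]: "kern w \<in> borel_measurable borel"
  unfolding kern_def by measurable

lemma norm_add_squared_hip:
  "complex_of_real ((norm (z + w))\<^sup>2) = of_real ((norm z)\<^sup>2) + hip z w + hip w z + of_real ((norm w)\<^sup>2)"
  unfolding hip_self[symmetric] by (simp add: hip_add_left hip_add_right)

text \<open>Completing the square: half of the Gaussian exponent absorbs the linear growth, the
  other half is left for integrability.\<close>

lemma exp_norm_gauss_bound:
  fixes c x :: real
  shows "exp (c * x) ^ 2 * exp (- x\<^sup>2) \<le> exp (2 * c\<^sup>2) * exp (- (1 / 2) * x\<^sup>2)"
proof -
  have "0 \<le> (x / 2 - c)\<^sup>2 * 2" by simp
  also have "\<dots> = 2 * c\<^sup>2 - (1 / 2) * x\<^sup>2 - (2 * (c * x) - x\<^sup>2)"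
    by (simp add: power2_eq_square algebra_simps)
  finally have "exp (2 * (c * x) - x\<^sup>2) \<le> exp (2 * c\<^sup>2 - (1 / 2) * x\<^sup>2)" by simp
  then show ?thesis
    unfolding exp_double[symmetric] exp_add[symmetric] by simp
qed

text \<open>A single criterion that covers the kernels, their truncations and the majorants used for
  differentiating under the integral.\<close>

lemma sq_integrable_exp_growth:
  fixes f :: "complex ^ 'n::finite \<Rightarrow> complex"
  assumes [measurable]: "f \<in> borel_measurable borel"
    and b: "\<And>z. norm (f z) \<le> exp (c * norm z)"
  shows "sq_integrable f"
proof -
  have "(\<integral>\<^sup>+z. ennreal (norm ((norm (f z))\<^sup>2)) \<partial>gauss)
      \<le> (\<integral>\<^sup>+z. ennreal (exp (2 * c\<^sup>2)) * ennreal (exp (- (1 / 2) * (norm (z::complex^'n))\<^sup>2)) \<partial>lborel)"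
  proof (subst nn_integral_gauss, simp, rule nn_integral_mono)
    fix z :: "complex ^ 'n"
    have p: "1 \<le> pi ^ CARD('n)" using pi_ge_two by (intro one_le_power) simp
    have "gdens z * (norm (f z))\<^sup>2 \<le> exp (- (norm z)\<^sup>2) * (norm (f z))\<^sup>2"
      using p by (intro mult_right_mono) (auto simp: divide_le_eq mult_le_cancel_left1)
    also have "\<dots> \<le> exp (- (norm z)\<^sup>2) * (exp (c * norm z))\<^sup>2"
      by (intro mult_left_mono power_mono b) auto
    also have "\<dots> \<le> exp (2 * c\<^sup>2) * exp (- (1 / 2) * (norm z)\<^sup>2)"
      using exp_norm_gauss_bound[of c "norm z"] by (simp only: mult.commute)
    finally show "ennreal (gdens z) * ennreal (norm ((norm (f z))\<^sup>2))
        \<le> ennreal (exp (2 * c\<^sup>2)) * ennreal (exp (- (1 / 2) * (norm z)\<^sup>2))"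
      by (simp add: ennreal_mult'[symmetric] ennreal_leI)
  qed
  also have "\<dots> < \<infinity>"
    by (subst nn_integral_cmult) (measurable, subst nn_integral_gaussian, simp_all add: ennreal_mult'[symmetric])
  finally show ?thesis
    by (simp add: sq_integrable_def integrable_iff_bounded)
qed

lemma norm_kern_le: "norm (kern w z) \<le> exp (norm w * norm z)"
  using norm_cauchy_schwarz[of z w] by (simp add: kern_def Re_hip mult.commute)

lemma cnj_kern: "cnj (kern w z) = exp (hip w z)"
  by (simp add: kern_def exp_cnj cnj_hip)

lemma sq_integrable_kern: "sq_integrable (kern w)"
  by (rule sq_integrable_exp_growth[OF _ norm_kern_le]) simp

lemma entire_kern: "entire (kern w)"
  using entire_exp_hip[of 1 w] by (simp add: kern_def[abs_def])

text \<open>Shifting the variable by \<open>w\<close> cancels the mixed terms of the Gaussian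
  against the kernel up to exp(-<z,w>). What is left is the Gaussian mean of the entire function
  \<open>h\<close>, whose value at 0 is \<open>f w\<close>.\<close>

lemma reproducing:
  fixes f :: "complex ^ 'n::finite \<Rightarrow> complex"
  assumes f: "entire f" and sq: "sq_integrable f"
  shows "(\<integral>z. f z * cnj (kern w z) \<partial>gauss) = f w"
proof -
  note [measurable] = entire_measurable[OF f]
  define h where "h z = f (z + w) * exp (-1 * hip z w)" for z
  have h: "entire h" unfolding h_def by (intro entire_mult entire_shift entire_exp_hip f)
  note [measurable] = entire_measurable[OF h]
  have eq: "gdens (z + w) *\<^sub>R (f (z + w) * cnj (kern w (z + w))) = gdens z *\<^sub>R h z" for z
  proof -
    have "complex_of_real (exp (- (norm (z + w))\<^sup>2)) * exp (hip w (z + w))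
        = exp (- complex_of_real ((norm (z + w))\<^sup>2) + hip w (z + w))"
      by (simp only: exp_add exp_of_real of_real_minus[symmetric])
    also have "- complex_of_real ((norm (z + w))\<^sup>2) + hip w (z + w) = - of_real ((norm z)\<^sup>2) - hip z w"
      unfolding norm_add_squared_hip hip_add_right hip_self by simp
    also have "exp \<dots> = complex_of_real (exp (- (norm z)\<^sup>2)) * exp (-1 * hip z w)"
      by (simp only: exp_add exp_of_real of_real_minus[symmetric] diff_conv_add_uminus mult_minus_left mult_1)
    finally show ?thesis
      by (simp add: h_def cnj_kern scaleR_conv_of_real divide_inverse mult_ac)
  qed
  have i: "integrable lborel (\<lambda>z. gdens z *\<^sub>R (f z * cnj (kern w z)))"
    using integrable_mult_cnj[OF sq sq_integrable_kern[of w]]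
    unfolding gauss_def by (subst (asm) integrable_density) auto
  have "integrable lborel (\<lambda>z. gdens z *\<^sub>R h z)"
    using integrable_lborel_shift[OF i, of w] unfolding eq .
  then have ih: "integrable gauss h"
    unfolding gauss_def by (subst integrable_density) auto
  have "(\<integral>z. f z * cnj (kern w z) \<partial>gauss) = (\<integral>z. gdens z *\<^sub>R (f z * cnj (kern w z)) \<partial>lborel)"
    by (rule integral_gauss) measurable
  also have "\<dots> = (\<integral>z. gdens (z + w) *\<^sub>R (f (z + w) * cnj (kern w (z + w))) \<partial>lborel)"
    by (rule integral_lborel_shift[symmetric]) measurable
  also have "\<dots> = (\<integral>z. gdens z *\<^sub>R h z \<partial>lborel)" unfolding eq ..
  also have "\<dots> = (\<integral>z. h z \<partial>gauss)" by (rule integral_gauss[symmetric]) measurable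
  also have "\<dots> = h 0" by (rule mean_value_gauss[OF h ih])
  finally show ?thesis by (simp add: h_def)
qed

section \<open>Truncated kernel operators\<close>

text \<open>Convolution with k is bounded on L^2 by the integral of k: Cauchy-Schwarz with k split
  into two square roots, then Tonelli. Integrals in \<open>ennreal\<close> allow both without prior
  integrability.\<close>

lemma young_L2:
  fixes F k :: "'a::euclidean_space \<Rightarrow> real"
  assumes [measurable]: "F \<in> borel_measurable borel" "k \<in> borel_measurable borel"
    and F: "\<And>x. 0 \<le> F x" and k: "\<And>x. 0 \<le> k x"
  shows "(\<integral>\<^sup>+z. (\<integral>\<^sup>+w. ennreal (F w * k (z - w)) \<partial>lborel)\<^sup>2 \<partial>lborel)
    \<le> (\<integral>\<^sup>+x. ennreal (k x) \<partial>lborel)\<^sup>2 * (\<integral>\<^sup>+w. ennreal ((F w)\<^sup>2) \<partial>lborel)"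
proof -
  define K where "K = (\<integral>\<^sup>+x. ennreal (k x) \<partial>lborel)"
  have inner: "(\<integral>\<^sup>+w. ennreal (F w * k (z - w)) \<partial>lborel)\<^sup>2
      \<le> K * (\<integral>\<^sup>+w. ennreal ((F w)\<^sup>2) * ennreal (k (z - w)) \<partial>lborel)" for z
  proof -
    have "(\<integral>\<^sup>+w. ennreal (F w * k (z - w)) \<partial>lborel)
        = (\<integral>\<^sup>+w. ennreal (sqrt (k (z - w))) * ennreal (F w * sqrt (k (z - w))) \<partial>lborel)"
      by (intro nn_integral_cong) (simp add: ennreal_mult'[symmetric] F k mult.left_commute)
    also have "\<dots>\<^sup>2 \<le> (\<integral>\<^sup>+w. (ennreal (sqrt (k (z - w))))\<^sup>2 \<partial>lborel)
        * (\<integral>\<^sup>+w. (ennreal (F w * sqrt (k (z - w))))\<^sup>2 \<partial>lborel)"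
      by (rule Cauchy_Schwarz_nn_integral) measurable
    also have "(\<integral>\<^sup>+w. (ennreal (sqrt (k (z - w))))\<^sup>2 \<partial>lborel) = (\<integral>\<^sup>+w. ennreal (k (z - w)) \<partial>lborel)"
      by (simp add: ennreal_power F k)
    also have "\<dots> = K"
      unfolding K_def by (rule nn_integral_lborel_reflect[of "\<lambda>x. ennreal (k x)"]) measurable
    also have "(\<integral>\<^sup>+w. (ennreal (F w * sqrt (k (z - w))))\<^sup>2 \<partial>lborel)
        = (\<integral>\<^sup>+w. ennreal ((F w)\<^sup>2) * ennreal (k (z - w)) \<partial>lborel)"
      by (simp add: ennreal_power ennreal_mult'[symmetric] F k power_mult_distrib)
    finally show ?thesis .
  qed
  have "(\<integral>\<^sup>+z. (\<integral>\<^sup>+w. ennreal (F w * k (z - w)) \<partial>lborel)\<^sup>2 \<partial>lborel)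
      \<le> (\<integral>\<^sup>+z. K * (\<integral>\<^sup>+w. ennreal ((F w)\<^sup>2) * ennreal (k (z - w)) \<partial>lborel) \<partial>lborel)"
    by (intro nn_integral_mono inner)
  also have "\<dots> = K * (\<integral>\<^sup>+z. (\<integral>\<^sup>+w. ennreal ((F w)\<^sup>2) * ennreal (k (z - w)) \<partial>lborel) \<partial>lborel)"
    by (rule nn_integral_cmult) measurable
  finally have 1: "(\<integral>\<^sup>+z. (\<integral>\<^sup>+w. ennreal (F w * k (z - w)) \<partial>lborel)\<^sup>2 \<partial>lborel)
      \<le> K * (\<integral>\<^sup>+z. (\<integral>\<^sup>+w. ennreal ((F w)\<^sup>2) * ennreal (k (z - w)) \<partial>lborel) \<partial>lborel)" .
  have "(\<integral>\<^sup>+z. (\<integral>\<^sup>+w. ennreal ((F w)\<^sup>2) * ennreal (k (z - w)) \<partial>lborel) \<partial>lborel)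
      = (\<integral>\<^sup>+w. (\<integral>\<^sup>+z. ennreal ((F w)\<^sup>2) * ennreal (k (z - w)) \<partial>lborel) \<partial>lborel)"
    by (rule lborel_pair.Fubini') measurable
  also have "\<dots> = (\<integral>\<^sup>+w. ennreal ((F w)\<^sup>2) * K \<partial>lborel)"
  proof (rule nn_integral_cong)
    fix w :: 'a
    have "(\<integral>\<^sup>+z. ennreal (k (z - w)) \<partial>lborel) = K"
      using nn_integral_lborel_shift[of "\<lambda>x. ennreal (k x)" "- w"] by (simp add: K_def)
    then show "(\<integral>\<^sup>+z. ennreal ((F w)\<^sup>2) * ennreal (k (z - w)) \<partial>lborel) = ennreal ((F w)\<^sup>2) * K"
      by (subst nn_integral_cmult) simp_all
  qed
  also have "\<dots> = (\<integral>\<^sup>+w. ennreal ((F w)\<^sup>2) \<partial>lborel) * K"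
    by (rule nn_integral_multc) measurable
  finally have 2: "(\<integral>\<^sup>+z. (\<integral>\<^sup>+w. ennreal ((F w)\<^sup>2) * ennreal (k (z - w)) \<partial>lborel) \<partial>lborel)
      = (\<integral>\<^sup>+w. ennreal ((F w)\<^sup>2) \<partial>lborel) * K" .
  have 3: "K * (I * K) = K\<^sup>2 * I" for I
    by (simp only: power2_eq_square ac_simps)
  show ?thesis using 1 unfolding 2 3 K_def[symmetric] .
qed

text \<open>The Schur bound for the reproducing kernel restricted to \<open>z - w \<in> S\<close>.\<close>

definition mass :: "(complex ^ 'n::finite) set \<Rightarrow> real" where
  "mass S = (\<integral>x. indicator S x * exp (- (1 / 2) * (norm x)\<^sup>2) / pi ^ CARD('n) \<partial>lborel)"

lemma mass_nonneg: "0 \<le> mass S"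
  unfolding mass_def by (rule Bochner_Integration.integral_nonneg) simp

lemma integrable_mass:
  assumes [measurable]: "S \<in> sets borel"
  shows "integrable lborel (\<lambda>x::complex ^ 'n::finite. indicator S x * exp (- (1 / 2) * (norm x)\<^sup>2) / pi ^ CARD('n))"
proof (rule Bochner_Integration.integrable_bound)
  show "integrable lborel (\<lambda>x::complex ^ 'n. exp (- (1 / 2) * (norm x)\<^sup>2) / pi ^ CARD('n))"
    by (intro integrable_divide integrable_gaussian) simp
qed (auto simp: indicator_def)

lemma nn_integral_mass:
  fixes S :: "(complex ^ 'n::finite) set"
  assumes "S \<in> sets borel"
  shows "(\<integral>\<^sup>+x. ennreal (indicator S x * exp (- (1 / 2) * (norm x)\<^sup>2) / pi ^ CARD('n)) \<partial>lborel) = ennreal (mass S)"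
  unfolding mass_def by (intro nn_integral_eq_integral integrable_mass assms) simp

text \<open>With the Gaussian weight at w and the square root of the weight at z, the modulus of the
  reproducing kernel becomes a function of z - w, up to the square root of the weight at w.\<close>

lemma inner_le_half_squares:
  "exp (z \<bullet> w) * exp (- (norm w)\<^sup>2) * exp (- (norm z)\<^sup>2 / 2)
    = exp (- (norm w)\<^sup>2 / 2) * exp (- (1 / 2) * (norm (z - w))\<^sup>2)"
proof -
  have "(norm (z - w))\<^sup>2 = (norm z)\<^sup>2 + (norm w)\<^sup>2 - 2 * (z \<bullet> w)"
    by (simp add: power2_norm_eq_inner inner_diff_left inner_diff_right inner_commute)
  then have "z \<bullet> w + - (norm w)\<^sup>2 + - (norm z)\<^sup>2 / 2 = - (norm w)\<^sup>2 / 2 + - (1 / 2) * (norm (z - w))\<^sup>2"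
    by (simp add: field_simps)
  then show ?thesis unfolding exp_add[symmetric] by (rule arg_cong)
qed

text \<open>Transport to Lebesgue measure: \<open>F\<close> is |f| with the square root of the
  Gaussian weight, the kernel becomes convolution with \<open>k\<close>, and the integral of
  \<open>k\<close> is \<open>mass S\<close>.\<close>

lemma schur_gauss:
  fixes f :: "complex ^ 'n::finite \<Rightarrow> complex"
  assumes [measurable]: "f \<in> borel_measurable borel" "S \<in> sets borel"
  shows "(\<integral>\<^sup>+z. (\<integral>\<^sup>+w. ennreal (norm (f w) * (indicator S (z - w) * exp (z \<bullet> w))) \<partial>gauss)\<^sup>2 \<partial>gauss)
    \<le> (ennreal (mass S))\<^sup>2 * (\<integral>\<^sup>+w. ennreal ((norm (f w))\<^sup>2) \<partial>gauss)"
proof -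
  define p where "p = pi ^ CARD('n)"
  have p: "p > 0" by (simp add: p_def)
  define F where "F w = norm (f w) * exp (- (norm w)\<^sup>2 / 2)" for w
  define k where "k x = indicator S x * exp (- (1 / 2) * (norm x)\<^sup>2) / p" for x :: "complex ^ 'n"
  have [measurable]: "F \<in> borel_measurable borel" "k \<in> borel_measurable borel"
    unfolding F_def k_def by measurable
  have nn: "0 \<le> F x" "0 \<le> k x" for x using p by (simp_all add: F_def k_def)
  have 1: "ennreal (exp (- (norm z)\<^sup>2 / 2)) * (\<integral>\<^sup>+w. ennreal (norm (f w) * (indicator S (z - w) * exp (z \<bullet> w))) \<partial>gauss)
      = (\<integral>\<^sup>+w. ennreal (F w * k (z - w)) \<partial>lborel)" for z
  proof -
    have "ennreal (exp (- (norm z)\<^sup>2 / 2)) * (\<integral>\<^sup>+w. ennreal (norm (f w) * (indicator S (z - w) * exp (z \<bullet> w))) \<partial>gauss)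
      = (\<integral>\<^sup>+w. ennreal (exp (- (norm z)\<^sup>2 / 2)) *
          (ennreal (gdens w) * ennreal (norm (f w) * (indicator S (z - w) * exp (z \<bullet> w)))) \<partial>lborel)"
      by (subst nn_integral_gauss, measurable, rule nn_integral_cmult[symmetric], measurable)
    also have "\<dots> = (\<integral>\<^sup>+w. ennreal (F w * k (z - w)) \<partial>lborel)"
    proof (rule nn_integral_cong)
      fix w
      have "exp (- (norm z)\<^sup>2 / 2) * (gdens w * (norm (f w) * (indicator S (z - w) * exp (z \<bullet> w))))
          = norm (f w) * indicator S (z - w) / p * (exp (z \<bullet> w) * exp (- (norm w)\<^sup>2) * exp (- (norm z)\<^sup>2 / 2))"
        by (simp add: p_def)
      also have "\<dots> = F w * k (z - w)"
        unfolding inner_le_half_squares by (simp add: F_def k_def)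
      finally show "ennreal (exp (- (norm z)\<^sup>2 / 2)) *
          (ennreal (gdens w) * ennreal (norm (f w) * (indicator S (z - w) * exp (z \<bullet> w)))) = ennreal (F w * k (z - w))"
        by (simp only: ennreal_mult'[symmetric] exp_ge_zero divide_nonneg_nonneg zero_le_power pi_ge_zero)
    qed
    finally show ?thesis .
  qed
  have "(\<integral>\<^sup>+z. (\<integral>\<^sup>+w. ennreal (norm (f w) * (indicator S (z - w) * exp (z \<bullet> w))) \<partial>gauss)\<^sup>2 \<partial>gauss)
     = (\<integral>\<^sup>+z. ennreal (1 / p) * (\<integral>\<^sup>+w. ennreal (F w * k (z - w)) \<partial>lborel)\<^sup>2 \<partial>lborel)"
  proof (subst nn_integral_gauss, measurable, rule nn_integral_cong)
    fix z :: "complex ^ 'n"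
    have "gdens z = 1 / p * (exp (- (norm z)\<^sup>2 / 2))\<^sup>2"
      by (simp add: p_def exp_double[symmetric])
    then have e: "ennreal (gdens z) = ennreal (1 / p) * (ennreal (exp (- (norm z)\<^sup>2 / 2)))\<^sup>2"
      using p by (simp only: ennreal_mult'[symmetric] ennreal_power exp_ge_zero divide_nonneg_nonneg zero_le_one less_imp_le)
    show "ennreal (gdens z) * (\<integral>\<^sup>+w. ennreal (norm (f w) * (indicator S (z - w) * exp (z \<bullet> w))) \<partial>gauss)\<^sup>2
      = ennreal (1 / p) * (\<integral>\<^sup>+w. ennreal (F w * k (z - w)) \<partial>lborel)\<^sup>2"
      unfolding 1[symmetric] e power_mult_distrib mult.assoc ..
  qed
  also have "\<dots> = ennreal (1 / p) * (\<integral>\<^sup>+z. (\<integral>\<^sup>+w. ennreal (F w * k (z - w)) \<partial>lborel)\<^sup>2 \<partial>lborel)"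
    by (rule nn_integral_cmult) measurable
  finally have 2: "(\<integral>\<^sup>+z. (\<integral>\<^sup>+w. ennreal (norm (f w) * (indicator S (z - w) * exp (z \<bullet> w))) \<partial>gauss)\<^sup>2 \<partial>gauss)
      = ennreal (1 / p) * (\<integral>\<^sup>+z. (\<integral>\<^sup>+w. ennreal (F w * k (z - w)) \<partial>lborel)\<^sup>2 \<partial>lborel)" .
  have 3: "(\<integral>\<^sup>+x. ennreal (k x) \<partial>lborel) = ennreal (mass S)"
    unfolding k_def p_def by (rule nn_integral_mass) measurable
  have 4: "ennreal (1 / p) * (\<integral>\<^sup>+w. ennreal ((F w)\<^sup>2) \<partial>lborel) = (\<integral>\<^sup>+w. ennreal ((norm (f w))\<^sup>2) \<partial>gauss)"
  proof (subst nn_integral_gauss, measurable, subst nn_integral_cmult[symmetric], measurable, rule nn_integral_cong)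
    fix w
    have "1 / p * (F w)\<^sup>2 = gdens w * (norm (f w))\<^sup>2"
      by (simp add: F_def p_def power_mult_distrib exp_double[symmetric])
    then show "ennreal (1 / p) * ennreal ((F w)\<^sup>2) = ennreal (gdens w) * ennreal ((norm (f w))\<^sup>2)"
      using p by (simp add: ennreal_mult'[symmetric])
  qed
  have "ennreal (1 / p) * (\<integral>\<^sup>+z. (\<integral>\<^sup>+w. ennreal (F w * k (z - w)) \<partial>lborel)\<^sup>2 \<partial>lborel)
      \<le> ennreal (1 / p) * ((ennreal (mass S))\<^sup>2 * (\<integral>\<^sup>+w. ennreal ((F w)\<^sup>2) \<partial>lborel))"
    unfolding 3[symmetric] by (intro mult_left_mono young_L2 nn) auto
  then show ?thesis unfolding 2 4[symmetric] mult.left_commute[of "ennreal (1 / p)"] .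
qed

text \<open>The integral operator of the reproducing kernel restricted to displacements z - w in
  \<open>S\<close>. The whole space gives the projection, a ball a band operator, and the complement
  of a ball the error between them.\<close>

definition opk :: "(complex ^ 'n::finite) set \<Rightarrow> (complex ^ 'n \<Rightarrow> complex) \<Rightarrow> complex ^ 'n \<Rightarrow> complex" where
  "opk S f z = (\<integral>w. f w * (indicator S (z - w) * exp (hip z w)) \<partial>gauss)"

lemma opk_integrable:
  assumes f: "sq_integrable f" and [measurable]: "S \<in> sets borel"
  shows "integrable gauss (\<lambda>w. f w * (indicator S (z - w) * exp (hip z w)))"
proof -
  have "sq_integrable (\<lambda>w. cnj (indicator S (z - w) * exp (hip z w)))"
  proof (rule sq_integrable_exp_growth[where c = "norm z"])
    show "norm (cnj (indicator S (z - w) * exp (hip z w))) \<le> exp (norm z * norm w)" for w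
      unfolding complex_mod_cnj norm_mult norm_exp_hip using norm_cauchy_schwarz[of z w]
      by (auto simp: indicator_def)
  qed measurable
  from integrable_mult_cnj[OF f this] show ?thesis by simp
qed

lemma opk_measurable [measurable]:
  assumes [measurable]: "f \<in> borel_measurable borel" "S \<in> sets borel"
  shows "opk S f \<in> borel_measurable borel"
proof -
  have "(\<lambda>z. \<integral>w. f w * (indicator S (z - w) * exp (hip z w)) \<partial>gauss) \<in> borel_measurable borel"
    by (rule gauss.borel_measurable_lebesgue_integral) measurable
  then show ?thesis by (simp add: opk_def[abs_def])
qed

lemma opk_sq:
  assumes f: "sq_integrable f" and S [measurable]: "S \<in> sets borel"
  shows "sq_integrable (opk S f)"
    "(\<integral>z. (norm (opk S f z))\<^sup>2 \<partial>gauss) \<le> (mass S)\<^sup>2 * (\<integral>z. (norm (f z))\<^sup>2 \<partial>gauss)"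
proof -
  note [measurable] = sq_integrable_borel[OF f]
  have fi: "integrable gauss (\<lambda>z. (norm (f z))\<^sup>2)" using f by (simp add: sq_integrable_def)
  have "(\<integral>\<^sup>+z. ennreal ((norm (opk S f z))\<^sup>2) \<partial>gauss)
     \<le> (\<integral>\<^sup>+z. (\<integral>\<^sup>+w. ennreal (norm (f w) * (indicator S (z - w) * exp (z \<bullet> w))) \<partial>gauss)\<^sup>2 \<partial>gauss)"
  proof (rule nn_integral_mono)
    fix z
    have "ennreal (norm (opk S f z)) \<le> (\<integral>\<^sup>+w. ennreal (norm (f w * (indicator S (z - w) * exp (hip z w)))) \<partial>gauss)"
      unfolding opk_def by (rule integral_norm_bound_ennreal[OF opk_integrable[OF f S]])
    also have "\<dots> = (\<integral>\<^sup>+w. ennreal (norm (f w) * (indicator S (z - w) * exp (z \<bullet> w))) \<partial>gauss)"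
      by (intro nn_integral_cong) (simp add: norm_mult Re_hip indicator_def)
    finally show "ennreal ((norm (opk S f z))\<^sup>2) \<le> (\<integral>\<^sup>+w. ennreal (norm (f w) * (indicator S (z - w) * exp (z \<bullet> w))) \<partial>gauss)\<^sup>2"
      by (simp add: ennreal_power[symmetric] power_mono)
  qed
  also have "\<dots> \<le> (ennreal (mass S))\<^sup>2 * (\<integral>\<^sup>+w. ennreal ((norm (f w))\<^sup>2) \<partial>gauss)"
    by (rule schur_gauss) measurable
  also have "\<dots> = ennreal ((mass S)\<^sup>2 * (\<integral>z. (norm (f z))\<^sup>2 \<partial>gauss))"
    by (simp add: nn_integral_eq_integral[OF fi] ennreal_power mass_nonneg ennreal_mult')
  finally have *: "(\<integral>\<^sup>+z. ennreal ((norm (opk S f z))\<^sup>2) \<partial>gauss) \<le> ennreal ((mass S)\<^sup>2 * (\<integral>z. (norm (f z))\<^sup>2 \<partial>gauss))" .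
  then have i: "integrable gauss (\<lambda>z. (norm (opk S f z))\<^sup>2)"
    by (intro integrableI_bounded) (auto simp: less_top[symmetric] top_unique)
  then show "sq_integrable (opk S f)" by (simp add: sq_integrable_def)
  have "ennreal (\<integral>z. (norm (opk S f z))\<^sup>2 \<partial>gauss) = (\<integral>\<^sup>+z. ennreal ((norm (opk S f z))\<^sup>2) \<partial>gauss)"
    by (rule nn_integral_eq_integral[OF i, symmetric]) simp
  with * have "ennreal (\<integral>z. (norm (opk S f z))\<^sup>2 \<partial>gauss) \<le> ennreal ((mass S)\<^sup>2 * (\<integral>z. (norm (f z))\<^sup>2 \<partial>gauss))"
    by simp
  then show "(\<integral>z. (norm (opk S f z))\<^sup>2 \<partial>gauss) \<le> (mass S)\<^sup>2 * (\<integral>z. (norm (f z))\<^sup>2 \<partial>gauss)"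
    by (rule iffD1[OF ennreal_le_iff, rotated]) simp
qed

lemma norm_exp_remainder: "norm (exp t - 1 - t) \<le> exp (norm t) * (norm t)\<^sup>2" for t :: complex
  using Taylor_exp_field[of t 1] by (simp add: atMost_nat_numeral diff_diff_eq numeral_2_eq_2)

text \<open>Differentiation under the integral sign: the second-order remainder of exp is dominated
  by |h|^2 times an integrable function, and the candidate derivative is complex-linear because
  \<open>hip\<close> is in its first argument.\<close>

lemma entire_opk_UNIV:
  fixes f :: "complex ^ 'n::finite \<Rightarrow> complex"
  assumes f: "sq_integrable f"
  shows "entire (opk UNIV f)"
  unfolding entire_def
proof
  fix z :: "complex ^ 'n"
  note [measurable] = sq_integrable_borel[OF f]
  define D where "D h = (\<integral>w. f w * (hip h w * exp (hip z w)) \<partial>gauss)" for h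
  \<comment> \<open>Majorant for |h| \<le> 1: the kernel at z contributes exp(|z||w|), the remainder
    of exp contributes |w|^2 exp(|w|).\<close>
  define G where "G w = norm (f w) * ((norm w)\<^sup>2 * exp ((norm z + 1) * norm w))" for w
  define B where "B = (\<integral>w. G w \<partial>gauss)"
  have le_exp: "x \<le> exp x" for x :: real using exp_ge_add_one_self[of x] by linarith
  have i1: "integrable gauss (\<lambda>w. f w * exp (hip y w))" for y
    using opk_integrable[OF f, of UNIV y] by simp
  have norm_e: "norm (exp (hip y w)) \<le> exp (norm y * norm w)" for y w :: "complex ^ 'n"
    unfolding norm_exp_hip using norm_cauchy_schwarz[of y w] by simp
  have i2: "integrable gauss (\<lambda>w. f w * (hip h w * exp (hip z w)))" for h
  proof -
    have "sq_integrable (\<lambda>w. cnj (hip h w * exp (hip z w)))"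
    proof (rule sq_integrable_exp_growth[where c = "norm h + norm z"])
      fix w :: "complex ^ 'n"
      have "norm (hip h w * exp (hip z w)) \<le> (norm h * norm w) * exp (norm z * norm w)"
        unfolding norm_mult by (intro mult_mono norm_hip_le norm_e) auto
      also have "\<dots> \<le> exp (norm h * norm w) * exp (norm z * norm w)"
        by (intro mult_right_mono le_exp) auto
      finally show "norm (cnj (hip h w * exp (hip z w))) \<le> exp ((norm h + norm z) * norm w)"
        by (simp only: complex_mod_cnj distrib_right exp_add)
    qed measurable
    from integrable_mult_cnj[OF f this] show ?thesis by simp
  qed
  have iG: "integrable gauss G"
  proof -
    have "sq_integrable (\<lambda>w::complex^'n. complex_of_real ((norm w)\<^sup>2 * exp ((norm z + 1) * norm w)))"
    \<comment> \<open>The polynomial factor is absorbed by |w|^2 \<le> exp(2|w|), which raises the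
      rate |z| + 1 by 2.\<close>
    proof (rule sq_integrable_exp_growth[where c = "norm z + 3"])
      fix w :: "complex ^ 'n"
      have "(norm w)\<^sup>2 * exp ((norm z + 1) * norm w) \<le> (exp (norm w))\<^sup>2 * exp ((norm z + 1) * norm w)"
        by (intro mult_right_mono power_mono le_exp) auto
      also have "\<dots> = exp ((norm z + 3) * norm w)"
        unfolding exp_double[symmetric] exp_add[symmetric] by (rule arg_cong[of _ _ exp]) (simp add: algebra_simps)
      finally show "norm (complex_of_real ((norm w)\<^sup>2 * exp ((norm z + 1) * norm w))) \<le> exp ((norm z + 3) * norm w)"
        by (simp only: norm_of_real abs_mult abs_exp_cancel abs_power2)
    qed measurable
    from integrable_norm[OF integrable_mult_cnj[OF f this]]
    show ?thesis by (simp add: G_def[abs_def] norm_mult norm_power)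
  qed
  have B: "B \<ge> 0" unfolding B_def G_def by (rule Bochner_Integration.integral_nonneg) simp
  have smult: "D (c *s v) = c * D v" for c v
    unfolding D_def hip_smult_left by (subst integral_mult_right_zero[symmetric]) (simp add: mult_ac)
  have lin: "bounded_linear D"
    unfolding linear_conv_bounded_linear[symmetric]
  proof (rule linearI)
    show "D (x + y) = D x + D y" for x y
      unfolding D_def hip_add_left using i2 by (simp add: distrib_right distrib_left)
    show "D (r *\<^sub>R x) = r *\<^sub>R D x" for r x
    proof -
      have "r *\<^sub>R x = complex_of_real r *s x" by (simp add: vec_eq_iff) (simp add: scaleR_conv_of_real)
      then show ?thesis by (simp add: smult scaleR_conv_of_real)
    qed
  qed
  have "(opk UNIV f has_derivative D) (at z)"
  proof (rule has_derivativeI_sandwich[where e = 1 and H = "\<lambda>y. B * norm (y - z)"])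
    show "((\<lambda>y. B * norm (y - z)) \<longlongrightarrow> 0) (at z)"
      by (auto intro!: tendsto_eq_intros)
    fix y assume y: "y \<noteq> z" "dist y z < 1"
    define h where "h = y - z"
    have h: "norm h \<le> 1" "h \<noteq> 0" using y by (auto simp: h_def dist_norm)
    have eq: "opk UNIV f y - opk UNIV f z - D h
        = (\<integral>w. f w * exp (hip y w) - f w * exp (hip z w) - f w * (hip h w * exp (hip z w)) \<partial>gauss)"
      unfolding opk_def D_def using i1 i2 by simp
    have "norm (opk UNIV f y - opk UNIV f z - D h) \<le> (\<integral>w. norm (f w * exp (hip y w) - f w * exp (hip z w) - f w * (hip h w * exp (hip z w))) \<partial>gauss)"
      unfolding eq by (rule integral_norm_bound)
    also have "\<dots> \<le> (\<integral>w. (norm h)\<^sup>2 * G w \<partial>gauss)"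
    proof (rule integral_mono)
      fix w :: "complex ^ 'n"
      have hy: "hip y w = hip z w + hip h w" by (simp add: h_def hip_add_left[symmetric])
      have nh: "norm (hip h w) \<le> norm h * norm w" by (rule norm_hip_le)
      have nh1: "norm (hip h w) \<le> norm w" using nh h mult_right_mono[OF h(1), of "norm w"] by simp
      have "f w * exp (hip y w) - f w * exp (hip z w) - f w * (hip h w * exp (hip z w))
          = f w * (exp (hip z w) * (exp (hip h w) - 1 - hip h w))"
        unfolding hy exp_add by (simp add: algebra_simps)
      moreover have "norm (exp (hip z w) * (exp (hip h w) - 1 - hip h w))
         \<le> exp (norm z * norm w) * (exp (norm w) * (norm h * norm w)\<^sup>2)"
        unfolding norm_mult
        by (intro mult_mono norm_e order.trans[OF norm_exp_remainder] power_mono nh) (use nh1 in auto)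
      moreover have "exp (norm z * norm w) * (exp (norm w) * (norm h * norm w)\<^sup>2)
          = (norm h)\<^sup>2 * ((norm w)\<^sup>2 * exp ((norm z + 1) * norm w))"
        by (simp add: distrib_right exp_add power_mult_distrib)
      ultimately have "norm (f w * exp (hip y w) - f w * exp (hip z w) - f w * (hip h w * exp (hip z w)))
          \<le> norm (f w) * ((norm h)\<^sup>2 * ((norm w)\<^sup>2 * exp ((norm z + 1) * norm w)))"
        by (metis norm_mult mult_left_mono norm_ge_zero)
      then show "norm (f w * exp (hip y w) - f w * exp (hip z w) - f w * (hip h w * exp (hip z w)))
          \<le> (norm h)\<^sup>2 * G w"
        by (simp add: G_def mult.left_commute)
    qed (use i1 i2 iG in auto)
    also have "\<dots> = (norm h)\<^sup>2 * B" unfolding B_def by simp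
    finally show "norm (opk UNIV f y - opk UNIV f z - D (y - z)) / norm (y - z) \<le> B * norm (y - z)"
      using h unfolding h_def[symmetric] by (simp add: divide_le_eq power2_eq_square mult_ac)
  qed (use lin in auto)
  then show "\<exists>D. (opk UNIV f has_derivative D) (at z) \<and> (\<forall>c v. D (c *s v) = c * D v)"
    using smult by blast
qed

text \<open>Fubini moves the kernel over to \<open>g\<close>, which it reproduces. Absolute
  integrability comes from the Schur bound for |f| combined with Cauchy-Schwarz against
  \<open>g\<close>.\<close>

lemma opk_UNIV_orthogonal:
  fixes f g :: "complex ^ 'n::finite \<Rightarrow> complex"
  assumes f: "sq_integrable f" and g: "sq_integrable g" "entire g"
  shows "(\<integral>z. opk UNIV f z * cnj (g z) \<partial>gauss) = (\<integral>w. f w * cnj (g w) \<partial>gauss)"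
proof -
  note [measurable] = sq_integrable_borel[OF f] sq_integrable_borel[OF g(1)]
  interpret P: pair_sigma_finite "gauss :: (complex ^ 'n) measure" "gauss :: (complex ^ 'n) measure" ..
  define T where "T z = (\<integral>\<^sup>+w. ennreal (norm (f w) * (indicator UNIV (z - w) * exp (z \<bullet> w))) \<partial>gauss)" for z
  have [measurable]: "T \<in> borel_measurable borel"
    unfolding T_def[abs_def] by measurable
  have fin: "(\<integral>\<^sup>+w. ennreal ((norm (u w))\<^sup>2) \<partial>gauss) < \<infinity>" if "sq_integrable u" for u :: "complex ^ 'n \<Rightarrow> complex"
    using that by (simp add: sq_integrable_def integrable_iff_bounded)
  have T2: "(\<integral>\<^sup>+z. (T z)\<^sup>2 \<partial>gauss) < \<infinity>"
    unfolding T_def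
    by (rule order.strict_trans1[OF schur_gauss]) (use fin[OF f] in \<open>simp_all add: ennreal_mult_less_top ennreal_power mass_nonneg\<close>)
  have int: "integrable (gauss \<Otimes>\<^sub>M gauss) (\<lambda>(z, w). f w * exp (hip z w) * cnj (g z))"
  proof (rule integrableI_bounded)
    have "(\<integral>\<^sup>+p. ennreal (norm (case p of (z, w) \<Rightarrow> f w * exp (hip z w) * cnj (g z))) \<partial>(gauss \<Otimes>\<^sub>M gauss))
      = (\<integral>\<^sup>+z. (\<integral>\<^sup>+w. ennreal (norm (f w * exp (hip z w) * cnj (g z))) \<partial>gauss) \<partial>gauss)"
      by (subst gauss.nn_integral_fst[symmetric]) simp_all
    also have "\<dots> = (\<integral>\<^sup>+z. T z * ennreal (norm (g z)) \<partial>gauss)"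
      unfolding T_def
      by (intro nn_integral_cong, subst nn_integral_multc[symmetric])
        (auto intro!: nn_integral_cong simp: norm_mult Re_hip ennreal_mult')
    finally have e: "(\<integral>\<^sup>+p. ennreal (norm (case p of (z, w) \<Rightarrow> f w * exp (hip z w) * cnj (g z))) \<partial>(gauss \<Otimes>\<^sub>M gauss))
      = (\<integral>\<^sup>+z. T z * ennreal (norm (g z)) \<partial>gauss)" .
    have "(\<integral>\<^sup>+z. T z * ennreal (norm (g z)) \<partial>gauss)\<^sup>2
        \<le> (\<integral>\<^sup>+z. (T z)\<^sup>2 \<partial>gauss) * (\<integral>\<^sup>+z. (ennreal (norm (g z)))\<^sup>2 \<partial>gauss)"
      by (rule Cauchy_Schwarz_nn_integral) measurable
    also have "\<dots> < \<infinity>"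
      using T2 fin[OF g(1)] by (simp add: ennreal_power ennreal_mult_less_top)
    finally show "(\<integral>\<^sup>+p. ennreal (norm (case p of (z, w) \<Rightarrow> f w * exp (hip z w) * cnj (g z))) \<partial>(gauss \<Otimes>\<^sub>M gauss)) < \<infinity>"
      unfolding e by (simp add: power2_eq_square ennreal_mult_less_top less_top[symmetric] ennreal_mult_eq_top_iff)
  qed measurable
  have "(\<integral>z. opk UNIV f z * cnj (g z) \<partial>gauss) = (\<integral>z. (\<integral>w. f w * exp (hip z w) * cnj (g z) \<partial>gauss) \<partial>gauss)"
    unfolding opk_def by simp
  also have "\<dots> = (\<integral>w. (\<integral>z. f w * exp (hip z w) * cnj (g z) \<partial>gauss) \<partial>gauss)"
    by (rule P.Fubini_integral[OF int, symmetric])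
  also have "\<dots> = (\<integral>w. f w * cnj (g w) \<partial>gauss)"
  proof (intro Bochner_Integration.integral_cong refl)
    fix w
    have "(\<integral>z. f w * exp (hip z w) * cnj (g z) \<partial>gauss) = f w * (\<integral>z. cnj (g z * cnj (kern w z)) \<partial>gauss)"
      by (subst integral_mult_right_zero[symmetric]) (simp add: kern_def mult_ac)
    also have "(\<integral>z. cnj (g z * cnj (kern w z)) \<partial>gauss) = cnj (g w)"
      unfolding Bochner_Integration.integral_cnj reproducing[OF g(2,1)] ..
    finally show "(\<integral>z. f w * exp (hip z w) * cnj (g z) \<partial>gauss) = f w * cnj (g w)" .
  qed
  finally show ?thesis .
qed

section \<open>Operators on the quotient space\<close>

lemma l2_cases:
  obtains f where "sq_integrable f" "u = l2_class f"
  by (metis Quotient_l2 Quotient_abs_rep Quotient_rep_reflp l2_rel_def)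

lemma l2_class_eq_zero_iff:
  assumes "sq_integrable f" shows "l2_class f = 0 \<longleftrightarrow> (AE z in gauss. f z = 0)"
proof -
  have "l2_class f = l2_class (\<lambda>_. 0) \<longleftrightarrow> l2_rel f (\<lambda>_. 0)"
    using Quotient_rel[OF Quotient_l2, of f "\<lambda>_. 0"] assms sq_integrable_zero by (auto simp: l2_rel_def)
  then show ?thesis using assms by (simp add: zero_l2_def l2_rel_def sq_integrable_zero)
qed

lemma cinner_l2_class:
  "sq_integrable f \<Longrightarrow> sq_integrable g \<Longrightarrow> cinner (l2_class f) (l2_class g) = (\<integral>z. f z * cnj (g z) \<partial>gauss)"
  by (simp add: cinner_l2.abs_eq l2_rel_def)

lemma plus_l2_class:
  "sq_integrable f \<Longrightarrow> sq_integrable g \<Longrightarrow> l2_class f + l2_class g = l2_class (\<lambda>z. f z + g z)"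
  by (simp add: plus_l2.abs_eq l2_rel_def)

lemma minus_l2_class:
  "sq_integrable f \<Longrightarrow> sq_integrable g \<Longrightarrow> l2_class f - l2_class g = l2_class (\<lambda>z. f z - g z)"
  by (simp add: minus_l2.abs_eq l2_rel_def)

lemma scaleC_l2_class: "sq_integrable f \<Longrightarrow> scaleC c (l2_class f) = l2_class (\<lambda>z. c * f z)"
  by (simp add: scaleC_l2.abs_eq l2_rel_def)

lemma mult_op_class:
  "f \<in> Linf \<Longrightarrow> sq_integrable u \<Longrightarrow> (mult_op f) (l2_class u) = l2_class (\<lambda>z. f z * u z)"
  by (simp add: mult_op.rep_eq mult_l2.abs_eq l2_rel_def)

text \<open>The zero function for non-Borel \<open>S\<close> is a dummy that makes the lifted map
  total.\<close>

lift_definition kernel_l2 :: "(complex ^ 'n::finite) set \<Rightarrow> 'n l2 \<Rightarrow> 'n l2"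
  is "\<lambda>S f. if S \<in> sets borel then opk S f else (\<lambda>_. 0)"
proof -
  fix S :: "(complex ^ 'n) set" and f g :: "complex ^ 'n \<Rightarrow> complex"
  assume fg: "l2_rel f g"
  then have sq: "sq_integrable f" "sq_integrable g" and ae: "AE z in gauss. f z = g z" by (simp_all add: l2_rel_def)
  note [measurable] = sq_integrable_borel[OF sq(1)] sq_integrable_borel[OF sq(2)]
  have "opk S f = opk S g" if [measurable]: "S \<in> sets borel"
    unfolding opk_def
    by (intro ext integral_cong_AE) (use ae in \<open>auto elim!: eventually_mono\<close>)
  then show "l2_rel (if S \<in> sets borel then opk S f else (\<lambda>_. 0)) (if S \<in> sets borel then opk S g else (\<lambda>_. 0))"
    using sq by (auto simp: l2_rel_def sq_integrable_zero opk_sq)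
qed

lemma kernel_l2_class:
  "sq_integrable f \<Longrightarrow> S \<in> sets borel \<Longrightarrow> kernel_l2 S (l2_class f) = l2_class (opk S f)"
  by (simp add: kernel_l2.abs_eq l2_rel_def)

lemma opk_add:
  assumes "sq_integrable f" "sq_integrable g" "S \<in> sets borel"
  shows "opk S (\<lambda>z. f z + g z) = (\<lambda>z. opk S f z + opk S g z)"
  unfolding opk_def using opk_integrable[OF assms(1,3)] opk_integrable[OF assms(2,3)]
  by (simp add: distrib_right)

lemma opk_cmult: "opk S (\<lambda>z. c * f z) = (\<lambda>z. c * opk S f z)"
  unfolding opk_def by (simp add: mult.assoc)

lemma scaleC_kernel_l2:
  assumes "S \<in> sets borel"
  shows "kernel_l2 S (scaleC c u) = scaleC c (kernel_l2 S u)"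
  by (rule l2_cases[of u])
    (simp add: scaleC_l2_class kernel_l2_class assms sq_integrable_cmult opk_cmult opk_sq)

lemma norm_kernel_l2_le:
  assumes S: "S \<in> sets borel"
  shows "norm (kernel_l2 S u) \<le> norm u * mass S"
proof (rule l2_cases[of u])
  fix f assume f: "sq_integrable f" "u = l2_class f"
  have "(norm (kernel_l2 S u))\<^sup>2 \<le> (norm u * mass S)\<^sup>2"
    using opk_sq[OF f(1) S]
    by (simp add: f kernel_l2_class S norm_l2_class_sq power_mult_distrib mult.commute)
  then show ?thesis by (rule power2_le_imp_le) (simp add: mass_nonneg)
qed

lift_definition kernel_op :: "(complex ^ 'n::finite) set \<Rightarrow> 'n l2 \<Rightarrow>\<^sub>L 'n l2"
  is "\<lambda>S. if S \<in> sets borel then kernel_l2 S else (\<lambda>_. 0)"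
proof -
  fix S :: "(complex ^ 'n) set"
  have "bounded_linear (kernel_l2 S)" if S: "S \<in> sets borel"
  proof (rule bounded_linear_intro[where K = "mass S"])
    fix u v :: "'n l2"
    obtain f g where fg: "sq_integrable f" "u = l2_class f" "sq_integrable g" "v = l2_class g"
      using l2_cases by metis
    show "kernel_l2 S (u + v) = kernel_l2 S u + kernel_l2 S v"
      using fg by (simp add: plus_l2_class kernel_l2_class S sq_integrable_add opk_add opk_sq)
    show "kernel_l2 S (r *\<^sub>R u) = r *\<^sub>R kernel_l2 S u" for r
      by (simp add: scaleC_of_real[symmetric] scaleC_kernel_l2 S)
    show "norm (kernel_l2 S u) \<le> norm u * mass S" by (rule norm_kernel_l2_le[OF S])
  qed
  then show "bounded_linear (if S \<in> sets borel then kernel_l2 S else (\<lambda>_. 0))" by simp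
qed

lemma kernel_op_class:
  "S \<in> sets borel \<Longrightarrow> sq_integrable f \<Longrightarrow> (kernel_op S) (l2_class f) = l2_class (opk S f)"
  by (simp add: kernel_op.rep_eq kernel_l2_class)

lemma norm_kernel_op_le: "S \<in> sets borel \<Longrightarrow> norm (kernel_op S) \<le> mass S"
  by (rule norm_blinfun_bound[OF mass_nonneg]) (metis kernel_op.rep_eq norm_kernel_l2_le mult.commute)

text \<open>With a ball for \<open>S\<close>, this splits the projection into a band operator and a
  remainder of small norm.\<close>

lemma kernel_op_compl:
  assumes S [measurable]: "S \<in> sets borel"
  shows "kernel_op UNIV = kernel_op S + kernel_op (- S)"
proof (rule blinfun_eqI)
  fix u :: "'a l2"
  obtain f where f: "sq_integrable f" "u = l2_class f" using l2_cases by metis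
  have mS: "- S \<in> sets borel" using S by (rule borel_comp)
  have "opk UNIV f = (\<lambda>z. opk S f z + opk (- S) f z)"
  proof
    fix z
    have "opk S f z + opk (- S) f z
      = (\<integral>w. f w * (indicator S (z - w) * exp (hip z w)) + f w * (indicator (- S) (z - w) * exp (hip z w)) \<partial>gauss)"
      unfolding opk_def
      by (rule Bochner_Integration.integral_add[symmetric]) (intro opk_integrable f S mS)+
    also have "\<dots> = opk UNIV f z"
      unfolding opk_def by (intro Bochner_Integration.integral_cong) (auto simp: indicator_def)
    finally show "opk UNIV f z = opk S f z + opk (- S) f z" ..
  qed
  then show "kernel_op UNIV u = (kernel_op S + kernel_op (- S)) u"
    using S mS by (simp add: f kernel_op_class blinfun.add_left plus_l2_class opk_sq)
qed

lemma kernel_op_in_operators: "S \<in> sets borel \<Longrightarrow> kernel_op S \<in> operators"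
  by (simp add: operators_def kernel_op.rep_eq scaleC_kernel_l2)

lemma mult_op_in_operators: "mult_op f \<in> operators"
proof (cases "f \<in> Linf")
  case True
  have "mult_op f (scaleC c u) = scaleC c (mult_op f u)" for c u
    by (rule l2_cases[of u])
      (simp add: scaleC_l2_class mult_op_class True sq_integrable_cmult sq_integrable_Linf_mult mult.left_commute)
  then show ?thesis by (simp add: operators_def)
next
  case False
  then have "mult_op f u = 0" for u
    unfolding mult_op.rep_eq by transfer (simp add: l2_rel_def sq_integrable_zero)
  then show ?thesis
    by (simp add: operators_def) (metis blinfun.zero_right scaleC_of_real scaleR_zero_right cinner_self norm_scaleC norm_eq_zero norm_zero mult_zero_right)
qed

section \<open>Riesz representation and adjoints\<close>

lemma cinner_add_right: "cinner x (y + z) = cinner x y + cinner x z"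
  by (metis cinner_commute cinner_add_left complex_cnj_add)

lemma cinner_diff_left: "cinner (x - y) z = cinner x z - cinner y z"
  using cinner_add_left[of "x - y" y z] by simp

lemma cinner_diff_right: "cinner x (y - z) = cinner x y - cinner x z"
  using cinner_add_right[of x "y - z" z] by simp

lemma cinner_zero_left [simp]: "cinner 0 x = 0"
  using cinner_diff_left[of 0 0 x] by simp

lemma cinner_zero_right [simp]: "cinner x 0 = 0"
  using cinner_diff_right[of x 0 0] by simp

lemma cinner_self_eq_0: "cinner x x = 0 \<longleftrightarrow> x = 0"
  by (simp add: cinner_self)

lemma norm_cinner_le: "norm (cinner x y) \<le> norm x * norm y"
proof (cases "cinner x y = 0")
  case False
  define c where "c = cnj (cinner x y) / norm (cinner x y)"
  have c: "norm c = 1" using False by (simp add: c_def norm_divide)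
  have "c * cinner x y = (cinner x y * cnj (cinner x y)) / norm (cinner x y)" by (simp add: c_def mult.commute)
  also have "\<dots> = norm (cinner x y)"
    using False by (simp add: complex_norm_square[symmetric] power2_eq_square)
  finally have "norm (cinner x y) = inner (scaleC c x) y"
    by (simp add: inner_eq_Re_cinner cinner_scaleC_left)
  also have "\<dots> \<le> norm (scaleC c x) * norm y" by (rule norm_cauchy_schwarz)
  finally show ?thesis by (simp add: norm_scaleC c)
qed simp

lemma cinner_scaleR_left: "cinner (r *\<^sub>R x) y = r *\<^sub>R cinner x y"
  by (simp add: scaleC_of_real[symmetric] cinner_scaleC_left scaleR_conv_of_real)

lemma cinner_scaleR_right: "cinner x (r *\<^sub>R y) = r *\<^sub>R cinner x y"
  by (simp add: scaleC_of_real[symmetric] cinner_scaleC_right scaleR_conv_of_real)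

lemma bounded_bilinear_cinner: "bounded_bilinear (cinner :: 'a::complex_inner \<Rightarrow> 'a \<Rightarrow> complex)"
  by (unfold_locales)
    (auto simp: cinner_add_left cinner_add_right cinner_scaleR_left cinner_scaleR_right
      intro!: exI[of _ 1] norm_cinner_le)

lemma cinner_eqI: "(\<And>x. cinner x y = cinner x z) \<Longrightarrow> y = z"
  by (metis cinner_diff_right cinner_self_eq_0 eq_iff_diff_eq_0)

text \<open>The representing vector minimises \<open>J x = \<parallel>x\<parallel>\<^sup>2 / 2 - \<phi> x\<close>; minimising sequences are Cauchy by
  the parallelogram law.\<close>

lemma riesz_real:
  fixes \<phi> :: "'a::{real_inner, complete_space} \<Rightarrow> real"
  assumes "bounded_linear \<phi>"
  obtains v where "\<And>x. \<phi> x = inner x v"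
proof -
  interpret \<phi>: bounded_linear \<phi> by fact
  define J where "J x = (norm x)\<^sup>2 / 2 - \<phi> x" for x
  define m where "m = Inf (range J)"
  obtain C where C: "\<And>x. norm (\<phi> x) \<le> norm x * C" using \<phi>.bounded by blast
  have "- (C\<^sup>2 / 2) \<le> J x" for x
  proof -
    have "\<phi> x \<le> norm x * C" using C[of x] by simp
    moreover have "0 \<le> (norm x - C)\<^sup>2" by simp
    ultimately show ?thesis by (simp add: J_def power2_diff field_simps)
  qed
  then have bdd: "bdd_below (range J)" by (auto intro!: bdd_belowI)
  have mle: "m \<le> J x" for x unfolding m_def by (rule cINF_lower[OF bdd]) simp
  have "\<exists>x. J x < m + 1 / Suc n" for n
  proof -
    have "Inf (range J) < m + 1 / Suc n" by (simp add: m_def)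
    then show ?thesis using bdd by (subst (asm) cInf_less_iff) auto
  qed
  then obtain u where u: "\<And>n. J (u n) < m + 1 / Suc n" by metis
  have par: "(norm (x - y))\<^sup>2 / 4 \<le> (J x - m) + (J y - m)" for x y
  proof -
    have "J x + J y - 2 * J ((1 / 2) *\<^sub>R (x + y)) = (norm (x - y))\<^sup>2 / 4"
      unfolding J_def power2_norm_eq_inner \<phi>.scaleR \<phi>.add
      by (simp add: inner_simps inner_commute) (simp add: field_simps)
    with mle[of "(1 / 2) *\<^sub>R (x + y)"] show ?thesis by simp
  qed
  have "Cauchy u"
  proof (rule metric_CauchyI)
    fix e :: real assume e: "e > 0"
    obtain N where N: "inverse (real (Suc N)) < e\<^sup>2 / 8"
      using reals_Archimedean[of "e\<^sup>2 / 8"] e by auto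
    show "\<exists>M. \<forall>i\<ge>M. \<forall>j\<ge>M. dist (u i) (u j) < e"
    proof (intro exI[of _ N] allI impI)
      fix i j assume ij: "N \<le> i" "N \<le> j"
      have s: "J (u k) - m < e\<^sup>2 / 8" if "N \<le> k" for k
      proof -
        have "1 / real (Suc k) \<le> 1 / real (Suc N)" using that by (intro divide_left_mono) auto
        with u[of k] N show ?thesis by (simp add: inverse_eq_divide)
      qed
      have "(norm (u i - u j))\<^sup>2 < e\<^sup>2" using par[of "u i" "u j"] s[OF ij(1)] s[OF ij(2)] by simp
      then show "dist (u i) (u j) < e" using e by (simp add: dist_norm power_less_imp_less_base)
    qed
  qed
  then obtain v where v: "u \<longlonglongrightarrow> v" using Cauchy_convergent convergent_def by blast
  have "(\<lambda>n. J (u n)) \<longlonglongrightarrow> J v"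
    unfolding J_def by (intro tendsto_intros \<phi>.tendsto v) simp
  moreover have "(\<lambda>n. m + 1 / real (Suc n)) \<longlonglongrightarrow> m + 0"
    by (intro tendsto_add tendsto_const LIMSEQ_Suc lim_1_over_n)
  ultimately have "J v \<le> m + 0"
    using u by (intro LIMSEQ_le[of "\<lambda>n. J (u n)"]) (auto intro: less_imp_le)
  then have min: "J v \<le> J x" for x using mle[of x] by simp
  have "\<phi> x = inner x v" for x
  proof (rule ccontr)
    assume ne: "\<phi> x \<noteq> inner x v"
    then have x: "norm x > 0" by (auto simp: \<phi>.zero)
    define d where "d = \<phi> x - inner x v"
    \<comment> \<open>The minimiser of the quadratic polynomial J (v + t x) in t; for d nonzero its
      minimum lies strictly below J v.\<close>
    define t where "t = d / (norm x)\<^sup>2"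
    have "J (v + t *\<^sub>R x) = J v - t * d + t\<^sup>2 * (norm x)\<^sup>2 / 2"
      by (simp add: J_def d_def \<phi>.scaleR \<phi>.add power2_norm_eq_inner inner_simps inner_commute)
        (simp add: field_simps power2_eq_square)
    also have "\<dots> = J v - d\<^sup>2 / (2 * (norm x)\<^sup>2)"
      using x by (simp add: t_def field_simps power2_eq_square)
    also have "\<dots> < J v" using x ne by (simp add: d_def)
    finally show False using min[of "v + t *\<^sub>R x"] by simp
  qed
  then show ?thesis by (rule that)
qed

text \<open>The vector representing the real part represents the whole functional, since the
  imaginary part at x is minus the real part at i x.\<close>

lemma riesz_complex:
  fixes \<phi> :: "'a::{complex_inner, complete_space} \<Rightarrow> complex"
  assumes "bounded_linear \<phi>" and c: "\<And>c x. \<phi> (scaleC c x) = c * \<phi> x"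
  obtains v where "\<And>x. \<phi> x = cinner x v"
proof -
  have "bounded_linear (\<lambda>x. Re (\<phi> x))"
    using bounded_linear_compose[OF bounded_linear_Re assms(1)] .
  then obtain v where v: "\<And>x. Re (\<phi> x) = inner x v" using riesz_real by blast
  have "\<phi> x = cinner x v" for x
  proof (rule complex_eqI)
    show "Re (\<phi> x) = Re (cinner x v)" using v by (simp add: inner_eq_Re_cinner)
    have "Re (\<phi> (scaleC \<i> x)) = Re (cinner (scaleC \<i> x) v)" using v by (simp add: inner_eq_Re_cinner)
    then show "Im (\<phi> x) = Im (cinner x v)" by (simp add: c cinner_scaleC_left)
  qed
  then show ?thesis by (rule that)
qed

text \<open>A relation, so that adjoints can be handled before their existence is known;
  \<open>hadjoint_eqI\<close> returns to the definite description.\<close>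

definition is_adjoint :: "('a::complex_inner \<Rightarrow>\<^sub>L 'a) \<Rightarrow> ('a \<Rightarrow>\<^sub>L 'a) \<Rightarrow> bool" where
  "is_adjoint A B \<longleftrightarrow> (\<forall>x y. cinner (A x) y = cinner x (B y))"

lemma hadjoint_eqI:
  assumes "is_adjoint A B" shows "hadjoint A = B"
  unfolding hadjoint_def
proof (rule the_equality)
  show "\<forall>x y. cinner (A x) y = cinner x (B y)"
    using assms by (simp add: is_adjoint_def)
  fix C :: "'a \<Rightarrow>\<^sub>L 'a" assume "\<forall>x y. cinner (A x) y = cinner x (C y)"
  then show "C = B"
    using assms by (intro blinfun_eqI cinner_eqI) (simp add: is_adjoint_def)
qed

text \<open>Applied to differences, this shows that convergence of operators carries over to their
  adjoints.\<close>

lemma is_adjoint_norm_le: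
  assumes "is_adjoint A B" shows "norm B \<le> norm A"
proof (rule norm_blinfun_bound)
  fix y
  have "(norm (B y))\<^sup>2 = norm (cinner (B y) (B y))"
    by (simp add: cinner_self norm_power)
  also have "\<dots> = norm (cinner (A (B y)) y)"
    using assms by (simp add: is_adjoint_def)
  also have "\<dots> \<le> norm (A (B y)) * norm y" by (rule norm_cinner_le)
  also have "\<dots> \<le> (norm A * norm (B y)) * norm y"
    by (intro mult_right_mono norm_blinfun) simp
  finally have "norm (B y) * norm (B y) \<le> (norm A * norm y) * norm (B y)"
    by (simp add: power2_eq_square mult_ac)
  then show "norm (B y) \<le> norm A * norm y"
    by (cases "norm (B y) = 0") (auto simp: mult_le_cancel_right)
qed simp

lemma is_adjoint_diff:
  "is_adjoint A B \<Longrightarrow> is_adjoint A' B' \<Longrightarrow> is_adjoint (A - A') (B - B')"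
  by (simp add: is_adjoint_def blinfun.diff_left cinner_diff_left cinner_diff_right)

lemma adjoint_exists:
  fixes A :: "'a::{complex_inner, complete_space} \<Rightarrow>\<^sub>L 'a"
  assumes A: "A \<in> operators"
  shows "is_adjoint A (hadjoint A)"
proof -
  have "\<exists>v. \<forall>x. cinner (A x) y = cinner x v" for y
  proof -
    have "bounded_linear (\<lambda>x. cinner (A x) y)"
      by (rule bounded_linear_compose[OF bounded_bilinear.bounded_linear_left[OF bounded_bilinear_cinner] blinfun.bounded_linear_right])
    moreover have "cinner (A (scaleC c x)) y = c * cinner (A x) y" for c x
      using A by (simp add: operators_def cinner_scaleC_left)
    ultimately show ?thesis by (rule riesz_complex) blast
  qed
  then obtain b where b: "\<And>x y. cinner (A x) y = cinner x (b y)" by metis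
  have "bounded_linear b"
  proof (rule bounded_linear_intro[where K = "norm A"])
    show "b (x + y) = b x + b y" for x y
      by (rule cinner_eqI) (simp add: b[symmetric] cinner_add_right)
    show "b (r *\<^sub>R x) = r *\<^sub>R b x" for r x
      by (rule cinner_eqI) (simp add: b[symmetric] cinner_scaleR_right)
    fix y
    have "(norm (b y))\<^sup>2 = norm (cinner (A (b y)) y)"
      by (simp add: b cinner_self norm_power)
    also have "\<dots> \<le> norm (A (b y)) * norm y" by (rule norm_cinner_le)
    also have "\<dots> \<le> (norm A * norm (b y)) * norm y"
      by (intro mult_right_mono norm_blinfun) simp
    finally have "norm (b y) * norm (b y) \<le> (norm y * norm A) * norm (b y)"
      by (simp add: power2_eq_square mult_ac)
    then show "norm (b y) \<le> norm y * norm A"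
      by (cases "norm (b y) = 0") (auto simp: mult_le_cancel_right)
  qed
  then have "is_adjoint A (Blinfun b)"
    by (simp add: is_adjoint_def b bounded_linear_Blinfun_apply)
  then show ?thesis using hadjoint_eqI by metis
qed

section \<open>The Fock space as a reproducing kernel Hilbert space\<close>

lift_definition kfock :: "complex ^ 'n::finite \<Rightarrow> 'n fock" is "\<lambda>w. l2_class (kern w)"
  unfolding fock_space_def using sq_integrable_kern entire_kern by blast

text \<open>The value at \<open>w\<close> of the entire representative of \<open>u\<close>. Pairing
  with the kernel avoids choosing a representative; \<open>ev_eq\<close> shows that it yields the
  right function.\<close>

definition ev :: "'n::finite fock \<Rightarrow> complex ^ 'n \<Rightarrow> complex" where
  "ev u w = cinner u (kfock w)"

lemma fock_cases:
  obtains f where "entire f" "sq_integrable f" "fock_l2 u = l2_class f"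
  using fock_l2[of u] unfolding fock_space_def by auto

lemma ev_eq:
  assumes "entire f" "sq_integrable f" "fock_l2 u = l2_class f"
  shows "ev u = f"
proof
  fix w
  show "ev u w = f w"
    unfolding ev_def cinner_fock.rep_eq kfock.rep_eq assms(3)
    using reproducing[OF assms(1,2)] by (simp add: cinner_l2_class assms(2) sq_integrable_kern)
qed

lemma
  shows entire_ev: "entire (ev u)"
    and sq_integrable_ev: "sq_integrable (ev u)"
    and l2_class_ev: "l2_class (ev u) = fock_l2 u"
  by (rule fock_cases[of u]; simp add: ev_eq)+

lemma fock_incl_apply: "fock_incl u = fock_l2 u"
  by (simp add: fock_incl.rep_eq)

lemma cinner_fock_ev: "cinner u v = (\<integral>z. ev u z * cnj (ev v z) \<partial>gauss)"
  unfolding cinner_fock.rep_eq l2_class_ev[symmetric] by (rule cinner_l2_class) (rule sq_integrable_ev)+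

lemma norm_fock_ev: "(norm u)\<^sup>2 = (\<integral>z. (norm (ev u z))\<^sup>2 \<partial>gauss)"
  unfolding norm_fock.rep_eq l2_class_ev[symmetric] by (rule norm_l2_class_sq) (rule sq_integrable_ev)

lemma ev_kfock: "ev (kfock w) = kern w"
  by (rule ev_eq) (simp_all add: entire_kern sq_integrable_kern kfock.rep_eq)

lemma cinner_kfock: "cinner (kfock w) (kfock z) = exp (hip z w)"
  using fun_cong[OF ev_kfock[of w], of z] by (simp add: ev_def kern_def)

lemma norm_kfock: "norm (kfock w) = exp ((norm w)\<^sup>2 / 2)"
proof -
  have "complex_of_real ((norm (kfock w))\<^sup>2) = complex_of_real ((exp ((norm w)\<^sup>2 / 2))\<^sup>2)"
    unfolding cinner_self[symmetric] cinner_kfock hip_self exp_of_real exp_double[symmetric] by simp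
  then have "(norm (kfock w))\<^sup>2 = (exp ((norm w)\<^sup>2 / 2))\<^sup>2" by (simp only: of_real_eq_iff)
  then show ?thesis by (simp add: power2_eq_iff_nonneg)
qed

lemma norm_kfock_diff:
  "(norm (kfock x - kfock w))\<^sup>2 = Re (exp (hip x x)) - 2 * Re (exp (hip x w)) + Re (exp (hip w w))"
proof -
  have "Re (exp (hip w x)) = Re (exp (hip x w))"
    by (metis cnj_hip exp_cnj cnj.sel(1))
  moreover have "(norm (kfock x - kfock w))\<^sup>2 = Re (cinner (kfock x - kfock w) (kfock x - kfock w))"
    by (simp add: cinner_self)
  ultimately show ?thesis
    by (simp add: cinner_diff_left cinner_diff_right cinner_kfock)
qed

text \<open>Norm continuity of the kernels makes all matrix elements between them continuous, hence
  measurable.\<close>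

lemma continuous_on_kfock: "continuous_on UNIV kfock"
  unfolding continuous_on_def
proof
  fix w :: "complex ^ 'a"
  have "((\<lambda>x. Re (exp (hip x x)) - 2 * Re (exp (hip x w)) + Re (exp (hip w w))) \<longlongrightarrow>
      Re (exp (hip w w)) - 2 * Re (exp (hip w w)) + Re (exp (hip w w))) (at w)"
  proof -
    have c: "continuous_on UNIV (\<lambda>x. Re (exp (hip x x)) - 2 * Re (exp (hip x w)) + Re (exp (hip w w)))"
      by (intro continuous_intros)
    show ?thesis using c[unfolded continuous_on_def, rule_format, of w] by simp
  qed
  then have "((\<lambda>x. (norm (kfock x - kfock w))\<^sup>2) \<longlongrightarrow> 0) (at w)"
    by (simp add: norm_kfock_diff)
  then have "((\<lambda>x. sqrt ((norm (kfock x - kfock w))\<^sup>2)) \<longlongrightarrow> sqrt 0) (at w)"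
    by (rule tendsto_real_sqrt)
  then have "((\<lambda>x. kfock x - kfock w) \<longlongrightarrow> 0) (at w)"
    by (simp add: tendsto_norm_zero_iff)
  then show "(kfock \<longlongrightarrow> kfock w) (at w)" by (rule LIM_zero_cancel)
qed

text \<open>A Cauchy sequence converges pointwise by the reproducing property, and in norm by Fatou's lemma;
  the limit is entire because it is reproduced by the kernel.\<close>

lemma fock_Cauchy_convergent:
  fixes u :: "nat \<Rightarrow> 'n::finite fock"
  assumes u: "Cauchy u"
  shows "convergent u"
proof -
  define F where "F n = ev (u n)" for n
  have F: "entire (F n)" "sq_integrable (F n)" "fock_l2 (u n) = l2_class (F n)" for n
    by (simp_all add: F_def entire_ev sq_integrable_ev l2_class_ev)
  note [measurable] = entire_measurable[OF F(1)]
  have "Cauchy (\<lambda>n. F n z)" for z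
    using bounded_linear.Cauchy[OF bounded_bilinear.bounded_linear_left[OF bounded_bilinear_cinner] u, of "kfock z"]
    by (simp add: F_def ev_def)
  then have "\<exists>l. (\<lambda>n. F n z) \<longlonglongrightarrow> l" for z
    using Cauchy_convergent convergent_def by blast
  then obtain f where f: "\<And>z. (\<lambda>n. F n z) \<longlonglongrightarrow> f z" by metis
  have fm [measurable]: "f \<in> borel_measurable borel"
    by (rule borel_measurable_LIMSEQ_metric[of F]) (use f in auto)
  have key: "\<exists>N. \<forall>n\<ge>N. (\<integral>\<^sup>+z. ennreal ((norm (F n z - f z))\<^sup>2) \<partial>gauss) \<le> ennreal (e\<^sup>2)" if e: "e > 0" for e
  proof -
    obtain N where N: "\<And>m n. m \<ge> N \<Longrightarrow> n \<ge> N \<Longrightarrow> norm (u m - u n) < e"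
      using CauchyD[OF u e] by auto
    show ?thesis
    proof (intro exI[of _ N] allI impI)
      fix n assume n: "n \<ge> N"
      have le: "(\<integral>\<^sup>+z. ennreal ((norm (F n z - F m z))\<^sup>2) \<partial>gauss) \<le> ennreal (e\<^sup>2)" if m: "m \<ge> N" for m
      proof -
        have sq: "sq_integrable (\<lambda>z. F n z - F m z)" by (intro sq_integrable_diff F)
        have "fock_l2 (u n - u m) = l2_class (\<lambda>z. F n z - F m z)"
          by (simp add: minus_fock.rep_eq F minus_l2_class)
        then have "(norm (u n - u m))\<^sup>2 = (\<integral>z. (norm (F n z - F m z))\<^sup>2 \<partial>gauss)"
          using norm_l2_class_sq[OF sq] by (simp add: norm_fock.rep_eq)
        moreover have "(norm (u n - u m))\<^sup>2 \<le> e\<^sup>2" using N[OF n m] by (intro power_mono) auto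
        moreover have "(\<integral>\<^sup>+z. ennreal ((norm (F n z - F m z))\<^sup>2) \<partial>gauss)
            = ennreal (\<integral>z. (norm (F n z - F m z))\<^sup>2 \<partial>gauss)"
          using sq by (intro nn_integral_eq_integral) (auto simp: sq_integrable_def)
        ultimately show ?thesis by (simp add: ennreal_leI)
      qed
      have "(\<lambda>m. ennreal ((norm (F n z - F m z))\<^sup>2)) \<longlonglongrightarrow> ennreal ((norm (F n z - f z))\<^sup>2)" for z
        by (intro tendsto_intros f) 
      then have "liminf (\<lambda>m. ennreal ((norm (F n z - F m z))\<^sup>2)) = ennreal ((norm (F n z - f z))\<^sup>2)" for z
        by (intro lim_imp_Liminf) simp_all
      then have "(\<integral>\<^sup>+z. ennreal ((norm (F n z - f z))\<^sup>2) \<partial>gauss)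
          = (\<integral>\<^sup>+z. liminf (\<lambda>m. ennreal ((norm (F n z - F m z))\<^sup>2)) \<partial>gauss)" by simp
      also have "\<dots> \<le> liminf (\<lambda>m. \<integral>\<^sup>+z. ennreal ((norm (F n z - F m z))\<^sup>2) \<partial>gauss)"
        by (rule nn_integral_liminf) measurable
      also have "\<dots> \<le> limsup (\<lambda>m. \<integral>\<^sup>+z. ennreal ((norm (F n z - F m z))\<^sup>2) \<partial>gauss)"
        by (rule Liminf_le_Limsup) simp
      also have "\<dots> \<le> ennreal (e\<^sup>2)"
        by (rule Limsup_bounded) (auto intro: eventually_mono[OF eventually_ge_at_top[of N]] le)
      finally show "(\<integral>\<^sup>+z. ennreal ((norm (F n z - f z))\<^sup>2) \<partial>gauss) \<le> ennreal (e\<^sup>2)" .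
    qed
  qed
  have sqd: "sq_integrable (\<lambda>z. F n z - f z)" if "(\<integral>\<^sup>+z. ennreal ((norm (F n z - f z))\<^sup>2) \<partial>gauss) \<le> ennreal (e\<^sup>2)" for n e
  proof -
    have "(\<integral>\<^sup>+z. ennreal ((norm (F n z - f z))\<^sup>2) \<partial>gauss) < \<infinity>"
      using that by (rule order.strict_trans1) simp
    then show ?thesis by (simp add: sq_integrable_def integrable_iff_bounded)
  qed
  have fsq: "sq_integrable f"
  proof -
    obtain N where "(\<integral>\<^sup>+z. ennreal ((norm (F N z - f z))\<^sup>2) \<partial>gauss) \<le> ennreal (1\<^sup>2)" using key[of 1] by auto
    from sq_integrable_diff[OF F(2)[of N] sqd[OF this]] show ?thesis by simp
  qed
  have lim: "(\<lambda>n. fock_l2 (u n)) \<longlonglongrightarrow> l2_class f"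
  proof (rule metric_LIMSEQ_I)
    fix e :: real assume e: "e > 0"
    then obtain N where N: "\<forall>n\<ge>N. (\<integral>\<^sup>+z. ennreal ((norm (F n z - f z))\<^sup>2) \<partial>gauss) \<le> ennreal ((e / 2)\<^sup>2)"
      using key[of "e / 2"] by auto
    show "\<exists>no. \<forall>n\<ge>no. dist (fock_l2 (u n)) (l2_class f) < e"
    proof (intro exI[of _ N] allI impI)
      fix n assume "n \<ge> N"
      with N have b: "(\<integral>\<^sup>+z. ennreal ((norm (F n z - f z))\<^sup>2) \<partial>gauss) \<le> ennreal ((e / 2)\<^sup>2)" by simp
      note sq = sqd[OF b]
      have "(dist (fock_l2 (u n)) (l2_class f))\<^sup>2 = (\<integral>z. (norm (F n z - f z))\<^sup>2 \<partial>gauss)"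
        by (simp add: dist_norm F minus_l2_class fsq norm_l2_class_sq sq)
      moreover have "(\<integral>\<^sup>+z. ennreal ((norm (F n z - f z))\<^sup>2) \<partial>gauss) = ennreal (\<integral>z. (norm (F n z - f z))\<^sup>2 \<partial>gauss)"
        using sq by (intro nn_integral_eq_integral) (auto simp: sq_integrable_def)
      ultimately have "(dist (fock_l2 (u n)) (l2_class f))\<^sup>2 \<le> (e / 2)\<^sup>2"
        using b by (simp add: ennreal_le_iff)
      then have "dist (fock_l2 (u n)) (l2_class f) \<le> e / 2"
        by (rule power2_le_imp_le) (use e in simp)
      then show "dist (fock_l2 (u n)) (l2_class f) < e" using e by simp
    qed
  qed
  \<comment> \<open>The pairing with \<open>kern z\<close> converges to \<open>opk UNIV f z\<close>
    by norm convergence and equals \<open>F n z\<close>, which tends to \<open>f z\<close>. Thus the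
    equality holds at every point, not just almost everywhere.\<close>
  have "opk UNIV f z = f z" for z
  proof -
    have l1: "(\<lambda>n. cinner (fock_l2 (u n)) (l2_class (kern z))) \<longlonglongrightarrow> cinner (l2_class f) (l2_class (kern z))"
      by (rule bounded_bilinear.tendsto[OF bounded_bilinear_cinner lim tendsto_const])
    have l2: "cinner (fock_l2 (u n)) (l2_class (kern z)) = F n z" for n
      unfolding F using reproducing[OF F(1,2)] by (simp add: cinner_l2_class F sq_integrable_kern)
    have l3: "cinner (l2_class f) (l2_class (kern z)) = opk UNIV f z"
      by (simp add: cinner_l2_class fsq sq_integrable_kern opk_def cnj_kern)
    show ?thesis by (rule LIMSEQ_unique[OF l1[unfolded l2 l3] f])
  qed
  then have "opk UNIV f = f" by (rule ext)
  then have "entire f" using entire_opk_UNIV[OF fsq] by (simp only:)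
  then have "l2_class f \<in> fock_space" using fsq unfolding fock_space_def by blast
  then have v: "fock_l2 (fock_of (l2_class f)) = l2_class f" by (rule fock_of_inverse)
  have "u \<longlonglongrightarrow> fock_of (l2_class f)"
    using lim unfolding lim_sequentially dist_fock.rep_eq v .
  then show ?thesis by (rule convergentI)
qed

text \<open>Completeness provides adjoints for the bounded operators on the Fock space.\<close>

instance fock :: (finite) complete_space
  by standard (rule fock_Cauchy_convergent)

section \<open>The orthogonal projection\<close>

lemma kernel_op_in_fock_space: "kernel_op UNIV u \<in> fock_space"
proof (rule l2_cases[of u])
  fix f assume f: "sq_integrable f" "u = l2_class f"
  show ?thesis
    unfolding fock_space_def using f entire_opk_UNIV[of f] opk_sq(1)[of f UNIV] by (auto simp: kernel_op_class)
qed

text \<open>The explicit integral form of the projection; it serves as the witness for the definite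
  description in \<open>fock_proj\<close>.\<close>

lift_definition bergman :: "'n::finite l2 \<Rightarrow>\<^sub>L 'n fock" is "\<lambda>u. fock_of (kernel_op UNIV u)"
proof (rule bounded_linear_intro[where K = "norm (kernel_op UNIV :: 'n l2 \<Rightarrow>\<^sub>L 'n l2)"])
  note inv = fock_of_inverse[OF kernel_op_in_fock_space]
  fix u v :: "'n l2" and r :: real
  show "fock_of (kernel_op UNIV (u + v))
      = fock_of (kernel_op UNIV u) + fock_of (kernel_op UNIV v)"
    unfolding fock_l2_inject[symmetric] plus_fock.rep_eq inv by (rule blinfun.add_right)
  show "fock_of (kernel_op UNIV (r *\<^sub>R u)) = r *\<^sub>R fock_of (kernel_op UNIV u)"
    unfolding fock_l2_inject[symmetric] scaleR_fock.rep_eq inv by (rule blinfun.scaleR_right)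
  show "norm (fock_of (kernel_op UNIV u)) \<le> norm u * norm (kernel_op UNIV :: 'n l2 \<Rightarrow>\<^sub>L 'n l2)"
    using norm_blinfun[of "kernel_op UNIV" u] by (simp add: norm_fock.rep_eq inv mult.commute)
qed

lemma fock_l2_bergman: "fock_l2 (bergman u) = (kernel_op UNIV) u"
  by (simp add: bergman.rep_eq fock_of_inverse kernel_op_in_fock_space)

lemma bergman_orthogonal:
  "cinner (u - fock_incl (bergman u)) (fock_incl v) = 0"
proof (rule l2_cases[of u])
  fix f assume f: "sq_integrable f" "u = l2_class f"
  have "cinner (kernel_op UNIV u) (fock_l2 v) = cinner u (fock_l2 v)"
    unfolding l2_class_ev[symmetric] using f opk_sq(1)[of f UNIV]
    by (simp add: kernel_op_class cinner_l2_class sq_integrable_ev opk_UNIV_orthogonal entire_ev)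
  then show ?thesis by (simp add: fock_incl_apply fock_l2_bergman cinner_diff_left)
qed

text \<open>Uniqueness: the difference of two candidates lies in the Fock space and is orthogonal to
  it, hence to itself.\<close>

lemma fock_proj_eq: "fock_proj = bergman"
  unfolding fock_proj_def
proof (rule the_equality)
  show "\<forall>u v. cinner (u - fock_incl (bergman u)) (fock_incl v) = 0"
    using bergman_orthogonal by blast
  fix P :: "'a l2 \<Rightarrow>\<^sub>L 'a fock"
  assume P: "\<forall>u v. cinner (u - fock_incl (P u)) (fock_incl v) = 0"
  show "P = bergman"
  proof (rule blinfun_eqI)
    fix u
    define d where "d = P u - bergman u"
    have "cinner (fock_incl d) (fock_incl d) = 0"
      using P[rule_format, of u d] bergman_orthogonal[of u d]
      by (simp add: d_def blinfun.diff_right cinner_diff_left)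
    then have "fock_l2 d = fock_l2 0" by (simp add: cinner_self_eq_0 fock_incl_apply zero_fock.rep_eq)
    then show "P u = bergman u" by (simp add: fock_l2_inject d_def)
  qed
qed

lemma fock_incl_proj: "fock_incl o\<^sub>L fock_proj = kernel_op UNIV"
  by (rule blinfun_eqI) (simp add: fock_proj_eq fock_incl_apply fock_l2_bergman)

lemma cinner_fock_incl: "cinner (fock_incl u) (fock_incl v) = cinner u v"
  by (simp add: fock_incl_apply cinner_fock.rep_eq)

lemma cinner_fock_proj: "cinner (fock_proj u) v = cinner u (fock_incl v)"
  using bergman_orthogonal[of u v]
  by (simp add: fock_proj_eq cinner_diff_left cinner_fock_incl)

lemma cinner_fock_proj_right: "cinner v (fock_proj u) = cinner (fock_incl v) u"
  by (metis cinner_commute cinner_fock_proj)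

lemma fock_proj_incl: "fock_proj o\<^sub>L fock_incl = id_blinfun"
  by (intro blinfun_eqI cinner_eqI) (simp add: cinner_fock_proj_right cinner_fock_incl)

lemma fock_incl_scaleC: "fock_incl (scaleC c u) = scaleC c (fock_incl u)"
  by (simp add: fock_incl_apply scaleC_fock.rep_eq)

lemma fock_proj_scaleC: "fock_proj (scaleC c u) = scaleC c (fock_proj u)"
  by (rule cinner_eqI) (simp add: cinner_fock_proj_right cinner_scaleC_right)

lemma compression_in_operators:
  assumes "A \<in> operators" shows "fock_proj o\<^sub>L A o\<^sub>L fock_incl \<in> operators"
  using assms by (simp add: operators_def fock_incl_scaleC fock_proj_scaleC)

section \<open>Band-dominated operators\<close>

lemma closed_ess_support: "closed (ess_support f)"
  unfolding ess_support_def by (intro closed_Compl open_Union) auto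

text \<open>The complement of the essential support is a union of possibly uncountably many open
  sets; the Lindelof property leaves countably many exceptional null sets.\<close>

lemma AE_ess_support: "AE z in gauss. z \<notin> ess_support f \<longrightarrow> f z = 0"
proof -
  let ?U = "{U. open U \<and> (AE z in lborel. z \<in> U \<longrightarrow> f z = 0)}"
  obtain F where F: "F \<subseteq> ?U" "countable F" "\<Union> F = \<Union> ?U"
    using Lindelof[of ?U] by auto
  have "AE z in lborel. \<forall>U\<in>F. z \<in> U \<longrightarrow> f z = 0"
    using F by (subst AE_ball_countable) auto
  then have "AE z in lborel. z \<notin> ess_support f \<longrightarrow> f z = 0"
    unfolding ess_support_def F(3)[symmetric] by eventually_elim auto
  then show ?thesis unfolding AE_gauss_iff .
qed

lemma ess_support_subset:
  assumes "closed S" "AE z in gauss. z \<notin> S \<longrightarrow> f z = 0"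
  shows "ess_support f \<subseteq> S"
  using assms unfolding ess_support_def AE_gauss_iff by (auto intro!: exI[of _ "- S"])

lemma mult_op_eq_0:
  assumes "f \<in> Linf" "AE z in gauss. f z = 0"
  shows "mult_op f = 0"
proof (rule blinfun_eqI)
  fix u :: "'a l2"
  obtain g where g: "sq_integrable g" "u = l2_class g" using l2_cases by metis
  have "l2_class (\<lambda>z. f z * g z) = 0"
    using assms(2) by (subst l2_class_eq_zero_iff) (auto simp: sq_integrable_Linf_mult assms(1) g elim!: eventually_mono)
  then show "mult_op f u = blinfun_apply 0 u"
    by (simp add: g mult_op_class assms(1))
qed

lemma mult_op_empty: "f \<in> Linf \<Longrightarrow> ess_support f = {} \<Longrightarrow> mult_op f = 0"
  using AE_ess_support[of f] by (intro mult_op_eq_0) simp_all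

text \<open>The band condition with arbitrary closed carriers and pointwise distances instead of
  essential supports and \<open>setdist\<close>. Carriers may then be balls or neighbourhoods chosen
  at will, and empty ones form no exception.\<close>

definition separates :: "real \<Rightarrow> ('n::finite l2 \<Rightarrow>\<^sub>L 'n l2) \<Rightarrow> bool" where
  "separates \<omega> A \<longleftrightarrow> (\<forall>f\<in>Linf. \<forall>g\<in>Linf. \<forall>S T. closed S \<longrightarrow> closed T \<longrightarrow>
      (AE z in gauss. z \<notin> S \<longrightarrow> f z = 0) \<longrightarrow> (AE z in gauss. z \<notin> T \<longrightarrow> g z = 0) \<longrightarrow>
      (\<forall>x\<in>S. \<forall>y\<in>T. \<omega> \<le> dist x y) \<longrightarrow> mult_op f o\<^sub>L A o\<^sub>L mult_op g = 0)"

lemma separatesD: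
  assumes "separates \<omega> A" "f \<in> Linf" "g \<in> Linf" "closed S" "closed T"
    "AE z in gauss. z \<notin> S \<longrightarrow> f z = 0" "AE z in gauss. z \<notin> T \<longrightarrow> g z = 0"
    "\<And>x y. x \<in> S \<Longrightarrow> y \<in> T \<Longrightarrow> \<omega> \<le> dist x y"
  shows "mult_op f o\<^sub>L A o\<^sub>L mult_op g = 0"
  using assms unfolding separates_def by blast

lemma band_operator_separates:
  assumes "band_operator A"
  shows "\<exists>\<omega>>0. separates \<omega> A"
proof -
  obtain \<omega> where w: "\<omega> > 0" "\<And>f g. f \<in> Linf \<Longrightarrow> g \<in> Linf \<Longrightarrow> setdist (ess_support f) (ess_support g) > \<omega> \<Longrightarrow>
      mult_op f o\<^sub>L A o\<^sub>L mult_op g = 0"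
    using assms unfolding band_operator_def by blast
  \<comment> \<open>The increment turns the weak inequality between distances into the strict one of
    the band condition.\<close>
  have "separates (\<omega> + 1) A"
    unfolding separates_def
  proof (intro ballI allI impI)
    fix f g :: "complex ^ 'a \<Rightarrow> complex" and S T
    assume fg: "f \<in> Linf" "g \<in> Linf" and cl: "closed S" "closed T"
      and ae: "AE z in gauss. z \<notin> S \<longrightarrow> f z = 0" "AE z in gauss. z \<notin> T \<longrightarrow> g z = 0"
      and d: "\<forall>x\<in>S. \<forall>y\<in>T. \<omega> + 1 \<le> dist x y"
    show "mult_op f o\<^sub>L A o\<^sub>L mult_op g = 0"
    \<comment> \<open>For an empty support \<open>setdist\<close> is 0 and the band condition says
      nothing, but then one of the multiplications is zero.\<close>
    proof (cases "ess_support f = {} \<or> ess_support g = {}")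
      case True
      then have "mult_op f = 0 \<or> mult_op g = 0"
        using fg mult_op_empty by blast
      then show ?thesis by (auto simp: bounded_bilinear.zero_left[OF bounded_bilinear_blinfun_compose]
          bounded_bilinear.zero_right[OF bounded_bilinear_blinfun_compose])
    next
      case False
      have "\<omega> + 1 \<le> setdist (ess_support f) (ess_support g)"
        using False ess_support_subset[OF cl(1) ae(1)] ess_support_subset[OF cl(2) ae(2)] d
        by (intro le_setdistI) auto
      then show ?thesis by (intro w fg) simp
    qed
  qed
  then show ?thesis using w(1) by (intro exI[of _ "\<omega> + 1"]) simp
qed

lemma band_operatorI:
  assumes "A \<in> operators" "\<omega> > 0"
    and "\<And>f g. f \<in> Linf \<Longrightarrow> g \<in> Linf \<Longrightarrow> (\<And>x y. x \<in> ess_support f \<Longrightarrow> y \<in> ess_support g \<Longrightarrow> \<omega> < dist x y)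
      \<Longrightarrow> mult_op f o\<^sub>L A o\<^sub>L mult_op g = 0"
  shows "band_operator A"
  unfolding band_operator_def
proof (intro conjI exI[of _ \<omega>] ballI impI assms)
  fix f g and x y assume "\<omega> < setdist (ess_support f) (ess_support g)" "x \<in> ess_support f" "y \<in> ess_support g"
  then show "\<omega> < dist x y" using setdist_le_dist[of x "ess_support f" y "ess_support g"] by linarith
qed

lemma mult_op_mult:
  assumes "f \<in> Linf" "g \<in> Linf"
  shows "(\<lambda>z. f z * g z) \<in> Linf" "mult_op f o\<^sub>L mult_op g = mult_op (\<lambda>z. f z * g z)"
proof -
  show fg: "(\<lambda>z. f z * g z) \<in> Linf"
  proof -
    obtain C where C: "AE z in lborel. norm (f z) \<le> C" using assms(1) by (auto simp: Linf_def)
    obtain D where D: "AE z in lborel. norm (g z) \<le> D" using assms(2) by (auto simp: Linf_def)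
    have "AE z in lborel. norm (f z * g z) \<le> C * D"
      using C D
    proof eventually_elim
      case (elim z)
      then have "0 \<le> C" using norm_ge_zero order_trans by blast
      then show ?case unfolding norm_mult using elim by (intro mult_mono) auto
    qed
    then show ?thesis using assms by (auto simp: Linf_def)
  qed
  show "mult_op f o\<^sub>L mult_op g = mult_op (\<lambda>z. f z * g z)"
  proof (rule blinfun_eqI)
    fix u :: "'a l2"
    obtain h where h: "sq_integrable h" "u = l2_class h" using l2_cases by metis
    show "(mult_op f o\<^sub>L mult_op g) u = (mult_op (\<lambda>z. f z * g z)) u"
      using assms fg h by (simp add: mult_op_class sq_integrable_Linf_mult mult.assoc)
  qed
qed

lemma band_mult_op:
  assumes f: "f \<in> Linf" shows "band_operator (mult_op f)"
proof (rule band_operatorI[of _ 1])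
  fix g h :: "complex ^ 'a \<Rightarrow> complex"
  assume gh: "g \<in> Linf" "h \<in> Linf"
    and d: "\<And>x y. x \<in> ess_support g \<Longrightarrow> y \<in> ess_support h \<Longrightarrow> 1 < dist x y"
  have "AE z in gauss. g z * f z * h z = 0"
    using AE_ess_support[of g] AE_ess_support[of h]
  proof eventually_elim
    case (elim z)
    then show ?case using d[of z z] by auto
  qed
  then show "mult_op g o\<^sub>L mult_op f o\<^sub>L mult_op h = 0"
    using f gh by (simp add: mult_op_mult mult_op_eq_0)
qed (simp_all add: mult_op_in_operators)

text \<open>For z in the support of f and w in that of g the displacement z - w lies outside the
  ball, where the truncated kernel vanishes.\<close>

lemma band_kernel_op:
  assumes R: "R > 0" shows "band_operator (kernel_op (cball 0 R))"
proof (rule band_operatorI[of _ R])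
  let ?S = "cball 0 R :: (complex ^ 'a) set"
  have S: "?S \<in> sets borel" by simp
  fix f g :: "complex ^ 'a \<Rightarrow> complex"
  assume fg: "f \<in> Linf" "g \<in> Linf"
    and d: "\<And>x y. x \<in> ess_support f \<Longrightarrow> y \<in> ess_support g \<Longrightarrow> R < dist x y"
  show "mult_op f o\<^sub>L kernel_op ?S o\<^sub>L mult_op g = 0"
  proof (rule blinfun_eqI)
    fix u :: "'a l2"
    obtain h where h: "sq_integrable h" "u = l2_class h" using l2_cases by metis
    have gh: "sq_integrable (\<lambda>z. g z * h z)" by (rule sq_integrable_Linf_mult[OF fg(2) h(1)])
    have "f z * opk ?S (\<lambda>z. g z * h z) z = 0" if z: "z \<notin> ess_support f \<longrightarrow> f z = 0" for z
    proof (cases "z \<in> ess_support f")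
      case True
      have "AE w in gauss. g w * h w * (indicator ?S (z - w) * exp (hip z w)) = 0"
        using AE_ess_support[of g]
      proof eventually_elim
        case (elim w)
        then show ?case using d[OF True, of w] by (auto simp: indicator_def dist_norm norm_minus_commute)
      qed
      then have "opk ?S (\<lambda>z. g z * h z) z = 0" unfolding opk_def by (rule integral_eq_zero_AE)
      then show ?thesis by simp
    qed (use z in simp)
    then have "AE z in gauss. f z * opk ?S (\<lambda>z. g z * h z) z = 0"
      using AE_ess_support[of f] by (auto elim!: eventually_mono)
    then have "l2_class (\<lambda>z. f z * opk ?S (\<lambda>z. g z * h z) z) = 0"
      by (subst l2_class_eq_zero_iff) (intro sq_integrable_Linf_mult fg opk_sq gh S)
    then show "(mult_op f o\<^sub>L kernel_op ?S o\<^sub>L mult_op g) u = blinfun_apply 0 u"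
      using fg h by (simp add: mult_op_class gh kernel_op_class opk_sq)
  qed
qed (simp_all add: R kernel_op_in_operators)

lemma indicator_Linf: "S \<in> sets borel \<Longrightarrow> indicator S \<in> Linf"
  unfolding Linf_def by (auto intro!: exI[of _ 1] AE_I2 simp: indicator_def)

lemma mult_op_indicator_compl:
  assumes S: "S \<in> sets borel"
  shows "mult_op (indicator S) + mult_op (indicator (- S)) = id_blinfun"
proof (rule blinfun_eqI)
  fix u :: "'a l2"
  obtain h where h: "sq_integrable h" "u = l2_class h" using l2_cases by metis
  have mS: "- S \<in> sets borel" using S by (rule borel_comp)
  have "(\<lambda>z. indicator S z * h z + indicator (- S) z * h z) = h"
    by (auto simp: indicator_def)
  then show "(mult_op (indicator S) + mult_op (indicator (- S))) u = id_blinfun u"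
    using h indicator_Linf[OF S] indicator_Linf[OF mS]
    by (simp add: blinfun.add_left mult_op_class plus_l2_class sq_integrable_Linf_mult)
qed

text \<open>Band widths add up. The identity is split between the factors by the neighbourhood
  \<open>N\<close> of radius a around the support of f: \<open>A\<close> does not connect the
  outside of \<open>N\<close> with this support, and \<open>B\<close> does not connect the support
  of g with \<open>N\<close>.\<close>

lemma band_compose:
  assumes A: "band_operator A" and B: "band_operator B"
  shows "band_operator (A o\<^sub>L B)"
proof -
  obtain a where a: "a > 0" "separates a A" using band_operator_separates[OF A] by blast
  obtain b where b: "b > 0" "separates b B" using band_operator_separates[OF B] by blast
  show ?thesis
  proof (rule band_operatorI[of _ "a + b"])
    show "A o\<^sub>L B \<in> operators" using A B by (simp add: band_operator_def operators_def)
    show "0 < a + b" using a b by simp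
    fix f g :: "complex ^ 'a \<Rightarrow> complex"
    assume fg: "f \<in> Linf" "g \<in> Linf"
      and d: "\<And>x y. x \<in> ess_support f \<Longrightarrow> y \<in> ess_support g \<Longrightarrow> a + b < dist x y"
    show "mult_op f o\<^sub>L (A o\<^sub>L B) o\<^sub>L mult_op g = 0"
    \<comment> \<open>\<open>infdist\<close> to the empty set is 0 by convention, so
      \<open>N\<close> would be meaningless there.\<close>
    proof (cases "ess_support f = {}")
      case True
      then have "mult_op f = 0" using fg by (intro mult_op_empty)
      then show ?thesis by (intro blinfun_eqI) simp
    next
      case False
      define S where "S = ess_support f"
      define N where "N = {x. infdist x S < a}"
      have "open N" unfolding N_def by (intro open_Collect_less continuous_intros)
      then have N: "N \<in> sets borel" "- N \<in> sets borel" by auto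
      have 1: "mult_op f o\<^sub>L A o\<^sub>L mult_op (indicator (- N)) = 0"
      proof (rule separatesD[OF a(2), where S = S and T = "- N"])
        show "a \<le> dist x y" if "x \<in> S" "y \<in> - N" for x y
          using that infdist_le[of x S y] by (auto simp: N_def dist_commute)
      qed (use fg N AE_ess_support[of f] closed_ess_support \<open>open N\<close>
          in \<open>auto simp: S_def intro: indicator_Linf\<close>)
      have 2: "mult_op (indicator N) o\<^sub>L B o\<^sub>L mult_op g = 0"
      \<comment> \<open>Carriers must be closed, so the open set \<open>N\<close> is enclosed in the
        closed neighbourhood of the same radius, which is still at distance b from the support of
        g.\<close>
      proof (rule separatesD[OF b(2), where S = "{x. infdist x S \<le> a}" and T = "ess_support g"])
        show "closed {x. infdist x S \<le> a}" by (intro closed_Collect_le continuous_intros)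
        show "b \<le> dist x y" if x: "x \<in> {x. infdist x S \<le> a}" and y: "y \<in> ess_support g" for x y
        proof -
          have "a + b \<le> infdist y S"
            using False d[OF _ y] unfolding infdist_def S_def
            by (auto intro!: cINF_greatest simp: dist_commute less_imp_le)
          also have "\<dots> \<le> infdist x S + dist y x" by (rule infdist_triangle)
          finally show ?thesis using x by (simp add: dist_commute)
        qed
      qed (use fg N AE_ess_support[of g] closed_ess_support in \<open>auto simp: N_def intro: indicator_Linf\<close>)
      have "mult_op f o\<^sub>L (A o\<^sub>L B) o\<^sub>L mult_op g
          = mult_op f o\<^sub>L A o\<^sub>L (mult_op (indicator N) + mult_op (indicator (- N))) o\<^sub>L B o\<^sub>L mult_op g"
        unfolding mult_op_indicator_compl[OF N(1)] by (intro blinfun_eqI) simp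
      also have "\<dots> = (mult_op f o\<^sub>L A o\<^sub>L (mult_op (indicator N) o\<^sub>L B o\<^sub>L mult_op g))
          + ((mult_op f o\<^sub>L A o\<^sub>L mult_op (indicator (- N))) o\<^sub>L B o\<^sub>L mult_op g)"
        by (intro blinfun_eqI) (simp add: blinfun.add_left blinfun.add_right)
      also have "\<dots> = 0" unfolding 1 2 by (intro blinfun_eqI) simp
      finally show ?thesis .
    qed
  qed
qed

lemma band_in_BDO: "band_operator A \<Longrightarrow> A \<in> BDO"
  unfolding BDO_def using closure_subset by blast

lemma closed_BDO: "closed BDO"
  unfolding BDO_def by simp

lemma BDO_compose:
  assumes "A \<in> BDO" "B \<in> BDO" shows "A o\<^sub>L B \<in> BDO"
proof -
  obtain a where a: "\<And>n. band_operator (a n)" "a \<longlonglongrightarrow> A"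
    using assms(1) unfolding BDO_def closure_sequential by auto
  obtain b where b: "\<And>n. band_operator (b n)" "b \<longlonglongrightarrow> B"
    using assms(2) unfolding BDO_def closure_sequential by auto
  have "(\<lambda>n. a n o\<^sub>L b n) \<longlonglongrightarrow> (A o\<^sub>L B)"
    by (rule bounded_bilinear.tendsto[OF bounded_bilinear_blinfun_compose a(2) b(2)])
  then show ?thesis unfolding BDO_def closure_sequential
    using band_compose[OF a(1) b(1)] by (intro exI[of _ "\<lambda>n. a n o\<^sub>L b n"]) simp
qed

text \<open>Half of the exponent gives the decay in R, the other half keeps the integral finite; the
  factor 1 / pi^n is at most 1 and is dropped.\<close>

lemma mass_outside_ball_le:
  assumes R: "R \<ge> 0"
  shows "mass (- cball 0 R :: (complex ^ 'n::finite) set)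
    \<le> exp (- R\<^sup>2 / 4) * (\<integral>x. exp (- (1 / 4) * (norm (x :: complex ^ 'n))\<^sup>2) \<partial>lborel)"
proof -
  have "mass (- cball 0 R :: (complex ^ 'n) set)
      \<le> (\<integral>x. exp (- R\<^sup>2 / 4) * exp (- (1 / 4) * (norm (x :: complex ^ 'n))\<^sup>2) \<partial>lborel)"
    unfolding mass_def
  proof (rule integral_mono)
    show "integrable lborel (\<lambda>x::complex ^ 'n. indicator (- cball 0 R) x * exp (- (1 / 2) * (norm x)\<^sup>2) / pi ^ CARD('n))"
      by (rule integrable_mass) (auto intro: borel_comp)
    show "integrable lborel (\<lambda>x::complex ^ 'n. exp (- R\<^sup>2 / 4) * exp (- (1 / 4) * (norm x)\<^sup>2))"
      by (intro integrable_mult_right integrable_gaussian) simp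
    fix x :: "complex ^ 'n"
    have p: "1 \<le> pi ^ CARD('n)" using pi_ge_two by (intro one_le_power) simp
    show "indicator (- cball 0 R) x * exp (- (1 / 2) * (norm x)\<^sup>2) / pi ^ CARD('n)
        \<le> exp (- R\<^sup>2 / 4) * exp (- (1 / 4) * (norm x)\<^sup>2)"
    proof (cases "norm x \<le> R")
      case False
      then have "R\<^sup>2 \<le> (norm x)\<^sup>2" using R by (intro power_mono) auto
      then have "exp (- (1 / 2) * (norm x)\<^sup>2) \<le> exp (- R\<^sup>2 / 4) * exp (- (1 / 4) * (norm x)\<^sup>2)"
        by (simp add: exp_add[symmetric])
      moreover have "exp (- (1 / 2) * (norm x)\<^sup>2) / pi ^ CARD('n) \<le> exp (- (1 / 2) * (norm x)\<^sup>2)"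
        using p by (simp add: divide_le_eq mult_le_cancel_left1)
      ultimately show ?thesis by (simp add: indicator_def)
    qed (simp add: indicator_def)
  qed
  then show ?thesis by simp
qed

lemma kernel_op_in_BDO: "(kernel_op UNIV :: 'n::finite l2 \<Rightarrow>\<^sub>L 'n l2) \<in> BDO"
proof -
  define C where "C = (\<integral>x. exp (- (1 / 4) * (norm (x :: complex ^ 'n))\<^sup>2) \<partial>lborel)"
  \<comment> \<open>The successor keeps the radii positive, as \<open>band_kernel_op\<close>
    demands.\<close>
  define K where "K n = (kernel_op (cball 0 (real (Suc n))) :: 'n l2 \<Rightarrow>\<^sub>L 'n l2)" for n
  have diff: "norm (K n - kernel_op UNIV) \<le> exp (- (real (Suc n))\<^sup>2 / 4) * C" for n
  proof -
    have "norm (K n - kernel_op UNIV) = norm (kernel_op (- cball 0 (real (Suc n))) :: 'n l2 \<Rightarrow>\<^sub>L 'n l2)"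
      by (simp add: K_def kernel_op_compl[of "cball 0 (real (Suc n))"])
    also have "\<dots> \<le> mass (- cball 0 (real (Suc n)) :: (complex ^ 'n) set)"
      by (rule norm_kernel_op_le) (auto intro: borel_comp)
    also have "\<dots> \<le> exp (- (real (Suc n))\<^sup>2 / 4) * C"
      unfolding C_def by (rule mass_outside_ball_le) simp
    finally show ?thesis .
  qed
  have "((\<lambda>x::real. exp (- x\<^sup>2 / 4) * C) \<longlongrightarrow> 0) at_top" by real_asymp
  then have "(\<lambda>n. exp (- (real (Suc n))\<^sup>2 / 4) * C) \<longlonglongrightarrow> 0"
    by (rule filterlim_compose) (rule filterlim_compose[OF filterlim_real_sequentially filterlim_Suc])
  then have "(\<lambda>n. K n - kernel_op UNIV) \<longlonglongrightarrow> 0"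
    by (rule Lim_null_comparison[rotated]) (rule always_eventually, rule allI, rule diff)
  then have "K \<longlonglongrightarrow> kernel_op UNIV" by (rule LIM_zero_cancel)
  moreover have "K n \<in> BDO" for n unfolding K_def by (intro band_in_BDO band_kernel_op) simp
  ultimately show ?thesis using closed_BDO unfolding closed_sequential_limits by blast
qed

section \<open>Off-diagonal decay for band operators\<close>

lemma norm_mult_indicator_le:
  assumes S: "S \<in> sets borel"
  shows "norm ((mult_op (indicator S)) u) \<le> norm u"
proof (rule l2_cases[of u])
  fix h assume h: "sq_integrable h" "u = l2_class h"
  have sq: "sq_integrable (\<lambda>z. indicator S z * h z)" by (rule sq_integrable_Linf_mult[OF indicator_Linf[OF S] h(1)])
  have "(norm ((mult_op (indicator S)) u))\<^sup>2 = (\<integral>z. (norm (indicator S z * h z))\<^sup>2 \<partial>gauss)"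
    by (simp add: h mult_op_class indicator_Linf S norm_l2_class_sq sq)
  also have "\<dots> \<le> (\<integral>z. (norm (h z))\<^sup>2 \<partial>gauss)"
    using h sq by (intro integral_mono) (auto simp: sq_integrable_def indicator_def)
  also have "\<dots> = (norm u)\<^sup>2" by (simp add: h norm_l2_class_sq)
  finally show ?thesis by (rule power2_le_imp_le) simp
qed

lemma cinner_mult_indicator:
  assumes S: "S \<in> sets borel"
  shows "cinner ((mult_op (indicator S)) u) v = cinner u ((mult_op (indicator S)) v)"
proof -
  obtain f where f: "sq_integrable f" "u = l2_class f" using l2_cases by metis
  obtain g where g: "sq_integrable g" "v = l2_class g" using l2_cases by metis
  have [simp]: "cnj (indicator S z) = indicator S z" for z by (simp add: indicator_def)
  show ?thesis
    by (simp add: f g mult_op_class indicator_Linf S cinner_l2_class sq_integrable_Linf_mult)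
      (simp add: mult_ac)
qed

text \<open>Against the Gaussian weight, |kern w|^2 is exp(|w|^2) times a Gaussian centred at w. Its
  exponent is halved to match \<open>mass\<close>, and the square root of the tail bound exp(-r^2/4)
  gives exp(-r^2/8).\<close>

lemma norm_kern_tail_le:
  fixes w :: "complex ^ 'n::finite"
  assumes r: "r \<ge> 0"
  shows "norm ((mult_op (indicator (- cball w r))) (l2_class (kern w)))
    \<le> exp ((norm w)\<^sup>2 / 2) * (sqrt (\<integral>x. exp (- (1 / 4) * (norm (x :: complex ^ 'n))\<^sup>2) \<partial>lborel) * exp (- r\<^sup>2 / 8))"
proof -
  define c where "c = (\<integral>x. exp (- (1 / 4) * (norm (x :: complex ^ 'n))\<^sup>2) \<partial>lborel)"
  have c: "c \<ge> 0" unfolding c_def by (rule Bochner_Integration.integral_nonneg) simp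
  let ?S = "- cball w r"
  have S [measurable]: "?S \<in> sets borel" by (intro borel_comp) simp
  have B [measurable]: "(- cball 0 r :: (complex ^ 'n) set) \<in> sets borel" by (intro borel_comp) simp
  have sq: "sq_integrable (\<lambda>z. indicator ?S z * kern w z)"
    by (rule sq_integrable_Linf_mult[OF indicator_Linf[OF S] sq_integrable_kern])
  define N where "N = norm ((mult_op (indicator ?S)) (l2_class (kern w)))"
  have "ennreal (N\<^sup>2) = ennreal (\<integral>z. (norm (indicator ?S z * kern w z))\<^sup>2 \<partial>gauss)"
    by (simp add: N_def mult_op_class indicator_Linf S sq_integrable_kern norm_l2_class_sq sq)
  also have "\<dots> = (\<integral>\<^sup>+z. ennreal ((norm (indicator ?S z * kern w z))\<^sup>2) \<partial>gauss)"
    using sq by (intro nn_integral_eq_integral[symmetric]) (auto simp: sq_integrable_def)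
  also have "\<dots> = (\<integral>\<^sup>+z. ennreal (gdens z) * ennreal ((norm (indicator ?S z * kern w z))\<^sup>2) \<partial>lborel)"
    by (rule nn_integral_gauss) measurable
  also have "\<dots> \<le> (\<integral>\<^sup>+z. ennreal (exp ((norm w)\<^sup>2)) *
      ennreal (indicator (- cball 0 r) (z + - w) * exp (- (1 / 2) * (norm (z + - w))\<^sup>2) / pi ^ CARD('n)) \<partial>lborel)"
  proof (rule nn_integral_mono)
    fix z :: "complex ^ 'n"
    have n: "(norm (z + - w))\<^sup>2 = (norm z)\<^sup>2 + (norm w)\<^sup>2 - 2 * (z \<bullet> w)"
      by (simp add: power2_norm_eq_inner inner_diff_left inner_diff_right inner_commute)
    have "(norm (kern w z))\<^sup>2 = exp (2 * (z \<bullet> w))"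
      unfolding kern_def norm_exp_hip exp_double[symmetric] ..
    then have "exp (- (norm z)\<^sup>2) * (norm (kern w z))\<^sup>2 = exp (- (norm z)\<^sup>2 + 2 * (z \<bullet> w))"
      by (simp only: exp_add)
    also have "\<dots> \<le> exp ((norm w)\<^sup>2 + - (1 / 2) * (norm (z + - w))\<^sup>2)"
    proof -
      have "- (norm z)\<^sup>2 + 2 * (z \<bullet> w) \<le> (norm w)\<^sup>2 + - (1 / 2) * (norm (z + - w))\<^sup>2"
        using n zero_le_power2[of "norm (z + - w)"] by linarith
      then show ?thesis by (simp only: exp_le_cancel_iff)
    qed
    also have "\<dots> = exp ((norm w)\<^sup>2) * exp (- (1 / 2) * (norm (z + - w))\<^sup>2)" by (rule exp_add)
    finally have "exp (- (norm z)\<^sup>2) * (norm (kern w z))\<^sup>2 \<le> exp ((norm w)\<^sup>2) * exp (- (1 / 2) * (norm (z + - w))\<^sup>2)" .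
    then have "gdens z * (norm (indicator ?S z * kern w z))\<^sup>2
        \<le> exp ((norm w)\<^sup>2) * (indicator (- cball 0 r) (z + - w) * exp (- (1 / 2) * (norm (z + - w))\<^sup>2) / pi ^ CARD('n))"
      by (auto simp: indicator_def dist_norm norm_minus_commute divide_right_mono)
    then show "ennreal (gdens z) * ennreal ((norm (indicator ?S z * kern w z))\<^sup>2) \<le> ennreal (exp ((norm w)\<^sup>2)) *
      ennreal (indicator (- cball 0 r) (z + - w) * exp (- (1 / 2) * (norm (z + - w))\<^sup>2) / pi ^ CARD('n))"
      by (simp only: ennreal_mult'[symmetric] ennreal_leI exp_ge_zero divide_nonneg_nonneg zero_le_power pi_ge_zero)
  qed
  also have "\<dots> = ennreal (exp ((norm w)\<^sup>2)) *
      (\<integral>\<^sup>+z. ennreal (indicator (- cball 0 r) (z + - w) * exp (- (1 / 2) * (norm (z + - w))\<^sup>2) / pi ^ CARD('n)) \<partial>lborel)"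
    by (rule nn_integral_cmult) measurable
  also have "(\<integral>\<^sup>+z. ennreal (indicator (- cball 0 r) (z + - w) * exp (- (1 / 2) * (norm (z + - w))\<^sup>2) / pi ^ CARD('n)) \<partial>lborel)
      = ennreal (mass (- cball 0 r :: (complex ^ 'n) set))"
    unfolding nn_integral_mass[OF B, symmetric]
    by (rule nn_integral_lborel_shift[of "\<lambda>x. ennreal (indicator (- cball 0 r) x * exp (- (1 / 2) * (norm x)\<^sup>2) / pi ^ CARD('n))" "- w"]) measurable
  finally have "ennreal (N\<^sup>2) \<le> ennreal (exp ((norm w)\<^sup>2) * mass (- cball 0 r :: (complex ^ 'n) set))"
    by (simp add: ennreal_mult')
  then have "N\<^sup>2 \<le> exp ((norm w)\<^sup>2) * mass (- cball 0 r :: (complex ^ 'n) set)"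
    by (rule iffD1[OF ennreal_le_iff, rotated]) (simp add: mass_nonneg)
  also have "\<dots> \<le> exp ((norm w)\<^sup>2) * (exp (- r\<^sup>2 / 4) * c)"
    unfolding c_def by (intro mult_left_mono mass_outside_ball_le r) simp
  also have "\<dots> = (exp ((norm w)\<^sup>2 / 2))\<^sup>2 * ((sqrt c)\<^sup>2 * (exp (- r\<^sup>2 / 8))\<^sup>2)"
    unfolding exp_double[symmetric] using c by simp
  also have "\<dots> = (exp ((norm w)\<^sup>2 / 2) * (sqrt c * exp (- r\<^sup>2 / 8)))\<^sup>2"
    by (simp only: power_mult_distrib)
  finally show ?thesis
    unfolding N_def c_def by (rule power2_le_imp_le) (use c in \<open>simp add: c_def\<close>)
qed

text \<open>Cut the two kernels to balls of radius (D - a)/2 around w and z, where D = |z - w|.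
  These balls are at distance at least a, so the truncated kernels have matrix element 0, and only
  the Gaussian tails contribute.\<close>

lemma band_operator_decay:
  fixes A :: "'n::finite l2 \<Rightarrow>\<^sub>L 'n l2"
  assumes A: "band_operator A"
  obtains K where "K \<ge> 0"
    "\<And>z w. norm (cinner (A (l2_class (kern w))) (l2_class (kern z)))
      \<le> K * exp (- (1 / 64) * (norm (z - w))\<^sup>2) * (exp ((norm w)\<^sup>2 / 2) * exp ((norm z)\<^sup>2 / 2))"
proof -
  obtain a where a: "a > 0" "separates a A" using band_operator_separates[OF A] by blast
  define c where "c = sqrt (\<integral>x. exp (- (1 / 4) * (norm (x :: complex ^ 'n))\<^sup>2) \<partial>lborel)"
  have c: "c \<ge> 0" unfolding c_def by (intro real_sqrt_ge_zero Bochner_Integration.integral_nonneg) simp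
  \<comment> \<open>The term 2 c accounts for the two tails and the 1 for the range D \<le> a. The
    factor exp(a^2/32) pays for replacing the radius by D: -r^2/8 \<le> a^2/32 - D^2/64 amounts to
    (D - 2 a)^2 \<ge> 0.\<close>
  define K where "K = norm A * (2 * c + 1) * exp (a\<^sup>2 / 32)"
  have K: "K \<ge> 0" using c by (simp add: K_def)
  have nk: "norm (l2_class (kern w) :: 'n l2) = exp ((norm w)\<^sup>2 / 2)" for w
    using norm_kfock[of w] by (simp add: norm_fock.rep_eq kfock.rep_eq)
  have "norm (cinner (A (l2_class (kern w))) (l2_class (kern z)))
      \<le> K * exp (- (1 / 64) * (norm (z - w))\<^sup>2) * (exp ((norm w)\<^sup>2 / 2) * exp ((norm z)\<^sup>2 / 2))" for z w :: "complex ^ 'n"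
  proof -
    define D where "D = norm (z - w)"
    define u where "u = (l2_class (kern w) :: 'n l2)"
    define v where "v = (l2_class (kern z) :: 'n l2)"
    define E where "E = norm u * norm v"
    have E: "E \<ge> 0" by (simp add: E_def)
    have main: "norm (cinner (A u) v) \<le> K * exp (- (1 / 64) * D\<^sup>2) * E"
    proof (cases "D \<le> a")
      case True
      have "norm (cinner (A u) v) \<le> norm (A u) * norm v" by (rule norm_cinner_le)
      also have "\<dots> \<le> (norm A * norm u) * norm v" by (intro mult_right_mono norm_blinfun) simp
      also have "\<dots> = norm A * 1 * E" by (simp add: E_def)
      also have "\<dots> \<le> norm A * (exp (a\<^sup>2 / 32) * exp (- (1 / 64) * D\<^sup>2)) * E"
      proof (intro mult_right_mono mult_left_mono E)
        have "D\<^sup>2 \<le> a\<^sup>2" using True by (intro power_mono) (auto simp: D_def)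
        then have "0 \<le> a\<^sup>2 / 32 + - (1 / 64) * D\<^sup>2" using zero_le_power2[of a] by linarith
        then show "1 \<le> exp (a\<^sup>2 / 32) * exp (- (1 / 64) * D\<^sup>2)" unfolding exp_add[symmetric] by simp
      qed simp
      also have "\<dots> \<le> K * exp (- (1 / 64) * D\<^sup>2) * E"
      proof -
        have "norm A * 1 \<le> norm A * (2 * c + 1)" using c by (intro mult_left_mono) auto
        then have "norm A * exp (a\<^sup>2 / 32) \<le> K" unfolding K_def by (intro mult_right_mono) auto
        then show ?thesis using E by (simp only: mult.assoc[symmetric]) (intro mult_right_mono; simp)
      qed
      finally show ?thesis .
    next
      case False
      define r where "r = (D - a) / 2"
      have r: "r \<ge> 0" using False by (simp add: r_def)
      define P where "P x = (mult_op (indicator (cball w r))) x" for x :: "'n l2"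
      define P' where "P' x = (mult_op (indicator (- cball w r))) x" for x :: "'n l2"
      define Q where "Q x = (mult_op (indicator (cball z r))) x" for x :: "'n l2"
      define Q' where "Q' x = (mult_op (indicator (- cball z r))) x" for x :: "'n l2"
      have S: "cball y r \<in> sets borel" "- cball y r \<in> sets borel" for y :: "complex ^ 'n"
        by (auto intro: borel_comp)
      have Pu: "u = P u + P' u"
        using arg_cong[OF mult_op_indicator_compl[OF S(1)[of w]], of "\<lambda>T. blinfun_apply T u"]
        by (simp add: P_def P'_def blinfun.add_left)
      have Qv: "v = Q v + Q' v"
        using arg_cong[OF mult_op_indicator_compl[OF S(1)[of z]], of "\<lambda>T. blinfun_apply T v"]
        by (simp add: Q_def Q'_def blinfun.add_left)
      have "mult_op (indicator (cball z r)) o\<^sub>L A o\<^sub>L mult_op (indicator (cball w r)) = 0"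
      proof (rule separatesD[OF a(2), where S = "cball z r" and T = "cball w r"])
        fix x y assume "x \<in> cball z r" "y \<in> cball w r"
        then have "dist z w \<le> r + dist x y + r"
          using dist_triangle[of z w x] dist_triangle[of x w y] by (simp add: dist_commute)
        then show "a \<le> dist x y" by (simp add: r_def D_def dist_norm field_simps)
      qed (auto intro!: indicator_Linf simp: indicator_def)
      then have 0: "Q (A (P u)) = 0"
        unfolding P_def Q_def by (metis blinfun_apply_blinfun_compose blinfun.zero_left)
      have 1: "cinner (A (P u)) (Q v) = 0"
        using 0 unfolding Q_def by (simp add: cinner_mult_indicator[OF S(1), symmetric])
      \<comment> \<open>Only the term with the truncated kernel \<open>P u\<close> needs the
        splitting of v; in the other term the tail \<open>P' u\<close> is small already.\<close>
      have "cinner (A u) v = cinner (A (P u)) v + cinner (A (P' u)) v"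
        by (subst Pu) (simp add: blinfun.add_right cinner_add_left)
      also have "cinner (A (P u)) v = cinner (A (P u)) (Q' v)"
        by (subst Qv) (simp add: cinner_add_right 1)
      finally have split: "cinner (A u) v
          = cinner (A (P u)) (Q' v) + cinner (A (P' u)) v" .
      define t where "t = c * exp (- r\<^sup>2 / 8)"
      have P't: "norm (P' u) \<le> norm u * t" and Q't: "norm (Q' v) \<le> norm v * t"
        using norm_kern_tail_le[OF r, of w] norm_kern_tail_le[OF r, of z]
        by (simp_all add: P'_def Q'_def u_def v_def t_def c_def nk)
      have Ple: "norm (P u) \<le> norm u" unfolding P_def by (rule norm_mult_indicator_le[OF S(1)])
      have "norm (cinner (A (P u)) (Q' v)) \<le> (norm A * norm u) * (norm v * t)"
        by (intro order.trans[OF norm_cinner_le] mult_mono Q't order.trans[OF norm_blinfun] mult_left_mono Ple) auto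
      moreover have "norm (cinner (A (P' u)) v) \<le> (norm A * (norm u * t)) * norm v"
        by (intro order.trans[OF norm_cinner_le] mult_right_mono order.trans[OF norm_blinfun] mult_left_mono P't) auto
      ultimately have "norm (cinner (A u) v) \<le> (norm A * norm u) * (norm v * t) + (norm A * (norm u * t)) * norm v"
        unfolding split by (rule norm_triangle_mono)
      also have "\<dots> = norm A * (2 * c) * exp (- r\<^sup>2 / 8) * E" by (simp add: E_def t_def)
      also have "\<dots> \<le> norm A * (2 * c + 1) * (exp (a\<^sup>2 / 32) * exp (- (1 / 64) * D\<^sup>2)) * E"
      proof (intro mult_right_mono mult_mono E)
        have "0 \<le> (D - 2 * a)\<^sup>2" by simp
        then have "- r\<^sup>2 / 8 \<le> a\<^sup>2 / 32 + - (1 / 64) * D\<^sup>2"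
          by (simp add: r_def power2_eq_square field_simps)
        then show "exp (- r\<^sup>2 / 8) \<le> exp (a\<^sup>2 / 32) * exp (- (1 / 64) * D\<^sup>2)"
          unfolding exp_add[symmetric] by simp
      qed (use c in auto)
      also have "\<dots> = K * exp (- (1 / 64) * D\<^sup>2) * E" by (simp add: K_def)
      finally show ?thesis .
    qed
    then show ?thesis unfolding u_def v_def D_def E_def nk .
  qed
  then show ?thesis using K by (rule that[rotated])
qed

section \<open>The integral representation of an operator on the Fock space\<close>

text \<open>The map \<open>hat\<close> is the unitary from \<open>L\<^sup>2\<close> of the Gaussian measure to \<open>L\<^sup>2\<close> of Lebesgue measure, and
  \<open>symb C z w\<close> is, up to the normalisation of Lebesgue measure, the matrix element of \<open>C\<close> between the
  normalised kernels at \<open>w\<close> and \<open>z\<close>.\<close>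

definition hat :: "(complex ^ 'n::finite \<Rightarrow> complex) \<Rightarrow> complex ^ 'n \<Rightarrow> complex" where
  "hat f z = complex_of_real (exp (- (norm z)\<^sup>2 / 2) / sqrt (pi ^ CARD('n))) * f z"

lemma hat_measurable [measurable]:
  assumes [measurable]: "f \<in> borel_measurable borel" shows "hat f \<in> borel_measurable borel"
  unfolding hat_def[abs_def] by measurable

lemma hat_mult_cnj_hat: "hat f z * cnj (hat g z) = gdens z *\<^sub>R (f z * cnj (g z))"
proof -
  define s where "s = exp (- (norm z)\<^sup>2 / 2) / sqrt (pi ^ CARD('a))"
  have "hat f z * cnj (hat g z) = complex_of_real (s\<^sup>2) * (f z * cnj (g z))"
    unfolding hat_def unfolding s_def[symmetric] complex_cnj_mult complex_cnj_complex_of_real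
    unfolding power2_eq_square of_real_mult
    by (simp only: mult_ac)
  also have "s\<^sup>2 = gdens z"
    by (simp add: s_def power_divide exp_double[symmetric])
  finally show ?thesis by (simp only: scaleR_conv_of_real)
qed

lemma norm_hat_sq: "(norm (hat f z))\<^sup>2 = gdens z * (norm (f z))\<^sup>2"
proof -
  have "complex_of_real ((norm (hat f z))\<^sup>2) = complex_of_real (gdens z * (norm (f z))\<^sup>2)"
    using hat_mult_cnj_hat[of f z f] by (simp only: complex_norm_square scaleR_conv_of_real of_real_mult)
  then show ?thesis by (simp only: of_real_eq_iff)
qed

lemma integrable_hat_sq: "integrable lborel (\<lambda>z. (norm (hat (ev u) z))\<^sup>2)"
  and integral_hat_sq: "(\<integral>z. (norm (hat (ev u) z))\<^sup>2 \<partial>lborel) = (norm u)\<^sup>2"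
proof -
  note [measurable] = sq_integrable_borel[OF sq_integrable_ev[of u]]
  have "integrable gauss (\<lambda>z. (norm (ev u z))\<^sup>2)" using sq_integrable_ev[of u] by (simp add: sq_integrable_def)
  then show "integrable lborel (\<lambda>z. (norm (hat (ev u) z))\<^sup>2)"
    unfolding norm_hat_sq gauss_def by (subst (asm) integrable_density) auto
  show "(\<integral>z. (norm (hat (ev u) z))\<^sup>2 \<partial>lborel) = (norm u)\<^sup>2"
    unfolding norm_hat_sq norm_fock_ev gauss_def by (subst integral_density) auto
qed

lemma nn_integral_hat_sq: "(\<integral>\<^sup>+z. ennreal ((norm (hat (ev u) z))\<^sup>2) \<partial>lborel) = ennreal ((norm u)\<^sup>2)"
  unfolding integral_hat_sq[symmetric] by (rule nn_integral_eq_integral[OF integrable_hat_sq]) simp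

lemma ev_borel [measurable]: "ev u \<in> borel_measurable borel"
  by (rule sq_integrable_borel[OF sq_integrable_ev])

lemma cinner_toeplitz:
  assumes F: "F \<in> Linf"
  shows "cinner (toeplitz F u) v = (\<integral>z. F z * (hat (ev u) z * cnj (hat (ev v) z)) \<partial>lborel)"
proof -
  have [measurable]: "F \<in> borel_measurable borel" using F by (simp add: Linf_def)
  have "cinner (toeplitz F u) v = cinner (mult_op F (fock_l2 u)) (fock_l2 v)"
    by (simp add: toeplitz_def cinner_fock_proj fock_incl_apply)
  also have "\<dots> = (\<integral>z. F z * ev u z * cnj (ev v z) \<partial>gauss)"
    unfolding l2_class_ev[symmetric]
    by (simp add: mult_op_class F sq_integrable_ev cinner_l2_class sq_integrable_Linf_mult)
  also have "\<dots> = (\<integral>z. gdens z *\<^sub>R (F z * ev u z * cnj (ev v z)) \<partial>lborel)"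
    by (rule integral_gauss) measurable
  also have "\<dots> = (\<integral>z. F z * (hat (ev u) z * cnj (hat (ev v) z)) \<partial>lborel)"
    unfolding hat_mult_cnj_hat by (simp add: scaleR_conv_of_real mult_ac)
  finally show ?thesis .
qed

definition symb :: "('n::finite fock \<Rightarrow>\<^sub>L 'n fock) \<Rightarrow> complex ^ 'n \<Rightarrow> complex ^ 'n \<Rightarrow> complex" where
  "symb C z w = cinner (C (kfock w)) (kfock z) *
     complex_of_real (exp (- (norm z)\<^sup>2 / 2) * exp (- (norm w)\<^sup>2 / 2) / pi ^ CARD('n))"

lemma continuous_on_symb: "continuous_on UNIV (\<lambda>p. symb C (fst p) (snd p))"
proof -
  have k: "continuous_on UNIV (\<lambda>p. kfock (f p))" if "continuous_on UNIV f"
    for f :: "(complex ^ 'a) \<times> (complex ^ 'a) \<Rightarrow> complex ^ 'a"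
    by (rule continuous_on_compose2[OF continuous_on_kfock that]) auto
  show ?thesis
    unfolding symb_def
    by (intro continuous_on_mult bounded_bilinear.continuous_on[OF bounded_bilinear_cinner]
        bounded_linear.continuous_on[OF blinfun.bounded_linear_right] k continuous_intros) auto
qed

lemma symb_measurable [measurable]:
  assumes [measurable]: "f \<in> borel_measurable M" "g \<in> borel_measurable M"
  shows "(\<lambda>x. symb C (f x) (g x)) \<in> borel_measurable M"
proof -
  have [measurable]: "(\<lambda>p. symb C (fst p) (snd p)) \<in> borel_measurable (borel \<Otimes>\<^sub>M borel)"
    unfolding borel_prod by (rule borel_measurable_continuous_onI[OF continuous_on_symb])
  have "(\<lambda>x. symb C (fst (f x, g x)) (snd (f x, g x))) \<in> borel_measurable M"
    by (rule measurable_compose[where f = "\<lambda>x. (f x, g x)" and N = "borel \<Otimes>\<^sub>M borel"]) measurable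
  then show ?thesis by simp
qed

text \<open>The value of \<open>C u\<close> at z is the pairing of u with the adjoint of
  \<open>C\<close> applied to the kernel at z. Written as an integral over w, this pairing contains
  the matrix element of \<open>C\<close> between the kernels at w and z.\<close>

lemma cinner_symb:
  assumes C: "C \<in> operators"
  shows "cinner (C u) v
    = (\<integral>z. (\<integral>w. symb C z w * (hat (ev u) w * cnj (hat (ev v) z)) \<partial>lborel) \<partial>lborel)"
proof -
  have adj: "cinner (C x) y = cinner x (hadjoint C y)" for x y
    using adjoint_exists[OF C] by (simp add: is_adjoint_def)
  have 1: "ev (C u) z = (\<integral>w. ev u w * cinner (C (kfock w)) (kfock z) \<partial>gauss)" for z
  proof -
    have "ev (C u) z = cinner u (hadjoint C (kfock z))" by (simp add: ev_def adj)
    also have "\<dots> = (\<integral>w. ev u w * cnj (cinner (hadjoint C (kfock z)) (kfock w)) \<partial>gauss)"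
      using cinner_fock_ev[of u "hadjoint C (kfock z)"] by (simp add: ev_def)
    also have "\<dots> = (\<integral>w. ev u w * cinner (C (kfock w)) (kfock z) \<partial>gauss)"
    proof -
      have "cnj (cinner (hadjoint C (kfock z)) (kfock w)) = cinner (C (kfock w)) (kfock z)" for w
        by (metis adj cinner_commute)
      then show ?thesis by simp
    qed
    finally show ?thesis .
  qed
  have meas: "(\<lambda>w. cinner (C (kfock w)) (kfock z)) \<in> borel_measurable borel" for z
    by (intro borel_measurable_continuous_onI bounded_bilinear.continuous_on[OF bounded_bilinear_cinner]
        bounded_linear.continuous_on[OF blinfun.bounded_linear_right] continuous_on_kfock continuous_on_const)
  note [measurable] = meas
  have "cinner (C u) v = (\<integral>z. ev (C u) z * cnj (ev v z) \<partial>gauss)"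
    by (rule cinner_fock_ev)
  also have "\<dots> = (\<integral>z. gdens z *\<^sub>R (ev (C u) z * cnj (ev v z)) \<partial>lborel)"
    by (rule integral_gauss) measurable
  also have "\<dots> = (\<integral>z. (\<integral>w. symb C z w * (hat (ev u) w * cnj (hat (ev v) z)) \<partial>lborel) \<partial>lborel)"
  proof (intro Bochner_Integration.integral_cong refl)
    fix z
    have "gdens z *\<^sub>R (ev (C u) z * cnj (ev v z))
        = complex_of_real (gdens z) * cnj (ev v z) * (\<integral>w. ev u w * cinner (C (kfock w)) (kfock z) \<partial>gauss)"
      unfolding 1 scaleR_conv_of_real by (simp add: mult_ac)
    also have "\<dots> = complex_of_real (gdens z) * cnj (ev v z) *
        (\<integral>w. gdens w *\<^sub>R (ev u w * cinner (C (kfock w)) (kfock z)) \<partial>lborel)"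
      by (subst integral_gauss) simp_all
    also have "\<dots> = (\<integral>w. complex_of_real (gdens z) * cnj (ev v z) *
        gdens w *\<^sub>R (ev u w * cinner (C (kfock w)) (kfock z)) \<partial>lborel)"
      by (rule integral_mult_right_zero[symmetric])
    also have "\<dots> = (\<integral>w. symb C z w * (hat (ev u) w * cnj (hat (ev v) z)) \<partial>lborel)"
    proof (intro Bochner_Integration.integral_cong refl)
      fix w
      \<comment> \<open>Each Gaussian density is a square s^2 / p. In each variable one factor s
        goes to \<open>symb\<close> and one to \<open>hat\<close>; \<open>symb\<close> takes 1 / p
        and each \<open>hat\<close> takes 1 / sqrt p.\<close>
      define p where "p = pi ^ CARD('a)"
      define s where "s x = exp (- (norm x)\<^sup>2 / 2)" for x :: "complex ^ 'a"
      have p: "sqrt p * sqrt p = p" "\<bar>p\<bar> = p" by (simp_all add: p_def)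
      have g: "gdens x = s x * s x / p" for x
        unfolding p_def s_def by (simp add: exp_add[symmetric])
      have "(s z * s w / p) * (s w / sqrt p) * (s z / sqrt p) = gdens z * gdens w"
        unfolding g by (simp add: p ac_simps)
      then have e: "complex_of_real (s z * s w / p) * complex_of_real (s w / sqrt p) * complex_of_real (s z / sqrt p)
          = complex_of_real (gdens z) * complex_of_real (gdens w)"
        by (simp only: of_real_mult[symmetric])
      have "symb C z w * (hat (ev u) w * cnj (hat (ev v) z))
          = (complex_of_real (s z * s w / p) * complex_of_real (s w / sqrt p) * complex_of_real (s z / sqrt p))
            * (cinner (C (kfock w)) (kfock z) * ev u w * cnj (ev v z))"
        unfolding symb_def hat_def p_def[symmetric] s_def[symmetric] complex_cnj_mult complex_cnj_complex_of_real
        by (simp only: mult_ac)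
      also have "\<dots> = complex_of_real (gdens z) * cnj (ev v z) *
          gdens w *\<^sub>R (ev u w * cinner (C (kfock w)) (kfock z))"
        unfolding e scaleR_conv_of_real by (simp only: mult_ac)
      finally show "complex_of_real (gdens z) * cnj (ev v z) *
          gdens w *\<^sub>R (ev u w * cinner (C (kfock w)) (kfock z))
        = symb C z w * (hat (ev u) w * cnj (hat (ev v) z))" ..
    qed
    finally show "gdens z *\<^sub>R (ev (C u) z * cnj (ev v z))
        = (\<integral>w. symb C z w * (hat (ev u) w * cnj (hat (ev v) z)) \<partial>lborel)" .
  qed
  finally show ?thesis .
qed

lemma integrable_pairI:
  fixes h :: "'a::euclidean_space \<Rightarrow> 'b::euclidean_space \<Rightarrow> complex"
  assumes [measurable]: "(\<lambda>p. h (fst p) (snd p)) \<in> borel_measurable (borel \<Otimes>\<^sub>M borel)"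
    and fin: "(\<integral>\<^sup>+x. (\<integral>\<^sup>+y. ennreal (norm (h x y)) \<partial>lborel) \<partial>lborel) < \<infinity>"
  shows "integrable (lborel \<Otimes>\<^sub>M lborel) (case_prod h)"
proof (rule integrableI_bounded)
  show "case_prod h \<in> borel_measurable (lborel \<Otimes>\<^sub>M lborel)"
    using assms(1) by (simp add: case_prod_beta')
  have "(\<integral>\<^sup>+p. ennreal (norm (case_prod h p)) \<partial>(lborel \<Otimes>\<^sub>M lborel))
      = (\<integral>\<^sup>+x. (\<integral>\<^sup>+y. ennreal (norm (h x y)) \<partial>lborel) \<partial>lborel)"
    by (subst lborel.nn_integral_fst[symmetric]) (use assms(1) in \<open>simp_all add: case_prod_beta'\<close>)
  with fin show "(\<integral>\<^sup>+p. ennreal (norm (case_prod h p)) \<partial>(lborel \<Otimes>\<^sub>M lborel)) < \<infinity>" by simp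
qed

text \<open>The change of variables x = z - w at fixed w: Fubini, a translation in the inner
  integral, Fubini again. Finiteness is required in the coordinates (x, w), where the decay of the
  kernel in x is visible.\<close>

lemma
  fixes q :: "'a::euclidean_space \<Rightarrow> 'a \<Rightarrow> complex"
  assumes q: "(\<lambda>p. q (fst p) (snd p)) \<in> borel_measurable (borel \<Otimes>\<^sub>M borel)"
    and fin: "(\<integral>\<^sup>+x. (\<integral>\<^sup>+w. ennreal (norm (q (w + x) w)) \<partial>lborel) \<partial>lborel) < \<infinity>"
  shows integral_shear: "(\<integral>z. (\<integral>w. q z w \<partial>lborel) \<partial>lborel) = (\<integral>x. (\<integral>w. q (w + x) w \<partial>lborel) \<partial>lborel)"
    and integrable_shear: "integrable lborel (\<lambda>x. \<integral>w. q (w + x) w \<partial>lborel)"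
proof -
  have qm [measurable]: "(\<lambda>x. q (f x) (g x)) \<in> borel_measurable M"
    if [measurable]: "f \<in> borel_measurable M" "g \<in> borel_measurable M" for f g and M :: "'c measure"
  proof -
    have "(\<lambda>x. q (fst (f x, g x)) (snd (f x, g x))) \<in> borel_measurable M"
      by (rule measurable_compose[where f = "\<lambda>x. (f x, g x)" and N = "borel \<Otimes>\<^sub>M borel", OF _ q]) measurable
    then show ?thesis by simp
  qed
  have "(\<integral>\<^sup>+z. (\<integral>\<^sup>+w. ennreal (norm (q z w)) \<partial>lborel) \<partial>lborel)
      = (\<integral>\<^sup>+w. (\<integral>\<^sup>+z. ennreal (norm (q z w)) \<partial>lborel) \<partial>lborel)"
    by (rule lborel_pair.Fubini') (simp add: case_prod_beta' q measurable_compose[OF q])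
  also have "\<dots> = (\<integral>\<^sup>+w. (\<integral>\<^sup>+x. ennreal (norm (q (x + w) w)) \<partial>lborel) \<partial>lborel)"
  proof (rule nn_integral_cong)
    fix w :: 'a
    show "(\<integral>\<^sup>+z. ennreal (norm (q z w)) \<partial>lborel) = (\<integral>\<^sup>+x. ennreal (norm (q (x + w) w)) \<partial>lborel)"
      by (rule nn_integral_lborel_shift[of "\<lambda>z. ennreal (norm (q z w))" w, symmetric]) measurable
  qed
  also have "\<dots> = (\<integral>\<^sup>+x. (\<integral>\<^sup>+w. ennreal (norm (q (x + w) w)) \<partial>lborel) \<partial>lborel)"
    by (rule lborel_pair.Fubini') measurable
  finally have "(\<integral>\<^sup>+z. (\<integral>\<^sup>+w. ennreal (norm (q z w)) \<partial>lborel) \<partial>lborel) < \<infinity>"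
    using fin by (simp add: add.commute)
  with q have I1: "integrable (lborel \<Otimes>\<^sub>M lborel) (case_prod q)" by (rule integrable_pairI)
  have I2: "integrable (lborel \<Otimes>\<^sub>M lborel) (\<lambda>(x, w). q (w + x) w)"
    by (rule integrable_pairI[OF _ fin]) measurable
  show "integrable lborel (\<lambda>x. \<integral>w. q (w + x) w \<partial>lborel)"
    by (rule lborel_pair.integrable_fst[OF I2])
  have "(\<integral>z. (\<integral>w. q z w \<partial>lborel) \<partial>lborel) = (\<integral>w. (\<integral>z. q z w \<partial>lborel) \<partial>lborel)"
    by (rule lborel_pair.Fubini_integral[OF I1, symmetric])
  also have "\<dots> = (\<integral>w. (\<integral>x. q (w + x) w \<partial>lborel) \<partial>lborel)"
  proof (rule Bochner_Integration.integral_cong[OF refl])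
    fix w :: 'a
    show "(\<integral>z. q z w \<partial>lborel) = (\<integral>x. q (w + x) w \<partial>lborel)"
      using integral_lborel_shift[of "\<lambda>z. q z w" w] by (simp add: add.commute)
  qed
  also have "\<dots> = (\<integral>x. (\<integral>w. q (w + x) w \<partial>lborel) \<partial>lborel)"
    by (rule lborel_pair.Fubini_integral[OF I2])
  finally show "(\<integral>z. (\<integral>w. q z w \<partial>lborel) \<partial>lborel) = (\<integral>x. (\<integral>w. q (w + x) w \<partial>lborel) \<partial>lborel)" .
qed

text \<open>Up to a unimodular factor, \<open>loc f w y\<close> is \<open>hat f (w + y)\<close> without the Gaussian weight in \<open>y\<close>:
  the Weyl translate of \<open>f\<close>, which is entire in \<open>y\<close>.\<close>

definition loc :: "(complex ^ 'n::finite \<Rightarrow> complex) \<Rightarrow> complex ^ 'n \<Rightarrow> complex ^ 'n \<Rightarrow> complex" where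
  "loc f w y = complex_of_real (exp (- (norm w)\<^sup>2 / 2) / sqrt (pi ^ CARD('n))) * (f (y + w) * exp (-1 * hip y w))"

lemma entire_loc:
  assumes "entire f" shows "entire (loc f w)"
  unfolding loc_def[abs_def] by (intro entire_cmult entire_mult entire_shift entire_exp_hip assms)

lemma hat_shift: "hat f (w + y) = complex_of_real (exp (- (norm y)\<^sup>2 / 2)) * cis (Im (hip y w)) * loc f w y"
proof -
  have n: "(norm (w + y))\<^sup>2 = (norm y)\<^sup>2 + (norm w)\<^sup>2 + 2 * Re (hip y w)"
    by (simp add: Re_hip power2_norm_eq_inner inner_add_left inner_add_right inner_commute)
  have "complex_of_real (- (norm (w + y))\<^sup>2 / 2)
      = complex_of_real (- (norm y)\<^sup>2 / 2) + \<i> * Im (hip y w) + complex_of_real (- (norm w)\<^sup>2 / 2) + -1 * hip y w"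
    by (rule complex_eqI) (simp_all add: n field_simps)
  then have "exp (complex_of_real (- (norm (w + y))\<^sup>2 / 2))
      = exp (complex_of_real (- (norm y)\<^sup>2 / 2) + \<i> * Im (hip y w) + complex_of_real (- (norm w)\<^sup>2 / 2) + -1 * hip y w)"
    by (rule arg_cong)
  then have e: "complex_of_real (exp (- (norm (w + y))\<^sup>2 / 2)) = complex_of_real (exp (- (norm y)\<^sup>2 / 2)) *
      cis (Im (hip y w)) * complex_of_real (exp (- (norm w)\<^sup>2 / 2)) * exp (-1 * hip y w)"
    unfolding exp_add exp_of_real cis_conv_exp .
  show ?thesis
    unfolding hat_def loc_def of_real_divide e by (simp add: add.commute[of w] mult_ac)
qed

lemma norm_loc_sq: "(norm (loc f w y))\<^sup>2 = exp ((norm y)\<^sup>2) * (norm (hat f (w + y)))\<^sup>2"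
  unfolding hat_shift norm_mult power_mult_distrib
  by (simp add: exp_double[symmetric] exp_add[symmetric])

text \<open>On the diagonal the unimodular factors of the two translates cancel, so a sampled
  product is a positive weight times a value of \<open>hat f\<close> times the conjugate of
  \<open>hat g\<close>: exactly the integrand of a Toeplitz form.\<close>

lemma loc_mult_cnj_loc: "loc f w y * cnj (loc g w y) = complex_of_real (exp ((norm y)\<^sup>2)) * (hat f (w + y) * cnj (hat g (w + y)))"
proof -
  have "cis (Im (hip y w)) * cnj (cis (Im (hip y w))) = 1" by (simp add: cis_cnj cis_mult)
  moreover have "complex_of_real (exp ((norm y)\<^sup>2)) * complex_of_real (exp (- (norm y)\<^sup>2 / 2)) * complex_of_real (exp (- (norm y)\<^sup>2 / 2)) = 1"
    unfolding of_real_mult[symmetric] exp_add[symmetric] by simp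
  moreover have "complex_of_real (exp ((norm y)\<^sup>2)) * (hat f (w + y) * cnj (hat g (w + y)))
    = (complex_of_real (exp ((norm y)\<^sup>2)) * complex_of_real (exp (- (norm y)\<^sup>2 / 2)) * complex_of_real (exp (- (norm y)\<^sup>2 / 2)))
      * (cis (Im (hip y w)) * cnj (cis (Im (hip y w)))) * (loc f w y * cnj (loc g w y))"
    unfolding hat_shift complex_cnj_mult complex_cnj_complex_of_real by (simp only: mult_ac)
  ultimately show ?thesis by simp
qed

text \<open>Off the diagonal a phase and a Gaussian factor survive. They depend only on x and w, not
  on the functions, and can be joined to the symbol of the operator.\<close>

lemma hat_off_diagonal: "hat f w * cnj (hat g (w + x))
    = complex_of_real (exp (- (norm x)\<^sup>2 / 2)) * cis (- Im (hip x w)) * (loc f w 0 * cnj (loc g w x))"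
proof -
  have "hat f w = loc f w 0" using hat_shift[of f w 0] by simp
  then show ?thesis
    unfolding hat_shift[of g w x] by (simp add: cis_cnj mult_ac)
qed

section \<open>Approximation by Toeplitz operators\<close>

lemma smult_measurable [measurable]:
  assumes [measurable]: "g \<in> borel_measurable M" "h \<in> borel_measurable M"
  shows "(\<lambda>p. g p *s (h p :: complex ^ 'n::finite)) \<in> borel_measurable M"
proof -
  have cont: "continuous_on UNIV (\<lambda>p::complex \<times> (complex ^ 'n). fst p *s snd p)"
    unfolding vector_scalar_mult_def by (intro continuous_intros)
  have [measurable]: "(\<lambda>p::complex \<times> (complex ^ 'n). fst p *s snd p) \<in> borel_measurable (borel \<Otimes>\<^sub>M borel)"
    unfolding borel_prod by (rule borel_measurable_continuous_onI[OF cont])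
  have "(\<lambda>p. fst (g p, h p) *s snd (g p, h p)) \<in> borel_measurable M"
    by (rule measurable_compose[where f = "\<lambda>x. (g x, h x)" and N = "borel \<Otimes>\<^sub>M borel"]) measurable
  then show ?thesis by simp
qed

lemma loc_on_line:
  assumes "entire f" shows "(\<lambda>\<zeta>. loc f w (\<zeta> *s x)) holomorphic_on UNIV"
  using entire_on_line[OF entire_loc[OF assms], of w 0 x] by simp

text \<open>The removed weight equals exp(4|x|^2) on the whole circle. Integrating over w first,
  each point of the circle contributes a full translate of |hat f|^2. This turns pointwise sampling
  errors into a bound by the norms of u and v.\<close>

lemma nn_integral_circ_norm_loc:
  assumes f: "entire f"
  shows "(\<integral>\<^sup>+w. ennreal ((circ_norm (\<lambda>\<zeta>. loc f w (\<zeta> *s x)))\<^sup>2) \<partial>lborel)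
    = ennreal (exp (4 * (norm x)\<^sup>2)) * (\<integral>\<^sup>+z. ennreal ((norm (hat f z))\<^sup>2) \<partial>lborel)"
proof -
  note [measurable] = entire_measurable[OF f]
  interpret P: pair_sigma_finite circ "lborel :: (complex ^ 'a) measure" ..
  have 1: "ennreal ((circ_norm (\<lambda>\<zeta>. loc f w (\<zeta> *s x)))\<^sup>2)
      = (\<integral>\<^sup>+\<zeta>. ennreal (exp (4 * (norm x)\<^sup>2)) * ennreal ((norm (hat f (w + (2 * \<zeta>) *s x)))\<^sup>2) \<partial>circ)" for w
  proof -
    have contF: "continuous_on UNIV (\<lambda>\<zeta>. loc f w (\<zeta> *s x))"
      by (rule holomorphic_on_imp_continuous_on[OF loc_on_line[OF f]])
    have c: "continuous_on UNIV (\<lambda>\<zeta>. loc f w ((2 * \<zeta>) *s x))"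
      by (rule continuous_on_compose2[OF contF, of _ "\<lambda>\<zeta>. 2 * \<zeta>"]) (auto intro!: continuous_intros)
    have "(circ_norm (\<lambda>\<zeta>. loc f w (\<zeta> *s x)))\<^sup>2 = (\<integral>\<zeta>. (norm (loc f w ((2 * \<zeta>) *s x)))\<^sup>2 \<partial>circ)"
      unfolding circ_norm_def by (rule real_sqrt_pow2) (rule Bochner_Integration.integral_nonneg, simp)
    then have "ennreal ((circ_norm (\<lambda>\<zeta>. loc f w (\<zeta> *s x)))\<^sup>2)
        = (\<integral>\<^sup>+\<zeta>. ennreal ((norm (loc f w ((2 * \<zeta>) *s x)))\<^sup>2) \<partial>circ)"
      by (simp only:) (intro nn_integral_eq_integral[symmetric] integrable_circ continuous_intros c, simp)
    also have "\<dots> = (\<integral>\<^sup>+\<zeta>. ennreal (exp (4 * (norm x)\<^sup>2)) * ennreal ((norm (hat f (w + (2 * \<zeta>) *s x)))\<^sup>2) \<partial>circ)"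
    proof (rule nn_integral_cong_AE)
      show "AE \<zeta> in circ. ennreal ((norm (loc f w ((2 * \<zeta>) *s x)))\<^sup>2)
          = ennreal (exp (4 * (norm x)\<^sup>2)) * ennreal ((norm (hat f (w + (2 * \<zeta>) *s x)))\<^sup>2)"
        using AE_circ
      proof eventually_elim
        case (elim \<zeta>)
        have "(norm ((2 * \<zeta>) *s x))\<^sup>2 = 4 * (norm x)\<^sup>2"
          by (simp add: norm_smult norm_mult elim power_mult_distrib)
        then show ?case unfolding norm_loc_sq by (simp add: ennreal_mult')
      qed
    qed
    finally show ?thesis .
  qed
  have "(\<integral>\<^sup>+w. ennreal ((circ_norm (\<lambda>\<zeta>. loc f w (\<zeta> *s x)))\<^sup>2) \<partial>lborel)
     = (\<integral>\<^sup>+w. (\<integral>\<^sup>+\<zeta>. ennreal (exp (4 * (norm x)\<^sup>2)) * ennreal ((norm (hat f (w + (2 * \<zeta>) *s x)))\<^sup>2) \<partial>circ) \<partial>lborel)"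
    by (rule nn_integral_cong) (rule 1)
  also have "\<dots> = (\<integral>\<^sup>+\<zeta>. (\<integral>\<^sup>+w. ennreal (exp (4 * (norm x)\<^sup>2)) * ennreal ((norm (hat f (w + (2 * \<zeta>) *s x)))\<^sup>2) \<partial>lborel) \<partial>circ)"
    by (rule P.Fubini') measurable
  also have "\<dots> = (\<integral>\<^sup>+\<zeta>. ennreal (exp (4 * (norm x)\<^sup>2)) * (\<integral>\<^sup>+z. ennreal ((norm (hat f z))\<^sup>2) \<partial>lborel) \<partial>circ)"
  proof (rule nn_integral_cong)
    fix \<zeta>
    have "(\<integral>\<^sup>+w. ennreal ((norm (hat f (w + (2 * \<zeta>) *s x)))\<^sup>2) \<partial>lborel) = (\<integral>\<^sup>+z. ennreal ((norm (hat f z))\<^sup>2) \<partial>lborel)"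
      by (rule nn_integral_lborel_shift[of "\<lambda>z. ennreal ((norm (hat f z))\<^sup>2)"]) measurable
    then show "(\<integral>\<^sup>+w. ennreal (exp (4 * (norm x)\<^sup>2)) * ennreal ((norm (hat f (w + (2 * \<zeta>) *s x)))\<^sup>2) \<partial>lborel)
        = ennreal (exp (4 * (norm x)\<^sup>2)) * (\<integral>\<^sup>+z. ennreal ((norm (hat f z))\<^sup>2) \<partial>lborel)"
      by (subst nn_integral_cmult) simp_all
  qed
  also have "\<dots> = ennreal (exp (4 * (norm x)\<^sup>2)) * (\<integral>\<^sup>+z. ennreal ((norm (hat f z))\<^sup>2) \<partial>lborel)"
    using circ.emeasure_space_1 by simp
  finally show ?thesis .
qed

lemma circ_norm_loc_measurable:
  assumes [measurable]: "f \<in> borel_measurable borel"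
  shows "(\<lambda>w. circ_norm (\<lambda>\<zeta>. loc f w (\<zeta> *s x))) \<in> borel_measurable borel"
  unfolding circ_norm_def loc_def
  by measurable

lemma mult_le_sum_squares: "x * y \<le> x\<^sup>2 + y\<^sup>2" for x y :: real
proof -
  have "2 * (x * y) \<le> x\<^sup>2 + y\<^sup>2" using sum_squares_bound[of x y] by (simp only: mult.assoc)
  then show ?thesis using zero_le_power2[of x] zero_le_power2[of y] by linarith
qed

text \<open>In the form of \<open>C\<close> the contribution of the displacement \<open>x = z - w\<close> is an integral over \<open>w\<close> of
  \<open>\<phi> x w * (loc f w 0 * cnj (loc g w x))\<close>. Displacements outside a large ball \<open>B\<close> are negligible; for the others,
  sampling on the diagonal of the complex line through \<open>x\<close> replaces this product by a combination of
  \<open>H (w + a i *s x)\<close> with \<open>H = hat f * cnj (hat g)\<close>. Substituting \<open>v = w + a i *s x\<close> and integrating over \<open>x\<close>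
  first leaves the form of a single Toeplitz operator.\<close>

lemma toeplitz_approx:
  fixes C :: "'n::finite fock \<Rightarrow>\<^sub>L 'n fock"
  assumes C: "C \<in> operators" and K: "K \<ge> 0"
    and dec: "\<And>z w. norm (symb C z w) \<le> K * exp (- (1 / 64) * (norm (z - w))\<^sup>2)"
    and eta: "\<eta> > 0"
  shows "\<exists>\<Phi>\<in>Linf. \<forall>u v. norm (cinner (C u) v - cinner (toeplitz \<Phi> u) v)
    \<le> \<eta> * ((norm u)\<^sup>2 + (norm v)\<^sup>2)"
proof -
  define I where "I = (\<integral>x. exp (- (1 / 128) * (norm (x :: complex ^ 'n))\<^sup>2) \<partial>lborel)"
  have intI: "integrable lborel (\<lambda>x :: complex ^ 'n. exp (- (1 / 128) * (norm x)\<^sup>2))"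
    by (rule integrable_gaussian) simp
  \<comment> \<open>Half of the decay rate 1/64 is spent on smallness outside the ball, the other
    half on integrability; hence 1/128.\<close>
  obtain R where R: "R \<ge> 0" "K * exp (- R\<^sup>2 / 128) * I \<le> \<eta> / 2"
  proof -
    have "((\<lambda>R::real. K * exp (- R\<^sup>2 / 128) * I) \<longlongrightarrow> 0) at_top" by real_asymp
    then have "eventually (\<lambda>R. K * exp (- R\<^sup>2 / 128) * I < \<eta> / 2) at_top"
      using eta by (intro order_tendstoD) auto
    then have "eventually (\<lambda>R. R \<ge> 0 \<and> K * exp (- R\<^sup>2 / 128) * I < \<eta> / 2) at_top"
      using eventually_ge_at_top[of 0] by eventually_elim simp
    then have "\<exists>R. R \<ge> 0 \<and> K * exp (- R\<^sup>2 / 128) * I < \<eta> / 2"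
      by (rule eventually_happens'[rotated]) simp
    then show ?thesis using that less_imp_le by blast
  qed
  define B where "B = (cball 0 R :: (complex ^ 'n) set)"
  have [measurable]: "B \<in> sets borel" by (simp add: B_def)
  define V where "V = measure lborel B"
  have V: "V \<ge> 0" by (simp add: V_def)
  have Bfin: "emeasure lborel B < \<infinity>"
    using emeasure_lborel_cball_finite[of "0 :: complex ^ 'n" R] by (simp add: B_def)
  have intB: "integrable lborel (indicat_real B)"
    using Bfin by (intro integrable_real_indicator) auto
  \<comment> \<open>The sampling error is at most K e exp(4 R^2) for each x, to be integrated over
    the volume \<open>V\<close>. Adding 1 keeps the denominator positive when K or V is 0.\<close>
  define e where "e = (\<eta> / 2) / (K * exp (4 * R\<^sup>2) * V + 1)"
  have pos: "K * exp (4 * R\<^sup>2) * V + 1 > 0"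
    using K V by (intro add_nonneg_pos mult_nonneg_nonneg) auto
  have e: "e > 0" unfolding e_def using eta pos by simp
  have eV: "K * exp (4 * R\<^sup>2) * V * e \<le> \<eta> / 2"
  proof -
    have "K * exp (4 * R\<^sup>2) * V * e \<le> (K * exp (4 * R\<^sup>2) * V + 1) * e"
      using e by (intro mult_right_mono) auto
    also have "\<dots> = e * (K * exp (4 * R\<^sup>2) * V + 1)" by (rule mult.commute)
    also have "\<dots> = \<eta> / 2"
      by (rule iffD1[OF nonzero_eq_divide_eq e_def]) (use pos in linarith)
    finally show ?thesis .
  qed
  obtain n c a where a: "\<And>i::nat. norm (a i :: complex) \<le> 1"
    and sample: "\<And>F G. F holomorphic_on UNIV \<Longrightarrow> G holomorphic_on UNIV \<Longrightarrow>
      norm ((\<Sum>i<n. c i * (F (a i) * cnj (G (a i)))) - F 0 * cnj (G 1)) \<le> e * (circ_norm F * circ_norm G)"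
    by (rule sample_off_diagonal[OF e]) (rule that)
  \<comment> \<open>Collects all factors that do not depend on the two vectors: the symbol, and the
    phase and Gaussian factor from \<open>hat_off_diagonal\<close>.\<close>
  define \<phi> where "\<phi> x w = symb C (w + x) w * (complex_of_real (exp (- (norm x)\<^sup>2 / 2)) * cis (- Im (hip x w)))" for x w
  have \<phi>_measurable [measurable]: "(\<lambda>p. \<phi> (f p) (g p)) \<in> borel_measurable M"
    if [measurable]: "f \<in> borel_measurable M" "g \<in> borel_measurable M" for f g and M :: "'z measure"
    unfolding \<phi>_def by measurable
  have \<phi>_le: "norm (\<phi> x w) \<le> K * exp (- (1 / 64) * (norm x)\<^sup>2)" for x w
  proof -
    have "norm (\<phi> x w) = norm (symb C (w + x) w) * exp (- (norm x)\<^sup>2 / 2)"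
      by (simp add: \<phi>_def norm_mult)
    also have "\<dots> \<le> norm (symb C (w + x) w) * 1" by (intro mult_left_mono) auto
    also have "\<dots> \<le> K * exp (- (1 / 64) * (norm x)\<^sup>2)" using dec[of "w + x" w] by simp
    finally show ?thesis .
  qed
  have \<phi>_le_K: "norm (\<phi> x w) \<le> K" for x w
  proof -
    have "K * exp (- (1 / 64) * (norm x)\<^sup>2) \<le> K * 1" using K by (intro mult_left_mono) auto
    with \<phi>_le[of x w] show ?thesis by simp
  qed
  \<comment> \<open>The exponential is the weight from \<open>loc_mult_cnj_loc\<close>, and v - a i
    x is the base point w in terms of the sampling point v.\<close>
  define \<psi> where "\<psi> i x v = indicator B x *
      (c i * complex_of_real (exp ((norm (a i *s x))\<^sup>2)) * \<phi> x (v - a i *s x))" for i x v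
  define \<Psi> where "\<Psi> x v = (\<Sum>i<n. \<psi> i x v)" for x v
  define \<Phi> where "\<Phi> v = (\<integral>x. \<Psi> x v \<partial>lborel)" for v
  define M where "M = (\<Sum>i<n. norm (c i) * (exp (R\<^sup>2) * K))"
  have \<psi>_measurable [measurable]: "(\<lambda>p. \<psi> i (f p) (g p)) \<in> borel_measurable N"
    if [measurable]: "f \<in> borel_measurable N" "g \<in> borel_measurable N" for f g i and N :: "'z measure"
    unfolding \<psi>_def by measurable
  have \<Psi>_measurable [measurable]: "(\<lambda>p. \<Psi> (f p) (g p)) \<in> borel_measurable N"
    if [measurable]: "f \<in> borel_measurable N" "g \<in> borel_measurable N" for f g and N :: "'z measure"
    unfolding \<Psi>_def by measurable
  have \<psi>_le: "norm (\<psi> i x v) \<le> norm (c i) * (exp (R\<^sup>2) * K) * indicator B x" for i x v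
  proof (cases "x \<in> B")
    case True
    then have x: "norm x \<le> R" by (simp add: B_def)
    have "norm (a i *s x) \<le> 1 * R" unfolding norm_smult using a x by (intro mult_mono) auto
    then have "(norm (a i *s x))\<^sup>2 \<le> R\<^sup>2" by (intro power_mono) auto
    then have "exp ((norm (a i *s x))\<^sup>2) * norm (\<phi> x (v - a i *s x)) \<le> exp (R\<^sup>2) * K"
      by (intro mult_mono \<phi>_le_K) auto
    then have "norm (c i) * (exp ((norm (a i *s x))\<^sup>2) * norm (\<phi> x (v - a i *s x))) \<le> norm (c i) * (exp (R\<^sup>2) * K)"
      by (intro mult_left_mono) auto
    then show ?thesis using True by (simp add: \<psi>_def norm_mult mult.assoc)
  qed (simp add: \<psi>_def)
  have \<Psi>_le: "norm (\<Psi> x v) \<le> M * indicator B x" for x v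
    unfolding \<Psi>_def M_def sum_distrib_right by (rule sum_norm_le) (rule \<psi>_le)
  have M: "M \<ge> 0" unfolding M_def using K by (intro sum_nonneg mult_nonneg_nonneg) auto
  have \<Phi>_meas [measurable]: "\<Phi> \<in> borel_measurable borel"
    unfolding \<Phi>_def[abs_def] by (rule lborel.borel_measurable_lebesgue_integral) measurable
  have \<Phi>: "\<Phi> \<in> Linf"
  proof -
    have "norm (\<Phi> v) \<le> M * V" for v
    proof -
      have i: "integrable lborel (\<lambda>x. M * indicator B x)" using intB by simp
      have "integrable lborel (\<lambda>x. \<Psi> x v)"
        by (rule Bochner_Integration.integrable_bound[OF i]) (use \<Psi>_le M in \<open>auto simp: abs_mult\<close>)
      then have "norm (\<Phi> v) \<le> (\<integral>x. M * indicator B x \<partial>lborel)"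
        unfolding \<Phi>_def using i by (rule Bochner_Integration.integral_norm_bound_integral) (rule \<Psi>_le)
      also have "\<dots> = M * V" using intB by (simp add: V_def)
      finally show ?thesis .
    qed
    then show ?thesis unfolding Linf_def using \<Phi>_meas by (auto intro!: exI[of _ "M * V"])
  qed
  have "norm (cinner (C u) v - cinner (toeplitz \<Phi> u) v) \<le> \<eta> * ((norm u)\<^sup>2 + (norm v)\<^sup>2)"
    for u v
  proof -
    define f where "f = ev u"
    define g where "g = ev v"
    have f: "entire f" and g: "entire g" by (simp_all add: f_def g_def entire_ev)
    have [measurable]: "f \<in> borel_measurable borel" "g \<in> borel_measurable borel"
      by (simp_all add: f_def g_def)
    define s where "s = (norm u)\<^sup>2 + (norm v)\<^sup>2"
    have s: "s \<ge> 0" by (simp add: s_def)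
    have hf: "integrable lborel (\<lambda>z. (norm (hat f z))\<^sup>2)" and hg: "integrable lborel (\<lambda>z. (norm (hat g z))\<^sup>2)"
      by (simp_all add: f_def g_def integrable_hat_sq)
    have nf: "(\<integral>\<^sup>+z. ennreal ((norm (hat f z))\<^sup>2) \<partial>lborel) = ennreal ((norm u)\<^sup>2)"
      and ng: "(\<integral>\<^sup>+z. ennreal ((norm (hat g z))\<^sup>2) \<partial>lborel) = ennreal ((norm v)\<^sup>2)"
      by (simp_all add: f_def g_def nn_integral_hat_sq)
    define H where "H z = hat f z * cnj (hat g z)" for z
    have [measurable]: "H \<in> borel_measurable borel" unfolding H_def[abs_def] by measurable
    have H: "integrable lborel H"
    proof (rule Bochner_Integration.integrable_bound)
      show "integrable lborel (\<lambda>z. (norm (hat f z))\<^sup>2 + (norm (hat g z))\<^sup>2)" using hf hg by simp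
    qed (auto simp: H_def norm_mult mult_le_sum_squares)
    define q where "q z w = symb C z w * (hat f w * cnj (hat g z))" for z w
    have q_measurable [measurable]: "(\<lambda>p. q (h p) (k p)) \<in> borel_measurable N"
      if [measurable]: "h \<in> borel_measurable N" "k \<in> borel_measurable N" for h k and N :: "'z measure"
      unfolding q_def by measurable
    have q_eq: "q (w + x) w = \<phi> x w * (loc f w 0 * cnj (loc g w x))" for x w
      unfolding q_def \<phi>_def hat_off_diagonal by (simp only: mult_ac)
    have q_le: "norm (q (w + x) w) \<le> K * exp (- (1 / 64) * (norm x)\<^sup>2) * ((norm (hat f w))\<^sup>2 + (norm (hat g (w + x)))\<^sup>2)" for x w
    proof -
      have "norm (q (w + x) w) = norm (symb C (w + x) w) * (norm (hat f w) * norm (hat g (w + x)))"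
        by (simp add: q_def norm_mult)
      also have "\<dots> \<le> K * exp (- (1 / 64) * (norm x)\<^sup>2) * ((norm (hat f w))\<^sup>2 + (norm (hat g (w + x)))\<^sup>2)"
        using dec[of "w + x" w] K by (intro mult_mono mult_le_sum_squares) auto
      finally show ?thesis .
    qed
    have nnq: "(\<integral>\<^sup>+w. ennreal (norm (q (w + x) w)) \<partial>lborel) \<le> ennreal (K * exp (- (1 / 64) * (norm x)\<^sup>2) * s)" for x
    proof -
      define k where "k = K * exp (- (1 / 64) * (norm x)\<^sup>2)"
      have k: "k \<ge> 0" using K by (simp add: k_def)
      have "(\<integral>\<^sup>+w. ennreal (norm (q (w + x) w)) \<partial>lborel)
          \<le> (\<integral>\<^sup>+w. ennreal k * (ennreal ((norm (hat f w))\<^sup>2) + ennreal ((norm (hat g (w + x)))\<^sup>2)) \<partial>lborel)"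
      proof (rule nn_integral_mono)
        fix w
        show "ennreal (norm (q (w + x) w)) \<le> ennreal k * (ennreal ((norm (hat f w))\<^sup>2) + ennreal ((norm (hat g (w + x)))\<^sup>2))"
          using q_le[of w x] k unfolding k_def[symmetric]
          by (simp add: ennreal_plus[symmetric] ennreal_mult'[symmetric] ennreal_leI del: ennreal_plus)
      qed
      also have "\<dots> = ennreal k * ((\<integral>\<^sup>+w. ennreal ((norm (hat f w))\<^sup>2) \<partial>lborel) + (\<integral>\<^sup>+w. ennreal ((norm (hat g (w + x)))\<^sup>2) \<partial>lborel))"
        by (subst nn_integral_cmult) (simp_all add: nn_integral_add)
      also have "(\<integral>\<^sup>+w. ennreal ((norm (hat g (w + x)))\<^sup>2) \<partial>lborel) = ennreal ((norm v)\<^sup>2)"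
        using nn_integral_lborel_shift[of "\<lambda>z. ennreal ((norm (hat g z))\<^sup>2)" x] ng by simp
      also have "ennreal k * ((\<integral>\<^sup>+w. ennreal ((norm (hat f w))\<^sup>2) \<partial>lborel) + ennreal ((norm v)\<^sup>2)) = ennreal (k * s)"
        unfolding nf s_def using k by (simp add: ennreal_plus[symmetric] ennreal_mult' del: ennreal_plus)
      finally show ?thesis unfolding k_def .
    qed
    have qint: "integrable lborel (\<lambda>w. q (w + x) w)" for x
    proof (rule integrableI_bounded)
      show "(\<integral>\<^sup>+w. ennreal (norm (q (w + x) w)) \<partial>lborel) < \<infinity>"
        by (rule order.strict_trans1[OF nnq]) simp
    qed measurable
    have nnqq: "(\<integral>\<^sup>+x. (\<integral>\<^sup>+w. ennreal (norm (q (w + x) w)) \<partial>lborel) \<partial>lborel) < \<infinity>"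
    proof -
      have "(\<integral>\<^sup>+x. (\<integral>\<^sup>+w. ennreal (norm (q (w + x) w)) \<partial>lborel) \<partial>lborel)
          \<le> (\<integral>\<^sup>+x. ennreal (exp (- (1 / 64) * (norm (x :: complex ^ 'n))\<^sup>2) * (K * s)) \<partial>lborel)"
        by (rule nn_integral_mono, rule order.trans[OF nnq]) (simp add: mult_ac)
      also have "\<dots> < \<infinity>"
        using integrable_gaussian[of "1 / 64", where 'a = "complex ^ 'n"] K s
        by (subst nn_integral_eq_integral) (auto intro!: integrable_mult_left)
      finally show ?thesis .
    qed
    have qm: "(\<lambda>p. q (fst p) (snd p)) \<in> borel_measurable (borel \<Otimes>\<^sub>M borel)" by measurable
    have C_eq: "cinner (C u) v = (\<integral>x. (\<integral>w. q (w + x) w \<partial>lborel) \<partial>lborel)"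
      unfolding cinner_symb[OF C] f_def[symmetric] g_def[symmetric] q_def[symmetric]
      by (rule integral_shear[OF qm nnqq])
    have X_int: "integrable lborel (\<lambda>x. \<integral>w. q (w + x) w \<partial>lborel)"
      by (rule integrable_shear[OF qm nnqq])
    \<comment> \<open>The sampled replacement of \<open>q (w + x) w\<close>, set to 0 for
      displacements outside \<open>B\<close>.\<close>
    define r where "r x w = indicator B x * (\<phi> x w * (\<Sum>i<n. c i * (loc f w (a i *s x) * cnj (loc g w (a i *s x)))))" for x w
    have r_eq: "r x w = (\<Sum>i<n. \<psi> i x (w + a i *s x) * H (w + a i *s x))" for x w
      unfolding r_def \<psi>_def loc_mult_cnj_loc H_def sum_distrib_left by (intro sum.cong refl) (simp add: mult_ac)
    have \<psi>H: "integrable lborel (\<lambda>v. \<psi> i x v * H v)" for i x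
    proof (rule Bochner_Integration.integrable_bound)
      show "integrable lborel (\<lambda>v. norm (c i) * (exp (R\<^sup>2) * K) * norm (H v))" using H by simp
      show "AE v in lborel. norm (\<psi> i x v * H v) \<le> norm (norm (c i) * (exp (R\<^sup>2) * K) * norm (H v))"
      proof (rule AE_I2)
        fix v
        have "norm (\<psi> i x v) \<le> norm (c i) * (exp (R\<^sup>2) * K)"
          using \<psi>_le[of i x v] K by (cases "x \<in> B") auto
        then have "norm (\<psi> i x v * H v) \<le> norm (c i) * (exp (R\<^sup>2) * K) * norm (H v)"
          unfolding norm_mult by (rule mult_right_mono) simp
        then show "norm (\<psi> i x v * H v) \<le> norm (norm (c i) * (exp (R\<^sup>2) * K) * norm (H v))" by simp
      qed
    qed measurable
    have r_int: "integrable lborel (r x)" for x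
      unfolding r_eq[abs_def] by (rule Bochner_Integration.integrable_sum) (rule integrable_lborel_shift[OF \<psi>H])
    have r_integral: "(\<integral>v. \<Psi> x v * H v \<partial>lborel) = (\<integral>w. r x w \<partial>lborel)" for x
    proof -
      have "(\<integral>v. \<Psi> x v * H v \<partial>lborel) = (\<Sum>i<n. \<integral>v. \<psi> i x v * H v \<partial>lborel)"
        unfolding \<Psi>_def sum_distrib_right by (rule Bochner_Integration.integral_sum) (rule \<psi>H)
      also have "\<dots> = (\<Sum>i<n. \<integral>w. \<psi> i x (w + a i *s x) * H (w + a i *s x) \<partial>lborel)"
        by (intro sum.cong refl integral_lborel_shift[of "\<lambda>v. \<psi> _ x v * H v", symmetric]) measurable
      also have "\<dots> = (\<integral>w. r x w \<partial>lborel)"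
        unfolding r_eq
        by (rule Bochner_Integration.integral_sum[symmetric]) (rule integrable_lborel_shift[OF \<psi>H])
      finally show ?thesis .
    qed
    \<comment> \<open>\<open>\<Psi>\<close> is bounded and vanishes for x outside the ball, while
      \<open>H\<close> is integrable in v; so the order of integration may be exchanged.\<close>
    have PH: "integrable (lborel \<Otimes>\<^sub>M lborel) (\<lambda>(x, v). \<Psi> x v * H v)"
    proof (rule integrable_pairI)
      have "(\<integral>\<^sup>+x. (\<integral>\<^sup>+v. ennreal (norm (\<Psi> x v * H v)) \<partial>lborel) \<partial>lborel)
          \<le> (\<integral>\<^sup>+x. (\<integral>\<^sup>+v. ennreal (M * indicator B x) * ennreal (norm (H v)) \<partial>lborel) \<partial>lborel)"
      proof (intro nn_integral_mono)
        fix x v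
        show "ennreal (norm (\<Psi> x v * H v)) \<le> ennreal (M * indicator B x) * ennreal (norm (H v))"
          using \<Psi>_le[of x v] M
          by (simp only: norm_mult ennreal_mult'[symmetric] ennreal_leI mult_right_mono norm_ge_zero mult_nonneg_nonneg indicator_pos_le)
      qed
      also have "\<dots> = (\<integral>\<^sup>+x. ennreal (M * indicator B x) * (\<integral>\<^sup>+v. ennreal (norm (H v)) \<partial>lborel) \<partial>lborel)"
        by (intro nn_integral_cong nn_integral_cmult) measurable
      also have "\<dots> = (\<integral>\<^sup>+x. ennreal (M * indicator B x) \<partial>lborel) * (\<integral>\<^sup>+v. ennreal (norm (H v)) \<partial>lborel)"
        by (rule nn_integral_multc) measurable
      also have "\<dots> < \<infinity>"
      proof -
        have "(\<integral>\<^sup>+x. ennreal (M * indicator B x) \<partial>lborel) < \<infinity>"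
          using intB M by (subst nn_integral_eq_integral) auto
        moreover have "(\<integral>\<^sup>+v. ennreal (norm (H v)) \<partial>lborel) < \<infinity>"
          using H by (simp add: integrable_iff_bounded)
        ultimately show ?thesis by (simp add: ennreal_mult_less_top)
      qed
      finally show "(\<integral>\<^sup>+x. (\<integral>\<^sup>+v. ennreal (norm (\<Psi> x v * H v)) \<partial>lborel) \<partial>lborel) < \<infinity>" .
    qed measurable
    have T_eq: "cinner (toeplitz \<Phi> u) v = (\<integral>x. (\<integral>w. r x w \<partial>lborel) \<partial>lborel)"
    proof -
      have "cinner (toeplitz \<Phi> u) v = (\<integral>v. \<Phi> v * H v \<partial>lborel)"
        unfolding cinner_toeplitz[OF \<Phi>] f_def[symmetric] g_def[symmetric] H_def ..
      also have "\<dots> = (\<integral>v. (\<integral>x. \<Psi> x v * H v \<partial>lborel) \<partial>lborel)"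
        unfolding \<Phi>_def by simp
      also have "\<dots> = (\<integral>x. (\<integral>v. \<Psi> x v * H v \<partial>lborel) \<partial>lborel)"
        by (rule lborel_pair.Fubini_integral[OF PH])
      finally show ?thesis unfolding r_integral .
    qed
    have Y_int: "integrable lborel (\<lambda>x. \<integral>w. r x w \<partial>lborel)"
      using lborel_pair.integrable_fst[OF PH] unfolding r_integral .
    \<comment> \<open>The first summand covers the sampling error inside \<open>B\<close>, the
      second the discarded displacements outside.\<close>
    define E where "E x = (indicator B x * (K * e * exp (4 * R\<^sup>2))
        + K * exp (- R\<^sup>2 / 128) * exp (- (1 / 128) * (norm x)\<^sup>2)) * s" for x
    have E_int: "integrable lborel E"
      unfolding E_def[abs_def] using intB intI by simp
    have bound: "norm ((\<integral>w. q (w + x) w \<partial>lborel) - (\<integral>w. r x w \<partial>lborel)) \<le> E x" for x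
    proof -
      have i: "integrable lborel (\<lambda>w. q (w + x) w - r x w)" using qint r_int by simp
      have E0: "E x \<ge> 0" unfolding E_def using K e s by (intro mult_nonneg_nonneg add_nonneg_nonneg) auto
      have "(\<integral>\<^sup>+w. ennreal (norm (q (w + x) w - r x w)) \<partial>lborel) \<le> ennreal (E x)"
      proof (cases "x \<in> B")
        case True
        then have x: "norm x \<le> R" by (simp add: B_def)
        define F where "F w \<zeta> = loc f w (\<zeta> *s x)" for w \<zeta>
        define G where "G w \<zeta> = loc g w (\<zeta> *s x)" for w \<zeta>
        have FG: "F w holomorphic_on UNIV" "G w holomorphic_on UNIV" for w
          unfolding F_def[abs_def] G_def[abs_def] by (rule loc_on_line[OF f], rule loc_on_line[OF g])
        have "norm (q (w + x) w - r x w) \<le> (K * e) * ((circ_norm (F w))\<^sup>2 + (circ_norm (G w))\<^sup>2)" for w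
        proof -
          \<comment> \<open>Along the line through x, \<open>q\<close> has the product of the values
            at 0 and 1 where \<open>r\<close> has the sampled sum, with the same nodes for every
            w.\<close>
          have "q (w + x) w - r x w = - (\<phi> x w * ((\<Sum>i<n. c i * (F w (a i) * cnj (G w (a i)))) - F w 0 * cnj (G w 1)))"
            unfolding q_eq r_def F_def G_def using True by (simp add: algebra_simps)
          then have "norm (q (w + x) w - r x w)
              = norm (\<phi> x w) * norm ((\<Sum>i<n. c i * (F w (a i) * cnj (G w (a i)))) - F w 0 * cnj (G w 1))"
            by (simp only: norm_minus_cancel norm_mult)
          also have "\<dots> \<le> K * (e * (circ_norm (F w) * circ_norm (G w)))"
            using K by (intro mult_mono \<phi>_le_K sample FG) auto
          also have "\<dots> \<le> K * (e * ((circ_norm (F w))\<^sup>2 + (circ_norm (G w))\<^sup>2))"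
            using K e by (intro mult_left_mono mult_le_sum_squares) auto
          finally show ?thesis by (simp only: mult.assoc)
        qed
        then have "(\<integral>\<^sup>+w. ennreal (norm (q (w + x) w - r x w)) \<partial>lborel)
            \<le> (\<integral>\<^sup>+w. ennreal (K * e * ((circ_norm (F w))\<^sup>2 + (circ_norm (G w))\<^sup>2)) \<partial>lborel)"
          by (intro nn_integral_mono ennreal_leI)
        also have "\<dots> \<le> ennreal (K * e * exp (4 * (norm x)\<^sup>2) * s)"
        proof -
          have [measurable]: "(\<lambda>w. circ_norm (F w)) \<in> borel_measurable borel" "(\<lambda>w. circ_norm (G w)) \<in> borel_measurable borel"
            unfolding F_def G_def by (intro circ_norm_loc_measurable; measurable)+
          have k: "K * e \<ge> 0" using K e by simp
          have "(\<integral>\<^sup>+w. ennreal (K * e * ((circ_norm (F w))\<^sup>2 + (circ_norm (G w))\<^sup>2)) \<partial>lborel)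
              = (\<integral>\<^sup>+w. ennreal (K * e) * (ennreal ((circ_norm (F w))\<^sup>2) + ennreal ((circ_norm (G w))\<^sup>2)) \<partial>lborel)"
            using k by (intro nn_integral_cong) (simp add: ennreal_plus[symmetric] ennreal_mult' del: ennreal_plus)
          also have "\<dots> = ennreal (K * e) *
              ((\<integral>\<^sup>+w. ennreal ((circ_norm (F w))\<^sup>2) \<partial>lborel) + (\<integral>\<^sup>+w. ennreal ((circ_norm (G w))\<^sup>2) \<partial>lborel))"
            by (subst nn_integral_cmult) (simp_all add: nn_integral_add)
          also have "\<dots> = ennreal (K * e) * (ennreal (exp (4 * (norm x)\<^sup>2)) * ennreal ((norm u)\<^sup>2)
              + ennreal (exp (4 * (norm x)\<^sup>2)) * ennreal ((norm v)\<^sup>2))"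
            unfolding F_def G_def nn_integral_circ_norm_loc[OF f] nn_integral_circ_norm_loc[OF g] nf ng ..
          also have "\<dots> = ennreal (K * e * exp (4 * (norm x)\<^sup>2) * s)"
            unfolding s_def using k
            by (simp add: ennreal_plus[symmetric] ennreal_mult'[symmetric] distrib_left mult.assoc del: ennreal_plus)
          finally show ?thesis by simp
        qed
        also have "\<dots> \<le> ennreal (E x)"
        proof (rule ennreal_leI)
          have "(norm x)\<^sup>2 \<le> R\<^sup>2" using x by (intro power_mono) auto
          then have "K * e * exp (4 * (norm x)\<^sup>2) \<le> K * e * exp (4 * R\<^sup>2)"
            using K e by (intro mult_left_mono) auto
          also have "\<dots> \<le> indicator B x * (K * e * exp (4 * R\<^sup>2)) + K * exp (- R\<^sup>2 / 128) * exp (- (1 / 128) * (norm x)\<^sup>2)"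
            using True K by simp
          finally show "K * e * exp (4 * (norm x)\<^sup>2) * s \<le> E x"
            unfolding E_def using s by (rule mult_right_mono)
        qed
        finally show ?thesis .
      next
        case False
        then have x: "R < norm x" by (simp add: B_def)
        have "(\<integral>\<^sup>+w. ennreal (norm (q (w + x) w - r x w)) \<partial>lborel) = (\<integral>\<^sup>+w. ennreal (norm (q (w + x) w)) \<partial>lborel)"
          using False by (simp add: r_def)
        also have "\<dots> \<le> ennreal (K * exp (- (1 / 64) * (norm x)\<^sup>2) * s)" by (rule nnq)
        also have "\<dots> \<le> ennreal (E x)"
        proof (rule ennreal_leI)
          \<comment> \<open>Outside \<open>B\<close> the replacement \<open>r\<close> is 0, and half
            of the exponent of the decay bound for \<open>q\<close> is at most -R^2/128.\<close>
          have "R\<^sup>2 \<le> (norm x)\<^sup>2" using x R by (intro power_mono) auto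
          then have "exp (- (1 / 64) * (norm x)\<^sup>2) \<le> exp (- R\<^sup>2 / 128) * exp (- (1 / 128) * (norm x)\<^sup>2)"
            unfolding exp_add[symmetric] by simp
          then have "K * exp (- (1 / 64) * (norm x)\<^sup>2) \<le> K * (exp (- R\<^sup>2 / 128) * exp (- (1 / 128) * (norm x)\<^sup>2))"
            using K by (rule mult_left_mono)
          then show "K * exp (- (1 / 64) * (norm x)\<^sup>2) * s \<le> E x"
            unfolding E_def using False s by (intro mult_right_mono) (simp_all add: mult.assoc)
        qed
        finally show ?thesis .
      qed
      moreover have "ennreal (norm (\<integral>w. q (w + x) w - r x w \<partial>lborel)) \<le> (\<integral>\<^sup>+w. ennreal (norm (q (w + x) w - r x w)) \<partial>lborel)"
        by (rule integral_norm_bound_ennreal[OF i])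
      ultimately have "ennreal (norm (\<integral>w. q (w + x) w - r x w \<partial>lborel)) \<le> ennreal (E x)" by (rule order.trans[rotated])
      then have "norm (\<integral>w. q (w + x) w - r x w \<partial>lborel) \<le> E x" using E0 by (simp only: ennreal_le_iff)
      then show ?thesis using qint r_int by simp
    qed
    have "cinner (C u) v - cinner (toeplitz \<Phi> u) v
        = (\<integral>x. (\<integral>w. q (w + x) w \<partial>lborel) - (\<integral>w. r x w \<partial>lborel) \<partial>lborel)"
      unfolding C_eq T_eq by (rule Bochner_Integration.integral_diff[OF X_int Y_int, symmetric])
    then have "norm (cinner (C u) v - cinner (toeplitz \<Phi> u) v) \<le> (\<integral>x. E x \<partial>lborel)"
      using Bochner_Integration.integral_norm_bound_integral[OF Bochner_Integration.integrable_diff[OF X_int Y_int] E_int bound] by simp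
    also have "\<dots> = (V * (K * e * exp (4 * R\<^sup>2)) + K * exp (- R\<^sup>2 / 128) * I) * s"
      unfolding E_def[abs_def] I_def V_def using intB intI by simp
    also have "\<dots> \<le> (\<eta> / 2 + \<eta> / 2) * s"
      using R(2) eV s by (intro mult_right_mono add_mono) (simp_all add: mult_ac)
    finally show ?thesis by (simp add: s_def)
  qed
  with \<Phi> show ?thesis by blast
qed

section \<open>The Toeplitz algebra\<close>

text \<open>Testing against the multiple of \<open>D u\<close> that has the norm of u balances the
  two squares.\<close>

lemma norm_le_of_form_bound:
  fixes D :: "'a::complex_inner \<Rightarrow>\<^sub>L 'a"
  assumes b: "\<And>u v. norm (cinner (D u) v) \<le> \<eta> * ((norm u)\<^sup>2 + (norm v)\<^sup>2)" and "\<eta> \<ge> 0"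
  shows "norm D \<le> 2 * \<eta>"
proof (rule norm_blinfun_bound)
  fix u
  show "norm (D u) \<le> 2 * \<eta> * norm u"
  proof (cases "u = 0 \<or> D u = 0")
    case False
    define d where "d = norm (D u)"
    define t where "t = norm u / d"
    have d: "d > 0" and u: "norm u > 0" using False by (simp_all add: d_def)
    have "norm (cinner (D u) (t *\<^sub>R D u)) = t * d\<^sup>2"
      using d by (simp add: cinner_scaleR_right cinner_self d_def t_def norm_power)
    also have "\<dots> = norm u * d" using d by (simp add: t_def power2_eq_square)
    finally have "norm u * d \<le> \<eta> * ((norm u)\<^sup>2 + (norm (t *\<^sub>R D u))\<^sup>2)"
      using b[of u "t *\<^sub>R D u"] by simp
    also have "norm (t *\<^sub>R D u) = norm u"
      using d by (simp add: t_def d_def)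
    finally have "norm u * d \<le> norm u * (2 * \<eta> * norm u)" by (simp add: power2_eq_square algebra_simps)
    then show ?thesis using u by (simp add: d_def)
  qed (use assms(2) in auto)
qed (use assms(2) in simp)

section \<open>Linearity and adjoints of Toeplitz operators\<close>

lemma Linf_zero: "(\<lambda>_. 0) \<in> Linf"
  by (auto simp: Linf_def intro!: exI[of _ 0])

lemma Linf_add:
  assumes "f \<in> Linf" "g \<in> Linf" shows "(\<lambda>z. f z + g z) \<in> Linf"
proof -
  obtain C where C: "AE z in lborel. norm (f z) \<le> C" using assms(1) by (auto simp: Linf_def)
  obtain D where D: "AE z in lborel. norm (g z) \<le> D" using assms(2) by (auto simp: Linf_def)
  have "AE z in lborel. norm (f z + g z) \<le> C + D"
    using C D by eventually_elim (rule norm_triangle_mono)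
  then show ?thesis using assms by (auto simp: Linf_def)
qed

lemma Linf_cnj: "f \<in> Linf \<Longrightarrow> (\<lambda>z. cnj (f z)) \<in> Linf"
  by (auto simp: Linf_def)

lemma Linf_const: "(\<lambda>_. c) \<in> Linf"
  by (auto simp: Linf_def intro!: exI[of _ "norm c"])

lemma mult_op_add:
  assumes "f \<in> Linf" "g \<in> Linf" shows "mult_op (\<lambda>z. f z + g z) = mult_op f + mult_op g"
proof (rule blinfun_eqI)
  fix u :: "'a l2"
  obtain h where h: "sq_integrable h" "u = l2_class h" using l2_cases by metis
  show "(mult_op (\<lambda>z. f z + g z)) u = (mult_op f + mult_op g) u"
    using assms h Linf_add[OF assms]
    by (simp add: mult_op_class blinfun.add_left plus_l2_class sq_integrable_Linf_mult distrib_right)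
qed

lemma mult_op_cmult:
  assumes "f \<in> Linf" shows "(mult_op (\<lambda>z. c * f z)) u = scaleC c (mult_op f u)"
  by (rule l2_cases[of u])
    (simp add: mult_op_class assms mult_op_mult(1)[OF Linf_const] scaleC_l2_class sq_integrable_Linf_mult mult.assoc)

lemma cinner_mult_op:
  assumes "f \<in> Linf"
  shows "cinner (mult_op f u) v = cinner u ((mult_op (\<lambda>z. cnj (f z))) v)"
proof -
  obtain g where g: "sq_integrable g" "u = l2_class g" using l2_cases by metis
  obtain h where h: "sq_integrable h" "v = l2_class h" using l2_cases by metis
  show ?thesis
    by (simp add: g h mult_op_class assms Linf_cnj cinner_l2_class sq_integrable_Linf_mult) (simp add: mult_ac)
qed

lemma toeplitz_add: "f \<in> Linf \<Longrightarrow> g \<in> Linf \<Longrightarrow> toeplitz f + toeplitz g = toeplitz (\<lambda>z. f z + g z)"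
  unfolding toeplitz_def by (intro blinfun_eqI) (simp add: mult_op_add blinfun.add_left blinfun.add_right)

lemma toeplitz_cmult: "f \<in> Linf \<Longrightarrow> scaleC_op c (toeplitz f) = toeplitz (\<lambda>z. c * f z)"
  unfolding toeplitz_def by (intro blinfun_eqI) (simp add: scaleC_op.rep_eq mult_op_cmult fock_proj_scaleC)

lemma toeplitz_zero: "toeplitz (\<lambda>_. 0) = 0"
  unfolding toeplitz_def by (intro blinfun_eqI) (simp add: mult_op_eq_0 Linf_zero)

lemma toeplitz_adjoint: "f \<in> Linf \<Longrightarrow> is_adjoint (toeplitz f) (toeplitz (\<lambda>z. cnj (f z)))"
  unfolding is_adjoint_def toeplitz_def
  by (simp add: cinner_fock_proj cinner_fock_proj_right cinner_mult_op)

lemma toeplitz_in_operators: "toeplitz f \<in> operators"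
  unfolding toeplitz_def by (rule compression_in_operators[OF mult_op_in_operators])

section \<open>Passing between the Fock space and L^2\<close>

definition compress :: "('n::finite l2 \<Rightarrow>\<^sub>L 'n l2) \<Rightarrow> 'n fock \<Rightarrow>\<^sub>L 'n fock" where
  "compress A = fock_proj o\<^sub>L A o\<^sub>L fock_incl"

text \<open>\<open>X\<close> on the Fock space and 0 on its orthogonal complement. Since the
  projection is the identity on the Fock space, this is a multiplicative right inverse of
  \<open>compress\<close>, which itself is not multiplicative.\<close>

definition extend :: "('n::finite fock \<Rightarrow>\<^sub>L 'n fock) \<Rightarrow> 'n l2 \<Rightarrow>\<^sub>L 'n l2" where
  "extend X = fock_incl o\<^sub>L X o\<^sub>L fock_proj"

lemma tendsto_compose_blinfun:
  "(a \<longlongrightarrow> A) F \<Longrightarrow> ((\<lambda>n. S o\<^sub>L a n o\<^sub>L T) \<longlongrightarrow> (S o\<^sub>L A o\<^sub>L T)) F"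
  by (intro bounded_bilinear.tendsto[OF bounded_bilinear_blinfun_compose] tendsto_const)

lemma compress_extend: "compress (extend X) = X"
proof (rule blinfun_eqI)
  fix u
  have id: "fock_proj (fock_incl x) = x" for x :: "'a fock"
    by (metis fock_proj_incl blinfun_apply_blinfun_compose blinfun_apply_id_blinfun)
  show "(compress (extend X)) u = X u"
    by (simp add: compress_def extend_def id)
qed

lemma extend_toeplitz: "extend (toeplitz f) = kernel_op UNIV o\<^sub>L mult_op f o\<^sub>L kernel_op UNIV"
  unfolding extend_def toeplitz_def fock_incl_proj[symmetric] by (intro blinfun_eqI) simp

lemma extend_compose: "extend (X o\<^sub>L Y) = extend X o\<^sub>L extend Y"
proof (rule blinfun_eqI)
  fix u
  have id: "fock_proj (fock_incl x) = x" for x :: "'a fock"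
    by (metis fock_proj_incl blinfun_apply_blinfun_compose blinfun_apply_id_blinfun)
  show "(extend (X o\<^sub>L Y)) u = (extend X o\<^sub>L extend Y) u"
    by (simp add: extend_def id)
qed

lemma extend_toeplitz_in_BDO: "f \<in> Linf \<Longrightarrow> extend (toeplitz f) \<in> BDO"
  unfolding extend_toeplitz by (intro BDO_compose kernel_op_in_BDO band_in_BDO band_mult_op)

text \<open>The kernels lie in the Fock space, so \<open>A\<close> and its compression have the same
  matrix elements between them, and the decay for \<open>A\<close> is the hypothesis that the
  approximation theorem needs.\<close>

lemma compress_band_in_closure:
  fixes A :: "'n::finite l2 \<Rightarrow>\<^sub>L 'n l2"
  assumes A: "band_operator A"
  shows "compress A \<in> closure (toeplitz ` Linf)"
proof -
  define C where "C = compress A"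
  have C: "C \<in> operators"
    unfolding C_def compress_def using A by (intro compression_in_operators) (simp add: band_operator_def)
  obtain K where K: "K \<ge> 0"
    "\<And>z w. norm (cinner (A (l2_class (kern w))) (l2_class (kern z)))
      \<le> K * exp (- (1 / 64) * (norm (z - w))\<^sup>2) * (exp ((norm w)\<^sup>2 / 2) * exp ((norm z)\<^sup>2 / 2))"
    by (rule band_operator_decay[OF A]) (rule that)
  have dec: "norm (symb C z w) \<le> K * exp (- (1 / 64) * (norm (z - w))\<^sup>2)" for z w
  proof -
    define p where "p = pi ^ CARD('n)"
    have p: "1 \<le> p" unfolding p_def using pi_ge_two by (intro one_le_power) simp
    define E where "E = exp ((norm w)\<^sup>2 / 2) * exp ((norm z)\<^sup>2 / 2)"
    have E: "exp (- (norm z)\<^sup>2 / 2) * exp (- (norm w)\<^sup>2 / 2) = 1 / E"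
      by (simp add: E_def exp_minus field_simps)
    have E0: "E > 0" by (simp add: E_def)
    have "cinner (C (kfock w)) (kfock z) = cinner (A (l2_class (kern w))) (l2_class (kern z))"
      by (simp add: C_def compress_def cinner_fock_proj fock_incl_apply kfock.rep_eq)
    then have "norm (symb C z w) = norm (cinner (A (l2_class (kern w))) (l2_class (kern z))) * (1 / E / p)"
      unfolding symb_def E p_def[symmetric] norm_mult norm_of_real using E0 p by simp
    also have "\<dots> \<le> (K * exp (- (1 / 64) * (norm (z - w))\<^sup>2) * E) * (1 / E / p)"
      using K(2)[of w z] E0 p unfolding E_def[symmetric] by (intro mult_right_mono) auto
    also have "\<dots> = (K * exp (- (1 / 64) * (norm (z - w))\<^sup>2)) / p" using E0 by simp
    also have "\<dots> \<le> (K * exp (- (1 / 64) * (norm (z - w))\<^sup>2)) / 1"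
      using K(1) p by (intro divide_left_mono mult_nonneg_nonneg) auto
    finally show ?thesis by simp
  qed
  have "\<exists>T\<in>toeplitz ` Linf. dist T C < e" if e: "e > 0" for e
  proof -
    \<comment> \<open>The passage from the form to the operator norm doubles the constant, leaving
      e/2 < e.\<close>
    from toeplitz_approx[OF C K(1) dec, of "e / 4"] e
    obtain F where F: "F \<in> Linf"
      "\<And>u v. norm (cinner (C u) v - cinner (toeplitz F u) v) \<le> e / 4 * ((norm u)\<^sup>2 + (norm v)\<^sup>2)"
      by auto
    have "norm (C - toeplitz F) \<le> 2 * (e / 4)"
      by (rule norm_le_of_form_bound) (use F(2) e in \<open>simp_all add: blinfun.diff_left cinner_diff_left\<close>)
    then have "dist (toeplitz F) C < e" using e by (simp add: dist_norm norm_minus_commute)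
    then show ?thesis using F(1) by blast
  qed
  then show ?thesis unfolding C_def[symmetric] closure_approachable by blast
qed

lemma closure_toeplitz: "closure (toeplitz ` Linf) = compress ` (BDO :: ('n::finite l2 \<Rightarrow>\<^sub>L 'n l2) set)"
proof
  show "compress ` BDO \<subseteq> closure (toeplitz ` Linf :: ('n fock \<Rightarrow>\<^sub>L 'n fock) set)"
  proof clarify
    fix A :: "'n l2 \<Rightarrow>\<^sub>L 'n l2" assume "A \<in> BDO"
    then obtain a where a: "\<And>n. band_operator (a n)" "a \<longlonglongrightarrow> A"
      unfolding BDO_def closure_sequential by auto
    have "(\<lambda>n. compress (a n)) \<longlonglongrightarrow> compress A"
      unfolding compress_def by (rule tendsto_compose_blinfun[OF a(2)])
    then show "compress A \<in> closure (toeplitz ` Linf)"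
      by (rule closed_sequentially[OF closed_closure compress_band_in_closure[OF a(1)]])
  qed
  show "closure (toeplitz ` Linf) \<subseteq> compress ` (BDO :: ('n l2 \<Rightarrow>\<^sub>L 'n l2) set)"
  proof
    fix X :: "'n fock \<Rightarrow>\<^sub>L 'n fock" assume "X \<in> closure (toeplitz ` Linf)"
    then obtain t where t: "\<And>n. t n \<in> toeplitz ` Linf" "t \<longlonglongrightarrow> X"
      unfolding closure_sequential by auto
    have "(\<lambda>n. extend (t n)) \<longlonglongrightarrow> extend X"
      unfolding extend_def by (rule tendsto_compose_blinfun[OF t(2)])
    moreover have "extend (t n) \<in> BDO" for n using t(1)[of n] extend_toeplitz_in_BDO by auto
    ultimately have "extend X \<in> BDO" by (rule closed_sequentially[OF closed_BDO, rotated])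
    then show "X \<in> compress ` BDO" by (metis compress_extend imageI)
  qed
qed

lemma closed_operators: "closed (operators :: ('a::complex_inner \<Rightarrow>\<^sub>L 'a) set)"
proof -
  have cont: "continuous_on UNIV (scaleC c :: 'a \<Rightarrow> 'a)" for c
  proof -
    have "bounded_linear (scaleC c :: 'a \<Rightarrow> 'a)"
      by (rule bounded_linear_intro[where K = "norm c"])
        (simp_all add: scaleC_add_right norm_scaleC mult.commute scaleC_scaleC flip: scaleC_of_real)
    then show ?thesis by (simp add: linear_continuous_on)
  qed
  show ?thesis
    unfolding closed_sequential_limits
  proof (intro allI impI, elim conjE)
    fix a :: "nat \<Rightarrow> 'a \<Rightarrow>\<^sub>L 'a" and A
    assume a: "\<forall>n. a n \<in> operators" "a \<longlonglongrightarrow> A"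
    have lim: "(\<lambda>n. (a n) x) \<longlonglongrightarrow> A x" for x
      by (intro blinfun.tendsto a tendsto_const)
    have "A (scaleC c x) = scaleC c (A x)" for c x
    proof (rule LIMSEQ_unique[OF lim])
      have "(\<lambda>n. scaleC c ((a n) x)) \<longlonglongrightarrow> scaleC c (A x)"
        by (rule continuous_on_tendsto_compose[OF cont lim]) simp_all
      then show "(\<lambda>n. (a n) (scaleC c x)) \<longlonglongrightarrow> scaleC c (A x)"
        using a(1) by (simp add: operators_def)
    qed
    then show "A \<in> operators" by (simp add: operators_def)
  qed
qed

lemma bounded_linear_scaleC_op: "bounded_linear (scaleC_op c :: ('a::complex_inner \<Rightarrow>\<^sub>L 'a) \<Rightarrow> _)"
proof (rule bounded_linear_intro[where K = "norm c"])
  fix A B :: "'a \<Rightarrow>\<^sub>L 'a" and r :: real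
  show "scaleC_op c (A + B) = scaleC_op c A + scaleC_op c B"
    by (intro blinfun_eqI) (simp add: scaleC_op.rep_eq blinfun.add_left scaleC_add_right)
  show "scaleC_op c (r *\<^sub>R A) = r *\<^sub>R scaleC_op c A"
    by (intro blinfun_eqI)
      (simp add: scaleC_op.rep_eq blinfun.scaleR_left scaleC_scaleC mult.commute flip: scaleC_of_real)
  show "norm (scaleC_op c A) \<le> norm A * norm c"
  proof (rule norm_blinfun_bound)
    fix x
    have "norm c * norm (A x) \<le> norm c * (norm A * norm x)"
      by (intro mult_left_mono norm_blinfun) simp
    then show "norm (scaleC_op c A x) \<le> norm A * norm c * norm x"
      by (simp add: scaleC_op.rep_eq norm_scaleC mult_ac)
  qed simp
qed

lemma c_star_subalgebra_closure_toeplitz: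
  "c_star_subalgebra (closure (toeplitz ` Linf) :: ('n::finite fock \<Rightarrow>\<^sub>L 'n fock) set)"
proof -
  let ?S = "closure (toeplitz ` Linf) :: ('n fock \<Rightarrow>\<^sub>L 'n fock) set"
  have T: "toeplitz f \<in> ?S" if "f \<in> Linf" for f
    by (rule subsetD[OF closure_subset imageI[OF that]])
  have op: "?S \<subseteq> operators"
    using closed_operators by (intro closure_minimal) (auto intro: toeplitz_in_operators)
  have seq: "\<exists>f. (\<forall>n. f n \<in> Linf) \<and> (\<lambda>n. toeplitz (f n)) \<longlonglongrightarrow> X" if X: "X \<in> ?S" for X
  proof -
    obtain t where t: "\<And>n. t n \<in> toeplitz ` Linf" "t \<longlonglongrightarrow> X"
      using X unfolding closure_sequential by auto
    then have "\<forall>n. \<exists>f. f \<in> Linf \<and> t n = toeplitz f" by blast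
    then obtain f where "\<forall>n. f n \<in> Linf \<and> t n = toeplitz (f n)" by metis
    moreover from this have "t = (\<lambda>n. toeplitz (f n))" by auto
    ultimately show ?thesis using t(2) by metis
  qed
  have lim: "X \<in> ?S" if "\<And>n. x n \<in> ?S" "x \<longlonglongrightarrow> X" for x X
    by (rule closed_sequentially[OF closed_closure that])
  have add: "A + B \<in> ?S" if A: "A \<in> ?S" and B: "B \<in> ?S" for A B
  proof -
    obtain f where f: "\<forall>n. f n \<in> Linf" "(\<lambda>n. toeplitz (f n)) \<longlonglongrightarrow> A" using seq[OF A] by blast
    obtain g where g: "\<forall>n. g n \<in> Linf" "(\<lambda>n. toeplitz (g n)) \<longlonglongrightarrow> B" using seq[OF B] by blast
    show ?thesis
      by (rule lim[OF _ tendsto_add[OF f(2) g(2)]]) (use f g in \<open>simp add: toeplitz_add T Linf_add\<close>)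
  qed
  have scale: "scaleC_op c A \<in> ?S" if A: "A \<in> ?S" for c A
  proof -
    obtain f where f: "\<forall>n. f n \<in> Linf" "(\<lambda>n. toeplitz (f n)) \<longlonglongrightarrow> A" using seq[OF A] by blast
    show ?thesis
      by (rule lim[OF _ bounded_linear.tendsto[OF bounded_linear_scaleC_op f(2)]])
        (use f in \<open>simp add: toeplitz_cmult T mult_op_mult(1)[OF Linf_const]\<close>)
  qed
  have mult: "A o\<^sub>L B \<in> ?S" if A: "A \<in> ?S" and B: "B \<in> ?S" for A B
  proof -
    have ext: "extend X \<in> BDO" if "X \<in> ?S" for X
    proof -
      obtain f where f: "\<forall>n. f n \<in> Linf" "(\<lambda>n. toeplitz (f n)) \<longlonglongrightarrow> X" using seq[OF \<open>X \<in> ?S\<close>] by blast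
      have "(\<lambda>n. extend (toeplitz (f n))) \<longlonglongrightarrow> extend X"
        unfolding extend_def by (rule tendsto_compose_blinfun[OF f(2)])
      moreover have "extend (toeplitz (f n)) \<in> BDO" for n using f(1) by (intro extend_toeplitz_in_BDO) simp
      ultimately show ?thesis by (rule closed_sequentially[OF closed_BDO, rotated])
    qed
    have "extend (A o\<^sub>L B) \<in> BDO" unfolding extend_compose by (intro BDO_compose ext A B)
    then have "compress (extend (A o\<^sub>L B)) \<in> ?S" unfolding closure_toeplitz by (rule imageI)
    then show ?thesis unfolding compress_extend .
  qed
  have adj: "hadjoint A \<in> ?S" if A: "A \<in> ?S" for A
  proof -
    obtain f where f: "\<forall>n. f n \<in> Linf" "(\<lambda>n. toeplitz (f n)) \<longlonglongrightarrow> A" using seq[OF A] by blast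
    \<comment> \<open>The adjoint of a difference is no larger in norm than the difference, so the
      Toeplitz operators with conjugate symbols converge to the adjoint of the limit.\<close>
    have le: "norm (toeplitz (\<lambda>z. cnj (f n z)) - hadjoint A) \<le> norm (toeplitz (f n) - A)" for n
      using f(1) A op by (intro is_adjoint_norm_le is_adjoint_diff toeplitz_adjoint adjoint_exists) auto
    have "(\<lambda>n. toeplitz (f n) - A) \<longlonglongrightarrow> 0" using f(2) by (rule LIM_zero)
    then have "(\<lambda>n. norm (toeplitz (f n) - A)) \<longlonglongrightarrow> 0" by (rule tendsto_norm_zero)
    then have "(\<lambda>n. toeplitz (\<lambda>z. cnj (f n z)) - hadjoint A) \<longlonglongrightarrow> 0"
      by (rule Lim_null_comparison[rotated]) (rule always_eventually, rule allI, rule le)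
    then have "(\<lambda>n. toeplitz (\<lambda>z. cnj (f n z))) \<longlonglongrightarrow> hadjoint A" by (rule LIM_zero_cancel)
    then show ?thesis by (rule lim[rotated]) (use f in \<open>simp add: T Linf_cnj\<close>)
  qed
  show ?thesis
    unfolding c_star_subalgebra_def
    using op add scale mult adj T[OF Linf_zero] by (simp add: toeplitz_zero)
qed

lemma toeplitz_algebra_eq: "toeplitz_algebra = closure (toeplitz ` Linf)"
proof
  show "toeplitz_algebra \<subseteq> closure (toeplitz ` Linf)"
    unfolding toeplitz_algebra_def c_star_generated_def
    by (rule Inf_lower) (simp add: c_star_subalgebra_closure_toeplitz closure_subset)
  show "closure (toeplitz ` Linf) \<subseteq> toeplitz_algebra"
    unfolding toeplitz_algebra_def c_star_generated_def
    by (intro Inf_greatest closure_minimal) (auto simp: c_star_subalgebra_def)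
qed

theorem theorem4p20:
  "(toeplitz_algebra :: ('n::finite fock \<Rightarrow>\<^sub>L 'n fock) set) =
     {fock_proj o\<^sub>L A o\<^sub>L fock_incl |A. A \<in> BDO}"
  unfolding toeplitz_algebra_eq closure_toeplitz compress_def by blast

end
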